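(* For every nonempty finite set $N$, the poset $\Pi^{\mathrm{ComTriAss}}_+(N)$ is Cohen-Macaulay. Moreover, $\Lambda\hat h(\Pi^{\mathrm{ComTriAss}})\cong\mathrm{Mag}$ as species; that is, up to suspension, the homology of $\Pi^{\mathrm{ComTriAss}}_+$ is isomorphic to the species $\mathrm{Mag}$.
   Context: The ground field $\Bbbk$ has characteristic $0$. A finite bounded graded poset is Cohen-Macaulay (over $\Bbbk$) if for all $x<y$ the reduced homology with coefficients in $\Bbbk$ of the order complex of the open interval $(x,y)$ vanishes except possibly in its top dimension, i.e. in degree $\mathrm{rk}(y)-\mathrm{rk}(x)-2$. $\mathrm{ComTriAss}$ is the commutative triassociative set-operad (whose linearization is Koszul dual to $\mathrm{PostLie}$): $\mathrm{ComTriAss}(N)$ is the set of nonempty subsets of the finite set $N$; for a partition $\pi$ of $N$, a nonempty $S\subset\pi$ and nonempty $S_B\subset B$ ($B\in\pi$), composition is $\gamma(S;(S_B)_{B\in\pi})=\bigcup_{B\in S}S_B$. $\Pi^{\mathrm{ComTriAss}}(N)$ is the set of partitions $\pi$ of $N$ with a decoration $p_B\in\mathrm{ComTriAss}(B)$ of each block $B\in\pi$. With coarser partitions being smaller, $(\sigma,(p'_A)_{A\in\sigma})\le(\pi,(p_B)_{B\in\pi})$ iff $\pi$ refines $\sigma$ and for every $A\in\sigma$ there is $r\in\mathrm{ComTriAss}(\{B\in\pi:B\subset A\})$ with $p'_A=\gamma(r;(p_B)_{B\subset A})$. The greatest element is the partition into singletons; $\Pi^{\mathrm{ComTriAss}}_+(N)$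 is obtained by adjoining a new least element. For $|N|=n$, $\Lambda\hat h(\Pi^{\mathrm{ComTriAss}})(N)$ denotes $\tilde H_{n-2}(\Delta;\Bbbk)\otimes\mathrm{sgn}_N$, where $\Delta$ is the order complex of $\Pi^{\mathrm{ComTriAss}}_+(N)$ with its least and greatest elements removed (with $\tilde H_{-1}(\emptyset)=\Bbbk$), and $\mathrm{sgn}_N$ is the sign representation of the symmetric group of $N$; this is a linear species in $N$. $\mathrm{Mag}$ is the linear species underlying the magmatic operad (free operad on one binary operation without symmetry): $\mathrm{Mag}(N)$ has as basis the planar binary trees with leaves labelled bijectively by $N$. *)

theory Defs
  imports Complex_Main
    "HOL-Library.Disjoint_Sets" "HOL-Library.FuncSet" "HOL-Library.Poly_Mapping"
    "HOL-Combinatorics.Permutations"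
    "HOL-Algebra.AbelCoset" "HOL-Algebra.Module"
begin

section \<open>Vector spaces\<close>

text \<open>
  Vector spaces over the field \<open>'k\<close> are module records. The ring multiplication and unit which such
  a record carries along are irrelevant and left \<open>undefined\<close>.
\<close>

definition scale :: "'k \<Rightarrow> ('b \<Rightarrow>\<^sub>0 'k) \<Rightarrow> ('b \<Rightarrow>\<^sub>0 'k::field)" where
  "scale a c = Poly_Mapping.map ((*) a) c"

definition free_space :: "'b set \<Rightarrow> ('k::field, 'b \<Rightarrow>\<^sub>0 'k) module" where
  "free_space S = \<lparr>carrier = {c. Poly_Mapping.keys c \<subseteq> S}, mult = undefined, one = undefined,
     zero = 0, add = (+), smult = scale\<rparr>"

text \<open>The linear extension of a map of basis elements.\<close>

definition pushforward :: "('b \<Rightarrow> 'c) \<Rightarrow> ('b \<Rightarrow>\<^sub>0 'k) \<Rightarrow> ('c \<Rightarrow>\<^sub>0 'k::field)" where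
  "pushforward f c =
     (\<Sum>x\<in>Poly_Mapping.keys c. Poly_Mapping.single (f x) (Poly_Mapping.lookup c x))"

text \<open>
  The quotient of \<open>V\<close> by a subspace \<open>U\<close>; its vectors are cosets. The scalar multiple of a coset is
  not the elementwise one, which would be wrong for the scalar \<open>0\<close>.
\<close>

definition quotient_space :: "('k, 'v) module \<Rightarrow> 'v set \<Rightarrow> ('k, 'v set) module" where
  "quotient_space V U = \<lparr>carrier = a_rcosets\<^bsub>V\<^esub> U, mult = undefined, one = undefined,
     zero = U, add = (<+>\<^bsub>V\<^esub>),
     smult = (\<lambda>a C. \<Union>x\<in>C. U +>\<^bsub>V\<^esub> (a \<odot>\<^bsub>V\<^esub> x))\<rparr>"

definition linear_iso :: "('k, 'v) module \<Rightarrow> ('k, 'w) module \<Rightarrow> ('v \<Rightarrow> 'w) \<Rightarrow> bool" where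
  "linear_iso V W \<phi> \<longleftrightarrow> bij_betw \<phi> (carrier V) (carrier W)
     \<and> (\<forall>x\<in>carrier V. \<forall>y\<in>carrier V. \<phi> (x \<oplus>\<^bsub>V\<^esub> y) = \<phi> x \<oplus>\<^bsub>W\<^esub> \<phi> y)
     \<and> (\<forall>a. \<forall>x\<in>carrier V. \<phi> (a \<odot>\<^bsub>V\<^esub> x) = a \<odot>\<^bsub>W\<^esub> \<phi> x)"

text \<open>
  \<open>V \<otimes> W\<close> is the free space on pairs of vectors modulo the subspace generated by the bilinearity
  relations.
\<close>

inductive_set tensor_relations ::
    "('k::field, 'v) module \<Rightarrow> ('k, 'w) module \<Rightarrow> ('v \<times> 'w \<Rightarrow>\<^sub>0 'k) set"
  for V :: "('k, 'v) module" and W :: "('k, 'w) module" where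
  add_left: "\<lbrakk>v \<in> carrier V; v' \<in> carrier V; w \<in> carrier W\<rbrakk> \<Longrightarrow>
    Poly_Mapping.single (v \<oplus>\<^bsub>V\<^esub> v', w) 1 - Poly_Mapping.single (v, w) 1
      - Poly_Mapping.single (v', w) 1 \<in> tensor_relations V W"
| add_right: "\<lbrakk>v \<in> carrier V; w \<in> carrier W; w' \<in> carrier W\<rbrakk> \<Longrightarrow>
    Poly_Mapping.single (v, w \<oplus>\<^bsub>W\<^esub> w') 1 - Poly_Mapping.single (v, w) 1
      - Poly_Mapping.single (v, w') 1 \<in> tensor_relations V W"
| smult_left: "\<lbrakk>v \<in> carrier V; w \<in> carrier W\<rbrakk> \<Longrightarrow>
    Poly_Mapping.single (a \<odot>\<^bsub>V\<^esub> v, w) 1 - Poly_Mapping.single (v, w) a \<in> tensor_relations V W"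
| smult_right: "\<lbrakk>v \<in> carrier V; w \<in> carrier W\<rbrakk> \<Longrightarrow>
    Poly_Mapping.single (v, a \<odot>\<^bsub>W\<^esub> w) 1 - Poly_Mapping.single (v, w) a \<in> tensor_relations V W"
| zero: "0 \<in> tensor_relations V W"
| add: "\<lbrakk>x \<in> tensor_relations V W; y \<in> tensor_relations V W\<rbrakk> \<Longrightarrow> x + y \<in> tensor_relations V W"
| scale: "x \<in> tensor_relations V W \<Longrightarrow> scale a x \<in> tensor_relations V W"

definition tensor_space ::
    "('k::field, 'v) module \<Rightarrow> ('k, 'w) module \<Rightarrow> ('k, ('v \<times> 'w \<Rightarrow>\<^sub>0 'k) set) module" where
  "tensor_space V W =
     quotient_space (free_space (carrier V \<times> carrier W)) (tensor_relations V W)"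

section \<open>Linear species\<close>

text \<open>
  A linear species on the finite sets of elements of \<open>'a\<close>: \<open>space F N\<close> is the vector space \<open>F(N)\<close>, and
  \<open>transport F N f\<close> is the map from \<open>F(N)\<close> to \<open>F(f ` N)\<close> induced by a map \<open>f\<close> that is injective on
  \<open>N\<close>. Values of \<open>transport\<close> outside the carrier of \<open>F(N)\<close> are irrelevant.
\<close>

record ('a, 'k, 'v) species =
  space :: "'a set \<Rightarrow> ('k, 'v) module"
  transport :: "'a set \<Rightarrow> ('a \<Rightarrow> 'a) \<Rightarrow> 'v \<Rightarrow> 'v"

definition species_isomorphic :: "('a, 'k, 'v) species \<Rightarrow> ('a, 'k, 'w) species \<Rightarrow> bool" where
  "species_isomorphic F G \<longleftrightarrow> (\<exists>\<phi>.
     (\<forall>N. finite N \<longrightarrow> linear_iso (space F N) (space G N) (\<phi> N)) \<and>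
     (\<forall>N N' f. finite N \<longrightarrow> bij_betw f N N' \<longrightarrow> (\<forall>x\<in>carrier (space F N).
        \<phi> N' (transport F N f x) = transport G N f (\<phi> N x))))"

text \<open>
  The pointwise (Hadamard) product \<open>N \<mapsto> F(N) \<otimes> G(N)\<close>. Since a bijection induces isomorphisms, the
  induced map on the tensor products takes a coset to its elementwise image.
\<close>

definition hadamard ::
    "('a, 'k::field, 'v) species \<Rightarrow> ('a, 'k, 'w) species \<Rightarrow> ('a, 'k, ('v \<times> 'w \<Rightarrow>\<^sub>0 'k) set) species" where
  "hadamard F G = \<lparr>
     space = (\<lambda>N. tensor_space (space F N) (space G N)),
     transport = (\<lambda>N f C. pushforward (map_prod (transport F N f) (transport G N f)) ` C)\<rparr>"

text \<open>
  \<open>sgn_N\<close> is realised, without choosing an ordering of \<open>N\<close>, as the one-dimensional space of those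
  functions on the enumerations of \<open>N\<close> that change by the sign when the positions are permuted. A
  permutation \<open>f\<close> of \<open>N\<close> acts on it by the scalar \<open>sign f\<close>.
\<close>

definition enumerations :: "'a set \<Rightarrow> 'a list set" where
  "enumerations N = {xs. distinct xs \<and> set xs = N}"

definition sgn_space :: "'a set \<Rightarrow> ('k::field, 'a list \<Rightarrow> 'k) module" where
  "sgn_space N = \<lparr>
     carrier = {\<omega>. (\<forall>xs. xs \<notin> enumerations N \<longrightarrow> \<omega> xs = 0) \<and>
       (\<forall>xs\<in>enumerations N. \<forall>\<sigma>. \<sigma> permutes {..<length xs} \<longrightarrow>
          \<omega> (permute_list \<sigma> xs) = of_int (sign \<sigma>) * \<omega> xs)},
     mult = undefined, one = undefined, zero = (\<lambda>xs. 0),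
     add = (\<lambda>\<omega> \<omega>' xs. \<omega> xs + \<omega>' xs), smult = (\<lambda>a \<omega> xs. a * \<omega> xs)\<rparr>"

definition sgn_species :: "('a, 'k::field, 'a list \<Rightarrow> 'k) species" where
  "sgn_species = \<lparr>
     space = sgn_space,
     transport = (\<lambda>N f \<omega> xs.
       if xs \<in> enumerations (f ` N) then \<omega> (map (inv_into N f) xs) else 0)\<rparr>"

section \<open>Order complexes and the Cohen-Macaulay property\<close>

text \<open>
  A poset is given by its underlying set \<open>P\<close> and a set \<open>r\<close> of pairs, \<open>(x, y) \<in> r\<close> meaning \<open>x \<le> y\<close>.
  The \<open>d\<close>-simplices of its order complex are the strictly increasing lists of length \<open>d + 1\<close>,
  including the empty list in degree \<open>-1\<close>; thus the chain complex below is the augmented one.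
\<close>

definition order_simplices :: "'b set \<Rightarrow> 'b rel \<Rightarrow> int \<Rightarrow> 'b list set" where
  "order_simplices P r d =
     {xs. set xs \<subseteq> P \<and> sorted_wrt (\<lambda>x y. (x, y) \<in> r - Id) xs \<and> int (length xs) = d + 1}"

definition boundary :: "('b list \<Rightarrow>\<^sub>0 'k) \<Rightarrow> ('b list \<Rightarrow>\<^sub>0 'k::field)" where
  "boundary c = (\<Sum>xs\<in>Poly_Mapping.keys c. \<Sum>i<length xs.
     Poly_Mapping.single (take i xs @ drop (Suc i) xs) ((-1) ^ i * Poly_Mapping.lookup c xs))"

definition cycles :: "'b set \<Rightarrow> 'b rel \<Rightarrow> int \<Rightarrow> ('b list \<Rightarrow>\<^sub>0 'k::field) set" where
  "cycles P r d = {c \<in> carrier (free_space (order_simplices P r d)). boundary c = 0}"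

definition boundaries :: "'b set \<Rightarrow> 'b rel \<Rightarrow> int \<Rightarrow> ('b list \<Rightarrow>\<^sub>0 'k::field) set" where
  "boundaries P r d = boundary ` carrier (free_space (order_simplices P r (d + 1)))"

definition reduced_homology ::
    "'b set \<Rightarrow> 'b rel \<Rightarrow> int \<Rightarrow> ('k::field, ('b list \<Rightarrow>\<^sub>0 'k) set) module" where
  "reduced_homology P r d =
     quotient_space ((free_space (order_simplices P r d))\<lparr>carrier := cycles P r d\<rparr>)
       (boundaries P r d)"

definition open_interval :: "'b set \<Rightarrow> 'b rel \<Rightarrow> 'b \<Rightarrow> 'b \<Rightarrow> 'b set" where
  "open_interval P r x y = {z \<in> P. (x, z) \<in> r - Id \<and> (z, y) \<in> r - Id}"

definition bounded_poset :: "'b set \<Rightarrow> 'b rel \<Rightarrow> bool" where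
  "bounded_poset P r \<longleftrightarrow> (\<exists>b\<in>P. \<forall>x\<in>P. (b, x) \<in> r) \<and> (\<exists>t\<in>P. \<forall>x\<in>P. (x, t) \<in> r)"

text \<open>The rank function, normalised to vanish on minimal elements and increasing by one on covers.\<close>

definition rank_function :: "'b set \<Rightarrow> 'b rel \<Rightarrow> ('b \<Rightarrow> nat) \<Rightarrow> bool" where
  "rank_function P r rk \<longleftrightarrow>
     (\<forall>x\<in>P. (\<forall>y\<in>P. (y, x) \<notin> r - Id) \<longrightarrow> rk x = 0) \<and>
     (\<forall>x\<in>P. \<forall>y\<in>P. (x, y) \<in> r - Id \<and> open_interval P r x y = {} \<longrightarrow> rk y = Suc (rk x))"

text \<open>The dummy argument specifies the field of coefficients.\<close>

definition cohen_macaulay :: "'k::field itself \<Rightarrow> 'b set \<Rightarrow> 'b rel \<Rightarrow> bool" where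
  "cohen_macaulay _ P r \<longleftrightarrow> finite P \<and> partial_order_on P r \<and> bounded_poset P r \<and>
     (\<exists>rk. rank_function P r rk \<and>
       (\<forall>x\<in>P. \<forall>y\<in>P. (x, y) \<in> r - Id \<longrightarrow> (\<forall>d. d \<noteq> int (rk y) - int (rk x) - 2 \<longrightarrow>
          carrier (reduced_homology (open_interval P r x y) r d
              :: ('k, ('b list \<Rightarrow>\<^sub>0 'k) set) module)
            = {\<zero>\<^bsub>reduced_homology (open_interval P r x y) r d\<^esub>})))"

definition proper_part :: "'b set \<Rightarrow> 'b rel \<Rightarrow> 'b set" where
  "proper_part P r = {x \<in> P. (\<exists>y\<in>P. (x, y) \<notin> r) \<and> (\<exists>y\<in>P. (y, x) \<notin> r)}"

section \<open>The operad ComTriAss and its decorated partition posets\<close>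

definition ComTriAss :: "'b set \<Rightarrow> 'b set set" where
  "ComTriAss N = {S. S \<subseteq> N \<and> S \<noteq> {}}"

definition ComTriAss_comp :: "'a set set \<Rightarrow> ('a set \<Rightarrow> 'a set) \<Rightarrow> 'a set" where
  "ComTriAss_comp S p = (\<Union>B\<in>S. p B)"

type_synonym 'a decorated_partition = "'a set set \<times> ('a set \<Rightarrow> 'a set)"

text \<open>The extensional function space makes the family of decorations unique as a function.\<close>

definition Pi_CTA :: "'a set \<Rightarrow> 'a decorated_partition set" where
  "Pi_CTA N = {(\<pi>, p). partition_on N \<pi> \<and> p \<in> (\<Pi>\<^sub>E B\<in>\<pi>. ComTriAss B)}"

definition Pi_CTA_order :: "'a set \<Rightarrow> 'a decorated_partition rel" where
  "Pi_CTA_order N = {((\<sigma>, q), (\<pi>, p)). (\<sigma>, q) \<in> Pi_CTA N \<and> (\<pi>, p) \<in> Pi_CTA N \<and>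
     refines N \<pi> \<sigma> \<and>
     (\<forall>A\<in>\<sigma>. \<exists>r\<in>ComTriAss {B\<in>\<pi>. B \<subseteq> A}. q A = ComTriAss_comp r p)}"

text \<open>The poset with a new least element \<open>None\<close>.\<close>

definition Pi_CTA_plus :: "'a set \<Rightarrow> 'a decorated_partition option set" where
  "Pi_CTA_plus N = insert None (Some ` Pi_CTA N)"

definition Pi_CTA_plus_order :: "'a set \<Rightarrow> 'a decorated_partition option rel" where
  "Pi_CTA_plus_order N =
     Pair None ` Pi_CTA_plus N \<union> map_prod Some Some ` Pi_CTA_order N"

definition relabel :: "'a set \<Rightarrow> ('a \<Rightarrow> 'a) \<Rightarrow> 'a decorated_partition \<Rightarrow> 'a decorated_partition" where
  "relabel N f = (\<lambda>(\<pi>, p).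
     ((`) f ` \<pi>, restrict (\<lambda>B. f ` p (inv_into N f ` B)) ((`) f ` \<pi>)))"

text \<open>
  The top reduced homology of the proper part. The chain map induced by a bijection is an
  isomorphism, hence it takes a homology class to its elementwise image.
\<close>

definition homology_species ::
    "('a, 'k::field, ('a decorated_partition option list \<Rightarrow>\<^sub>0 'k) set) species" where
  "homology_species = \<lparr>
     space = (\<lambda>N. reduced_homology (proper_part (Pi_CTA_plus N) (Pi_CTA_plus_order N))
        (Pi_CTA_plus_order N) (int (card N) - 2)),
     transport = (\<lambda>N f C. pushforward (map (map_option (relabel N f))) ` C)\<rparr>"

definition Lambda_h_CTA ::
    "('a, 'k::field,
      (('a decorated_partition option list \<Rightarrow>\<^sub>0 'k) set \<times> ('a list \<Rightarrow> 'k) \<Rightarrow>\<^sub>0 'k) set) species" where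
  "Lambda_h_CTA = hadamard homology_species sgn_species"

section \<open>The species Mag\<close>

datatype 'a planar_tree = Tip 'a | Node "'a planar_tree" "'a planar_tree"

fun leaves :: "'a planar_tree \<Rightarrow> 'a list" where
  "leaves (Tip a) = [a]"
| "leaves (Node s t) = leaves s @ leaves t"

definition Mag :: "('a, 'k::field, 'a planar_tree \<Rightarrow>\<^sub>0 'k) species" where
  "Mag = \<lparr>
     space = (\<lambda>N. free_space {t. leaves t \<in> enumerations N}),
     transport = (\<lambda>N f. pushforward (map_planar_tree f))\<rparr>"

end

theory Submission
  imports Defs
begin

text \<open>
  For the Cohen-Macaulay property: two elements covered by a common element cover a common element above any
  given common lower bound. By Mayer-Vietoris, adding one at a time the ideals below the coatoms of an interval, the
  homology of every interval is concentrated in the top degree.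

  For the homology: let \<open>Q(N)\<close> be the proper part and \<open>R(N - {s})\<close> the part of \<open>Q(N)\<close> strictly above the one-block
  partition decorated by \<open>{s}\<close>. Without these \<open>|N|\<close> atoms \<open>Q(N)\<close> is acyclic, so that
  \<open>H(Q(N)) = \<Oplus>\<^sub>s H(R(N - {s}))\<close> up to a shift. In \<open>R(T)\<close>, the elements where \<open>s\<close> is a singleton block form \<open>Q(T)\<close>;
  among the others, only those whose remaining blocks are singletons change the homology, their links being joins
  of some \<open>R(T')\<close> and \<open>Q(T - T')\<close>. Unfolding this recursion attaches to every planar binary tree a maximal
  chain, and the coefficients at these chains are coordinates on the top cycles. As the chain depends naturally on
  the tree and a tree orders its leaves, which cancels the sign representation, the coordinates give the
  isomorphism with \<open>Mag\<close>.
\<close>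

section \<open>Chains and the boundary operator as linear extensions\<close>

section \<open>Linear extension\<close>

text \<open>The isomorphism has to commute with relabelling, while no ordering of the labels and no
  particular top cycle comes with a tree. The top homology is therefore described by coordinates
  only: maximal chains indexed by trees, such that every family of values belongs to exactly one top
  cycle. Coordinates are put together when a point is glued to a set along its link, and multiply
  for joins; the recursion needs nothing else.

  The recursion is that of trees: one with first leaf \<open>s\<close> and further leaves
  \<open>T\<close>, not empty, is \<open>Node u v\<close>, where \<open>u\<close> has the leaves
  \<open>s\<close> and \<open>T'\<close> and \<open>v\<close> the leaves \<open>T - T'\<close>. On
  the side of homology, \<open>T' = {}\<close> is Q(T) inside R(T), and any other \<open>T'\<close>
  is the point where \<open>T'\<close> is split into singletons and the rest of \<open>T\<close> is
  joined to \<open>s\<close>.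

  That no other points count has one reason. The link of a point contracts to a cone, whose apex
  keeps the blocks (or the decoration) of the point together and splits all the rest into
  singletons. This fails when the apex is the greatest element, which has been removed: for the
  atoms decorated by one point and for the partitions into singletons.\<close>

abbreviation (input) basis :: "'b \<Rightarrow> ('b \<Rightarrow>\<^sub>0 'k::field)" where
  "basis x \<equiv> Poly_Mapping.single x 1"

text \<open>Boundary, concatenation, insertion of a point, relabelling and the final isomorphism are
  all of this form, so that identities between them need to be checked on basis vectors
  only.\<close>

definition linext :: "('b \<Rightarrow> ('c \<Rightarrow>\<^sub>0 'k)) \<Rightarrow> ('b \<Rightarrow>\<^sub>0 'k) \<Rightarrow> ('c \<Rightarrow>\<^sub>0 'k::field)" where
  "linext g c = (\<Sum>x\<in>Poly_Mapping.keys c. scale (Poly_Mapping.lookup c x) (g x))"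

lemma lookup_scale [simp]: "Poly_Mapping.lookup (scale a c) x = a * Poly_Mapping.lookup c x"
  by (simp add: scale_def Poly_Mapping.map.rep_eq when_def)

lemma scale_add_right: "scale a (c + d) = scale a c + scale a d"
  by (rule poly_mapping_eqI) (simp add: lookup_add algebra_simps)

lemma scale_add_left: "scale (a + b) c = scale a c + scale b c"
  by (rule poly_mapping_eqI) (simp add: lookup_add algebra_simps)

lemma scale_scale [simp]: "scale a (scale b c) = scale (a * b) c"
  by (rule poly_mapping_eqI) (simp add: algebra_simps)

lemma scale_simps [simp]:
  "scale a 0 = 0" "scale 0 c = 0" "scale 1 c = c" "scale (- 1) c = - c" "scale a (- c) = - scale a c"
  "scale (- a) c = - scale a c"
  "scale a (Poly_Mapping.single x b) = Poly_Mapping.single x (a * b)"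
  by (rule poly_mapping_eqI; simp add: lookup_single when_def)+

lemma scale_diff_right: "scale a (c - d) = scale a c - scale a d"
  by (rule poly_mapping_eqI) (simp add: lookup_minus algebra_simps)

lemma scale_sum: "scale a (sum f A) = (\<Sum>x\<in>A. scale a (f x))"
  by (rule poly_mapping_eqI) (simp add: lookup_sum sum_distrib_left)

lemma keys_scale: "Poly_Mapping.keys (scale a c) \<subseteq> Poly_Mapping.keys c"
  by (auto simp: in_keys_iff)

lemma linext_superset:
  assumes "finite A" "Poly_Mapping.keys c \<subseteq> A"
  shows "linext g c = (\<Sum>x\<in>A. scale (Poly_Mapping.lookup c x) (g x))"
  unfolding linext_def by (rule sum.mono_neutral_left) (use assms in \<open>auto simp: in_keys_iff\<close>)

lemma linext_zero [simp]: "linext g 0 = 0"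
  by (simp add: linext_def)

lemma linext_add: "linext g (c + d) = linext g c + linext g d"
proof -
  let ?A = "Poly_Mapping.keys c \<union> Poly_Mapping.keys d"
  have "linext g (c + d) = (\<Sum>x\<in>?A. scale (Poly_Mapping.lookup (c + d) x) (g x))"
    by (rule linext_superset) (auto simp: keys_add)
  also have "\<dots> = linext g c + linext g d"
    by (subst (1 2) linext_superset[where A = ?A])
       (auto simp: lookup_add scale_add_left sum.distrib)
  finally show ?thesis .
qed

lemma linext_scale: "linext g (scale a c) = scale a (linext g c)"
  by (subst linext_superset[where A = "Poly_Mapping.keys c"])
     (auto simp: keys_scale linext_def scale_sum intro!: sum.cong subsetD[OF keys_scale])

lemma linext_uminus: "linext g (- c) = - linext g c"
  using linext_scale[of g "-1" c] by simp

lemma linext_diff: "linext g (c - d) = linext g c - linext g d"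
  using linext_add[of g c "- d"] by (simp add: linext_uminus)

lemma linext_sum: "linext g (sum f A) = (\<Sum>x\<in>A. linext g (f x))"
  by (induction A rule: infinite_finite_induct) (auto simp: linext_add)

lemma linext_single [simp]: "linext g (Poly_Mapping.single x a) = scale a (g x)"
  by (subst linext_superset[where A = "{x}"]) auto

lemma linext_linext: "linext g (linext h c) = linext (\<lambda>x. linext g (h x)) c"
  by (simp add: linext_def[of h] linext_sum linext_scale) (simp add: linext_def)

lemma linext_cong:
  "(\<And>x. x \<in> Poly_Mapping.keys c \<Longrightarrow> g x = h x) \<Longrightarrow> linext g c = linext h c"
  by (simp add: linext_def)

lemma linext_basis [simp]: "linext basis c = c"
  by (rule poly_mapping_eqI)
     (auto simp: linext_def lookup_sum lookup_single when_def in_keys_iff if_distrib cong: if_cong)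

lemma linext_fun_add: "linext (\<lambda>x. g x + h x) c = linext g c + linext h c"
  by (simp add: linext_def scale_add_right sum.distrib)

lemma linext_fun_diff: "linext (\<lambda>x. g x - h x) c = linext g c - linext h c"
  by (simp add: linext_def scale_diff_right sum_subtractf)

lemma linext_fun_scale: "linext (\<lambda>x. scale a (g x)) c = scale a (linext g c)"
  by (simp add: linext_def scale_sum mult.commute)

lemma linext_fun_zero [simp]: "linext (\<lambda>x. 0) c = 0"
  by (simp add: linext_def)

lemma linext_eq_zero: "(\<And>x. x \<in> Poly_Mapping.keys c \<Longrightarrow> g x = 0) \<Longrightarrow> linext g c = 0"
  using linext_cong[of c g "\<lambda>x. 0"] by simp

lemma linext_eq_self:
  "(\<And>x. x \<in> Poly_Mapping.keys c \<Longrightarrow> g x = basis x) \<Longrightarrow> linext g c = c"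
  using linext_cong[of c g basis] by simp

lemma lookup_linext:
  "Poly_Mapping.lookup (linext g c) y
     = (\<Sum>x\<in>Poly_Mapping.keys c. Poly_Mapping.lookup c x * Poly_Mapping.lookup (g x) y)"
  by (simp add: linext_def lookup_sum)

lemma keys_linext: "Poly_Mapping.keys (linext g c) \<subseteq> (\<Union>x\<in>Poly_Mapping.keys c. Poly_Mapping.keys (g x))"
proof
  fix y assume "y \<in> Poly_Mapping.keys (linext g c)"
  then have "(\<Sum>x\<in>Poly_Mapping.keys c. Poly_Mapping.lookup c x * Poly_Mapping.lookup (g x) y) \<noteq> 0"
    by (simp add: in_keys_iff lookup_linext)
  then obtain x where "x \<in> Poly_Mapping.keys c" "Poly_Mapping.lookup (g x) y \<noteq> 0"
    by (metis (no_types, lifting) mult_zero_right sum.neutral)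
  then show "y \<in> (\<Union>x\<in>Poly_Mapping.keys c. Poly_Mapping.keys (g x))"
    by (auto simp: in_keys_iff)
qed

lemma keys_linext_subset:
  "(\<And>x. x \<in> Poly_Mapping.keys c \<Longrightarrow> Poly_Mapping.keys (g x) \<subseteq> S) \<Longrightarrow> Poly_Mapping.keys (linext g c) \<subseteq> S"
  using keys_linext[of g c] by blast

lemma keys_add_subset:
  "Poly_Mapping.keys c \<subseteq> S \<Longrightarrow> Poly_Mapping.keys d \<subseteq> S \<Longrightarrow> Poly_Mapping.keys (c + d) \<subseteq> S"
  by (meson Un_subset_iff keys_add order_trans)

lemma keys_diff_subset:
  fixes c d :: "'b \<Rightarrow>\<^sub>0 'k::field"
  shows "Poly_Mapping.keys c \<subseteq> S \<Longrightarrow> Poly_Mapping.keys d \<subseteq> S \<Longrightarrow> Poly_Mapping.keys (c - d) \<subseteq> S"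
  using keys_add_subset[of c S "- d"] by simp

lemma keys_sum_subset:
  "(\<And>x. x \<in> A \<Longrightarrow> Poly_Mapping.keys (f x) \<subseteq> S) \<Longrightarrow> Poly_Mapping.keys (sum f A) \<subseteq> S"
  by (induction A rule: infinite_finite_induct) (simp_all add: keys_add_subset)

lemma pushforward_linext: "pushforward f c = linext (\<lambda>x. basis (f x)) c"
  by (simp add: pushforward_def linext_def)

lemma lookup_pushforward_inj:
  assumes "inj_on f S" "Poly_Mapping.keys c \<subseteq> S" "x \<in> S"
  shows "Poly_Mapping.lookup (pushforward f c) (f x) = Poly_Mapping.lookup c x"
proof -
  have "Poly_Mapping.lookup (pushforward f c) (f x)
      = (\<Sum>y\<in>Poly_Mapping.keys c. Poly_Mapping.lookup c y when y = x)"
    unfolding pushforward_linext lookup_linext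
    by (rule sum.cong) (use assms in \<open>auto simp: lookup_single when_def inj_on_def\<close>)
  then show ?thesis by (simp add: when_def in_keys_iff)
qed

section \<open>The boundary operator\<close>

text \<open>The alternating sum of faces in recursive form, as for a cone with apex
  \<open>x\<close>; this makes the Leibniz rule and the vanishing of the square inductions on the
  list. The empty list is the simplex of degree -1 and has no faces.\<close>

fun bdl :: "'b list \<Rightarrow> ('b list \<Rightarrow>\<^sub>0 'k::field)" where
  "bdl [] = 0"
| "bdl (x # xs) = basis xs - linext (\<lambda>ys. basis (x # ys)) (bdl xs)"

lemma bdl_eq_sum:
  "bdl xs = (\<Sum>i<length xs. Poly_Mapping.single (take i xs @ drop (Suc i) xs) ((-1) ^ i))"
proof (induction xs)
  case (Cons x xs)
  show ?case
    by (simp add: Cons.IH linext_sum sum.lessThan_Suc_shift sum_negf[symmetric] single_uminus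
          del: sum.lessThan_Suc)
qed simp

lemma boundary_linext: "boundary c = linext bdl c"
  unfolding boundary_def linext_def bdl_eq_sum scale_sum by (simp add: mult.commute)

text \<open>For chains of two sets, the first lying below the second, this is the product with
  values in the chains of the join.\<close>

definition conc :: "('b list \<Rightarrow>\<^sub>0 'k) \<Rightarrow> ('b list \<Rightarrow>\<^sub>0 'k) \<Rightarrow> ('b list \<Rightarrow>\<^sub>0 'k::field)" where
  "conc c d = linext (\<lambda>x. linext (\<lambda>y. basis (x @ y)) d) c"

lemma conc_single [simp]:
  "conc (Poly_Mapping.single x a) (Poly_Mapping.single y b) = Poly_Mapping.single (x @ y) (a * b)"
  by (simp add: conc_def)

lemma conc_basis_left: "conc (basis x) d = linext (\<lambda>y. basis (x @ y)) d"
  by (simp add: conc_def)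

lemma conc_basis_right: "conc c (basis y) = linext (\<lambda>x. basis (x @ y)) c"
  by (simp add: conc_def)

lemma conc_basis_Cons: "conc (basis (x # p)) d = linext (\<lambda>ys. basis (x # ys)) (conc (basis p) d)"
  by (simp add: conc_basis_left linext_linext)

lemma conc_linear [simp]:
  "conc (c + c') d = conc c d + conc c' d"
  "conc c (d + d') = conc c d + conc c d'"
  "conc (scale a c) d = scale a (conc c d)"
  "conc c (scale a d) = scale a (conc c d)"
  "conc 0 d = 0" "conc c 0 = 0"
  by (simp_all add: conc_def linext_add linext_fun_add linext_scale linext_fun_scale)

lemma conc_linear_diff [simp]:
  "conc (c - c') d = conc c d - conc c' d"
  "conc c (d - d') = conc c d - conc c d'"
  "conc (- c) d = - conc c d"
  "conc c (- d) = - conc c d"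
  using conc_linear(3)[of "-1" c d] conc_linear(4)[of c "-1" d]
  by (simp_all add: conc_def linext_diff linext_fun_diff)

lemma conc_linext_left: "conc (linext g c) d = linext (\<lambda>x. conc (g x) d) c"
  by (simp add: conc_def linext_linext)

lemma conc_linext_right: "conc c (linext g d) = linext (\<lambda>y. conc c (g y)) d"
proof -
  have "linext (\<lambda>x. linext (f x) d) c = linext (\<lambda>y. linext (\<lambda>x. f x y) c) d"
    for f :: "'a list \<Rightarrow> 'c \<Rightarrow> ('a list \<Rightarrow>\<^sub>0 'b)"
    unfolding linext_def scale_sum by (subst sum.swap) (simp add: mult.commute)
  then show ?thesis by (simp add: conc_def linext_linext)
qed

lemma conc_sum_left: "conc (sum f A) d = (\<Sum>x\<in>A. conc (f x) d)"
  by (simp add: conc_def linext_sum)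

lemma conc_sum_right: "conc c (sum f A) = (\<Sum>x\<in>A. conc c (f x))"
  by (induction A rule: infinite_finite_induct) auto

text \<open>The Leibniz rule. The sign is governed by the length and not by the degree
  \<open>length p - 1\<close>, since \<open>p\<close> shifts the positions in \<open>q\<close> by
  \<open>length p\<close>.\<close>

lemma bdl_append:
  "bdl (p @ q) = conc (bdl p) (basis q) + scale ((-1) ^ length p) (conc (basis p) (bdl q))"
proof (induction p)
  case Nil
  then show ?case by (simp add: conc_basis_left)
next
  case (Cons x p)
  let ?C = "linext (\<lambda>ys. basis (x # ys))"
  have 1: "conc (?C c) d = ?C (conc c d)" for c d :: "'a list \<Rightarrow>\<^sub>0 'b"
    by (simp add: conc_def linext_linext)
  have 2: "?C (scale a c) = scale a (?C c)" for a and c :: "'a list \<Rightarrow>\<^sub>0 'b"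
    by (rule linext_scale)
  show ?case
    by (simp add: Cons.IH linext_add 1 linext_uminus linext_scale conc_basis_Cons[of x p])
qed

lemma linext_bdl_bdl [simp]: "linext bdl (bdl xs) = (0 :: 'b list \<Rightarrow>\<^sub>0 'k::field)"
proof (induction xs)
  case (Cons x xs)
  have "linext bdl (linext (\<lambda>ys. basis (x # ys)) (bdl xs)) = ( linext (\<lambda>ys. basis ys - linext (\<lambda>zs. basis (x # zs)) (bdl ys)) (bdl xs)
      :: 'b list \<Rightarrow>\<^sub>0 'k)"
    by (simp add: linext_linext)
  also have "\<dots> = bdl xs - linext (\<lambda>zs. basis (x # zs)) (linext bdl (bdl xs))"
    by (simp add: linext_fun_diff linext_linext)
  finally show ?case using Cons by (simp add: linext_diff)
qed simp

lemma boundary_boundary [simp]: "boundary (boundary c) = 0"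
  by (simp add: boundary_linext linext_linext)

lemma boundary_simps [simp]:
  "boundary 0 = 0" "boundary (Poly_Mapping.single xs a) = scale a (bdl xs)"
  by (simp_all add: boundary_linext)

lemma boundary_add: "boundary (c + d) = boundary c + boundary d"
  by (simp add: boundary_linext linext_add)

lemma boundary_diff: "boundary (c - d) = boundary c - boundary d"
  by (simp add: boundary_linext linext_diff)

lemma boundary_uminus: "boundary (- c) = - boundary c"
  by (simp add: boundary_linext linext_uminus)

lemma boundary_scale: "boundary (scale a c) = scale a (boundary c)"
  by (simp add: boundary_linext linext_scale)

lemma boundary_sum: "boundary (sum f A) = (\<Sum>x\<in>A. boundary (f x))"
  by (simp add: boundary_linext linext_sum)

lemma boundary_conc:
  assumes "\<And>x. x \<in> Poly_Mapping.keys c \<Longrightarrow> length x = n"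
  shows "boundary (conc c d) = conc (boundary c) d + scale ((-1) ^ n) (conc c (boundary d))"
proof -
  have "boundary (conc c d) = linext (\<lambda>x. linext (\<lambda>y. bdl (x @ y)) d) c"
    by (simp add: boundary_linext conc_def linext_linext)
  also have "\<dots> = linext (\<lambda>x. linext (\<lambda>y. conc (bdl x) (basis y)
      + scale ((-1) ^ n) (conc (basis x) (bdl y))) d) c"
    by (intro linext_cong) (simp add: bdl_append assms)
  also have "\<dots> = linext (\<lambda>x. conc (bdl x) d) c
      + scale ((-1) ^ n) (linext (\<lambda>x. conc (basis x) (boundary d)) c)"
    by (simp add: linext_fun_add linext_fun_scale boundary_linext conc_linext_right[symmetric])
  also have "\<dots> = conc (boundary c) d + scale ((-1) ^ n) (conc c (boundary d))"
    by (simp add: boundary_linext conc_linext_left[symmetric])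
  finally show ?thesis .
qed

lemma keys_bdl:
  "Poly_Mapping.keys (bdl xs :: 'b list \<Rightarrow>\<^sub>0 'k::field) \<subseteq> {ys. \<exists>p x q. xs = p @ x # q \<and> ys = p @ q}"
proof (induction xs)
  case (Cons x xs)
  let ?S = "{ys. \<exists>p z q. x # xs = p @ z # q \<and> ys = p @ q}"
  have "Poly_Mapping.keys (linext (\<lambda>ys. basis (x # ys) :: 'b list \<Rightarrow>\<^sub>0 'k) (bdl xs)) \<subseteq> ?S"
  proof (rule keys_linext_subset)
    fix ys assume "ys \<in> Poly_Mapping.keys (bdl xs :: 'b list \<Rightarrow>\<^sub>0 'k)"
    with Cons.IH obtain p z q where *: "xs = p @ z # q" "ys = p @ q" by blast
    then show "Poly_Mapping.keys (basis (x # ys) :: 'b list \<Rightarrow>\<^sub>0 'k) \<subseteq> ?S"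
      by (auto intro!: exI[of _ "x # p"])
  qed
  moreover have "Poly_Mapping.keys (basis xs :: 'b list \<Rightarrow>\<^sub>0 'k) \<subseteq> ?S"
    by (auto intro!: exI[of _ "[]"])
  ultimately show ?case unfolding bdl.simps by (intro keys_diff_subset)
qed simp

section \<open>Homological tools for order complexes: gluing, joins, semimodularity\<close>

section \<open>Chains of a strictly ordered set\<close>

text \<open>Only the order is fixed, while the vertex set stays an argument: links, unions and
  images are then treated within one locale. \<open>K\<close> fixes the field, which the type of
  \<open>bounding\<close> does not show.\<close>

locale strict_poset =
  fixes K :: "'k::field itself" and lt :: "'b \<Rightarrow> 'b \<Rightarrow> bool" (infix "\<prec>" 50)
  assumes irrefl: "\<not> x \<prec> x" and trans: "x \<prec> y \<Longrightarrow> y \<prec> z \<Longrightarrow> x \<prec> z"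
begin

lemma asym: "x \<prec> y \<Longrightarrow> \<not> y \<prec> x"
  using irrefl trans by blast

definition simplices :: "'b set \<Rightarrow> nat \<Rightarrow> 'b list set" where
  "simplices X n = {xs. set xs \<subseteq> X \<and> sorted_wrt (\<prec>) xs \<and> length xs = n}"

definition chains :: "'b set \<Rightarrow> nat \<Rightarrow> ('b list \<Rightarrow>\<^sub>0 'k) set" where
  "chains X n = {c. Poly_Mapping.keys c \<subseteq> simplices X n}"

text \<open>Chains are indexed by length, so that this is the vanishing of reduced homology in
  degree \<open>n - 1\<close>. For \<open>n = 0\<close> it says that \<open>X\<close> is nonempty;
  in particular acyclic sets are nonempty.\<close>

definition bounding :: "'b set \<Rightarrow> nat \<Rightarrow> bool" where
  "bounding X n \<longleftrightarrow> (\<forall>c\<in>chains X n. boundary c = 0 \<longrightarrow> (\<exists>b\<in>chains X (Suc n). boundary b = c))"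

definition acyclic :: "'b set \<Rightarrow> bool" where
  "acyclic X \<longleftrightarrow> (\<forall>n. bounding X n)"

lemma chains_closed:
  "0 \<in> chains X n"
  "c \<in> chains X n \<Longrightarrow> d \<in> chains X n \<Longrightarrow> c + d \<in> chains X n"
  "c \<in> chains X n \<Longrightarrow> d \<in> chains X n \<Longrightarrow> c - d \<in> chains X n"
  "c \<in> chains X n \<Longrightarrow> - c \<in> chains X n"
  "c \<in> chains X n \<Longrightarrow> scale a c \<in> chains X n"
  unfolding chains_def using keys_scale[of a c]
  by (auto simp: keys_add_subset keys_diff_subset subset_iff)
     (metis (no_types, lifting) keys_add_subset keys_diff_subset subset_iff)+

lemma chains_sum: "(\<And>i. i \<in> A \<Longrightarrow> f i \<in> chains X n) \<Longrightarrow> sum f A \<in> chains X n"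
  by (induction A rule: infinite_finite_induct) (auto simp: chains_closed)

lemma chains_linext:
  "(\<And>x. x \<in> Poly_Mapping.keys c \<Longrightarrow> g x \<in> chains X n) \<Longrightarrow> linext g c \<in> chains X n"
  unfolding chains_def using keys_linext_subset[of c g] by blast

lemma chains_mono: "X \<subseteq> Y \<Longrightarrow> c \<in> chains X n \<Longrightarrow> c \<in> chains Y n"
  by (auto simp: chains_def simplices_def)

lemma single_in_chains: "xs \<in> simplices X n \<Longrightarrow> Poly_Mapping.single xs a \<in> chains X n"
  by (auto simp: chains_def)

lemma keys_chains: "c \<in> chains X n \<Longrightarrow> xs \<in> Poly_Mapping.keys c \<Longrightarrow> xs \<in> simplices X n"
  by (auto simp: chains_def)

lemma bdl_in_chains:
  assumes "xs \<in> simplices X (Suc n)"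
  shows "bdl xs \<in> chains X n"
  using keys_bdl[of xs, where 'k = 'k] assms
  by (fastforce simp: chains_def simplices_def sorted_wrt_append)

lemma boundary_in_chains: "c \<in> chains X (Suc n) \<Longrightarrow> boundary c \<in> chains X n"
  unfolding boundary_linext by (intro chains_linext bdl_in_chains) (auto dest: keys_chains)

lemma boundary_chains_0: "c \<in> chains X 0 \<Longrightarrow> boundary c = 0"
  unfolding boundary_linext by (rule linext_eq_zero) (auto dest!: keys_chains simp: simplices_def)

lemma bounding_0:
  assumes "X \<noteq> {}"
  shows "bounding X 0"
  unfolding bounding_def
proof (intro ballI impI)
  fix c assume c: "c \<in> chains X 0"
  from assms obtain x where x: "x \<in> X" by blast
  have "linext (\<lambda>xs. basis [x]) c \<in> chains X (Suc 0)"
    by (intro chains_linext single_in_chains) (use x in \<open>auto simp: simplices_def\<close>)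
  moreover have "boundary (linext (\<lambda>xs. basis [x]) c) = linext basis c"
    unfolding boundary_linext linext_linext
    by (rule linext_cong) (use c in \<open>auto dest: keys_chains simp: simplices_def\<close>)
  ultimately show "\<exists>b\<in>chains X (Suc 0). boundary b = c" by auto
qed

text \<open>By \<open>cov\<close> the order complex of the union is, in this dimension, the union of
  the two order complexes. A cycle splits into a part in \<open>Y\<close> and a part in
  \<open>Z\<close>; their boundaries are opposite, hence a cycle of the intersection, and a chain
  \<open>e\<close> filling it corrects both parts to cycles.\<close>

lemma Mayer_Vietoris:
  assumes cov: "\<And>xs. xs \<in> simplices (Y \<union> Z) (Suc n) \<Longrightarrow> set xs \<subseteq> Y \<or> set xs \<subseteq> Z"
    and Y: "bounding Y (Suc n)" and Z: "bounding Z (Suc n)" and YZ: "bounding (Y \<inter> Z) n"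
  shows "bounding (Y \<union> Z) (Suc n)"
  unfolding bounding_def
proof (intro ballI impI)
  fix c assume c: "c \<in> chains (Y \<union> Z) (Suc n)" and c0: "boundary c = 0"
  define c1 where "c1 = linext (\<lambda>xs. if set xs \<subseteq> Y then basis xs else 0) c"
  define c2 where "c2 = c - c1"
  have c1: "c1 \<in> chains Y (Suc n)" unfolding c1_def
    by (intro chains_linext) (use c in \<open>auto dest!: keys_chains simp: simplices_def chains_def\<close>)
  have "c2 = linext (\<lambda>xs. basis xs - (if set xs \<subseteq> Y then basis xs else 0)) c"
    by (simp add: c2_def c1_def linext_fun_diff)
  also have "\<dots> \<in> chains Z (Suc n)"
  proof (rule chains_linext)
    fix xs assume "xs \<in> Poly_Mapping.keys c"
    then have xs: "xs \<in> simplices (Y \<union> Z) (Suc n)" using c keys_chains by blast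
    with cov[OF xs] show "basis xs - (if set xs \<subseteq> Y then basis xs else 0) \<in> chains Z (Suc n)"
      by (auto simp: chains_closed simplices_def intro: single_in_chains)
  qed
  finally have c2: "c2 \<in> chains Z (Suc n)" .
  have eq: "boundary c1 = - boundary c2"
    using c0 by (simp add: c2_def boundary_diff)
  then have "boundary c1 \<in> chains Z n"
    using boundary_in_chains[OF c2] by (simp add: chains_closed)
  with boundary_in_chains[OF c1] have "boundary c1 \<in> chains (Y \<inter> Z) n"
    by (fastforce simp: chains_def simplices_def)
  then obtain e where e: "e \<in> chains (Y \<inter> Z) (Suc n)" "boundary e = boundary c1"
    using YZ by (auto simp: bounding_def)
  have "c1 - e \<in> chains Y (Suc n)" "c2 + e \<in> chains Z (Suc n)"
    using c1 c2 chains_mono[OF _ e(1)] by (auto intro!: chains_closed)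
  moreover have "boundary (c1 - e) = 0" "boundary (c2 + e) = 0"
    using e(2) eq by (simp_all add: boundary_diff boundary_add)
  ultimately obtain u v where "u \<in> chains Y (Suc (Suc n))" "boundary u = c1 - e"
    "v \<in> chains Z (Suc (Suc n))" "boundary v = c2 + e"
    using Y Z unfolding bounding_def by metis
  then have "u + v \<in> chains (Y \<union> Z) (Suc (Suc n))" "boundary (u + v) = c"
    using chains_mono[of Y "Y \<union> Z" u] chains_mono[of Z "Y \<union> Z" v]
    by (auto simp: boundary_add c2_def chains_closed)
  then show "\<exists>b\<in>chains (Y \<union> Z) (Suc (Suc n)). boundary b = c" by blast
qed

section \<open>Adding a point\<close>

definition link :: "'b set \<Rightarrow> 'b \<Rightarrow> 'b set" where
  "link X w = {y \<in> X. y \<prec> w \<or> w \<prec> y}"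

text \<open>The sign is that of moving \<open>w\<close> to the front, as in a cone with apex
  \<open>w\<close>; this gives the homotopy formula \<open>boundary_ins\<close>. It is meant for
  chains of the link of \<open>w\<close>, where \<open>p\<close> and \<open>q\<close> make up the
  whole list.\<close>

definition ins :: "'b \<Rightarrow> ('b list \<Rightarrow>\<^sub>0 'k) \<Rightarrow> ('b list \<Rightarrow>\<^sub>0 'k)" where
  "ins w = linext (\<lambda>xs. let p = filter (\<lambda>y. y \<prec> w) xs; q = filter (\<lambda>y. w \<prec> y) xs in
     Poly_Mapping.single (p @ w # q) ((-1) ^ length p))"

text \<open>The left inverse of \<open>ins w\<close> on the link. It kills the simplices that avoid
  \<open>w\<close>, and so reads off the part of a chain that passes through
  \<open>w\<close>.\<close>

definition del :: "'b \<Rightarrow> ('b list \<Rightarrow>\<^sub>0 'k) \<Rightarrow> ('b list \<Rightarrow>\<^sub>0 'k)" where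
  "del w = linext (\<lambda>xs. if w \<in> set xs
     then Poly_Mapping.single (filter (\<lambda>y. y \<prec> w) xs @ filter (\<lambda>y. w \<prec> y) xs)
            ((-1) ^ length (filter (\<lambda>y. y \<prec> w) xs)) else 0)"

lemma simplices_link_split:
  assumes "xs \<in> simplices (link X w) n"
  obtains p q where "xs = p @ q" "\<forall>y\<in>set p. y \<prec> w" "\<forall>y\<in>set q. w \<prec> y" "p @ w # q \<in> simplices (insert w X) (Suc n)"
proof -
  have *: "sorted_wrt (\<prec>) xs \<Longrightarrow> \<forall>y\<in>set xs. y \<prec> w \<or> w \<prec> y \<Longrightarrow>
     xs = filter (\<lambda>y. y \<prec> w) xs @ filter (\<lambda>y. w \<prec> y) xs"
  proof (induction xs)
    case (Cons x xs)
    show ?case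
    proof (cases "x \<prec> w")
      case True
      then show ?thesis using Cons by (auto dest: asym)
    next
      case False
      then have "\<forall>y\<in>set xs. w \<prec> y" "w \<prec> x" using Cons.prems by (auto intro: trans)
      then show ?thesis using False by (auto dest: asym simp: filter_empty_conv)
    qed
  qed simp
  have 1: "xs = filter (\<lambda>y. y \<prec> w) xs @ filter (\<lambda>y. w \<prec> y) xs"
    using assms by (intro *) (auto simp: simplices_def link_def)
  moreover have "filter (\<lambda>y. y \<prec> w) xs @ w # filter (\<lambda>y. w \<prec> y) xs \<in> simplices (insert w X) (Suc n)"
    using assms arg_cong[OF 1, of length] sorted_wrt_filter[of "(\<prec>)" xs]
    by (auto simp: simplices_def link_def sorted_wrt_append intro: trans)
  ultimately show thesis by (intro that[of "filter (\<lambda>y. y \<prec> w) xs" "filter (\<lambda>y. w \<prec> y) xs"]) auto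
qed

lemma simplices_insert_split:
  assumes "xs \<in> simplices (insert w X) n" "w \<in> set xs" "w \<notin> X"
  obtains p q m where "xs = p @ w # q" "\<forall>y\<in>set p. y \<prec> w" "\<forall>y\<in>set q. w \<prec> y"
    "n = Suc m" "p @ q \<in> simplices (link X w) m"
proof -
  from assms(2) obtain p q where pq: "xs = p @ w # q" by (meson split_list)
  show thesis
    by (rule that[of p q "n - 1"])
      (use assms pq in \<open>auto simp: simplices_def link_def sorted_wrt_append dest: irrefl[THEN notE]\<close>)
qed

lemma filter_split:
  assumes "\<forall>y\<in>set p. y \<prec> w" "\<forall>y\<in>set q. w \<prec> y"
  shows "filter (\<lambda>y. y \<prec> w) p = p" "filter (\<lambda>y. y \<prec> w) q = []"
    "filter (\<lambda>y. w \<prec> y) p = []" "filter (\<lambda>y. w \<prec> y) q = q"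
  using assms by (auto simp: filter_empty_conv filter_id_conv dest: asym)

lemma ins_basis:
  assumes "\<forall>y\<in>set p. y \<prec> w" "\<forall>y\<in>set q. w \<prec> y"
  shows "ins w (basis (p @ q)) = Poly_Mapping.single (p @ w # q) ((-1) ^ length p)"
  by (simp add: ins_def filter_split[OF assms])

lemma del_basis:
  assumes "\<forall>y\<in>set p. y \<prec> w" "\<forall>y\<in>set q. w \<prec> y"
  shows "del w (Poly_Mapping.single (p @ w # q) a) = Poly_Mapping.single (p @ q) (a * (-1) ^ length p)"
  by (simp add: del_def filter_split[OF assms] irrefl)

lemma ins_linext: "ins w (linext g c) = linext (\<lambda>x. ins w (g x)) c"
  by (simp add: ins_def linext_linext)

lemma ins_eq_linext: "ins w c = linext (\<lambda>x. ins w (basis x)) c"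
  by (simp add: ins_def)

lemma ins_lin:
  "ins w (c + d) = ins w c + ins w d" "ins w (c - d) = ins w c - ins w d"
  "ins w (- c) = - ins w c" "ins w (scale a c) = scale a (ins w c)" "ins w 0 = 0"
  by (simp_all add: ins_def linext_add linext_diff linext_uminus linext_scale)

lemma del_lin:
  "del w (c + d) = del w c + del w d" "del w (c - d) = del w c - del w d" "del w 0 = 0"
  by (simp_all add: del_def linext_add linext_diff)

lemma ins_in_chains:
  assumes "c \<in> chains (link X w) n"
  shows "ins w c \<in> chains (insert w X) (Suc n)"
proof -
  have "linext (\<lambda>xs. ins w (basis xs)) c \<in> chains (insert w X) (Suc n)"
  proof (rule chains_linext)
    fix xs assume "xs \<in> Poly_Mapping.keys c"
    then obtain p q where "xs = p @ q" "\<forall>y\<in>set p. y \<prec> w" "\<forall>y\<in>set q. w \<prec> y"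
      "p @ w # q \<in> simplices (insert w X) (Suc n)"
      by (rule simplices_link_split[OF keys_chains[OF assms]])
    then show "ins w (basis xs) \<in> chains (insert w X) (Suc n)"
      by (simp only: ins_basis) (rule single_in_chains)
  qed
  then show ?thesis by (simp only: ins_eq_linext[symmetric])
qed

lemma del_ins:
  assumes "c \<in> chains (link X w) n"
  shows "del w (ins w c) = c"
proof -
  have "del w (ins w c) = linext (\<lambda>xs. del w (ins w (basis xs))) c"
    by (subst ins_eq_linext) (simp add: del_def linext_linext)
  also have "\<dots> = c"
  proof (rule linext_eq_self)
    fix xs assume "xs \<in> Poly_Mapping.keys c"
    then obtain p q where "xs = p @ q" "\<forall>y\<in>set p. y \<prec> w" "\<forall>y\<in>set q. w \<prec> y"
      by (rule simplices_link_split[OF keys_chains[OF assms]])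
    then show "del w (ins w (basis xs)) = basis xs"
      by (simp add: ins_basis del_basis power_mult_distrib[symmetric])
  qed
  finally show ?thesis .
qed

lemma del_eq_zero: "c \<in> chains X n \<Longrightarrow> w \<notin> X \<Longrightarrow> del w c = 0"
  unfolding del_def by (rule linext_eq_zero) (auto dest!: keys_chains simp: simplices_def)

text \<open>Deleting \<open>w\<close> gives back \<open>p @ q\<close>, the two signs cancelling.
  Every other face is again an insertion of \<open>w\<close>: a deletion in \<open>p\<close> moves
  \<open>w\<close> by one place, and a deletion in \<open>q\<close> takes place one position later
  than without \<open>w\<close>. Either way one factor -1 remains.\<close>

lemma boundary_ins_basis:
  assumes "\<forall>y\<in>set p. y \<prec> w" "\<forall>y\<in>set q. w \<prec> y"
  shows "boundary (ins w (basis (p @ q))) = basis (p @ q) - ins w (bdl (p @ q))"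
proof -
  have 1: "ins w (conc (bdl p) (basis q)) = - scale ((-1) ^ length p) (conc (bdl p) (basis (w # q)))"
  proof -
    have "ins w (basis (ys @ q)) = - scale ((-1) ^ length p) (basis (ys @ w # q))"
      if "ys \<in> Poly_Mapping.keys (bdl p :: 'b list \<Rightarrow>\<^sub>0 'k)" for ys
    proof -
      from that keys_bdl[of p] obtain r x s where r: "p = r @ x # s" "ys = r @ s" by blast
      with assms have "\<forall>y\<in>set ys. y \<prec> w" by auto
      then show ?thesis using r by (subst ins_basis) (use assms in \<open>auto simp: single_uminus\<close>)
    qed
    then have "ins w (conc (bdl p) (basis q)) = linext (\<lambda>ys. scale (-1) (scale ((-1) ^ length p) (basis (ys @ w # q)))) (bdl p)"
      unfolding conc_basis_right ins_linext by (intro linext_cong) (simp add: single_uminus)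
    then show ?thesis by (simp only: linext_fun_scale conc_basis_right) simp
  qed
  have 2: "ins w (conc (basis p) (bdl q)) = scale ((-1) ^ length p) (conc (basis (p @ [w])) (bdl q))"
  proof -
    have "ins w (basis (p @ ys)) = scale ((-1) ^ length p) (basis (p @ w # ys))"
      if "ys \<in> Poly_Mapping.keys (bdl q :: 'b list \<Rightarrow>\<^sub>0 'k)" for ys
    proof -
      from that keys_bdl[of q] obtain r x s where r: "q = r @ x # s" "ys = r @ s" by blast
      with assms have "\<forall>y\<in>set ys. w \<prec> y" by auto
      then show ?thesis using r by (subst ins_basis) (use assms in auto)
    qed
    then have "ins w (conc (basis p) (bdl q)) = linext (\<lambda>ys. scale ((-1) ^ length p) (basis (p @ w # ys))) (bdl q)"
      unfolding conc_basis_left ins_linext by (intro linext_cong) simp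
    then show ?thesis by (simp only: linext_fun_scale conc_basis_left) simp
  qed
  have 3: "conc (basis p) (linext (\<lambda>ys. basis (w # ys)) (bdl q)) = conc (basis (p @ [w])) (bdl q)"
    by (simp add: conc_basis_left linext_linext)
  have sq: "(- 1) ^ length p * (- 1) ^ length p = (1 :: 'k)"
    by (simp add: power_mult_distrib[symmetric])
  show ?thesis
    by (simp add: ins_basis[OF assms] bdl_append ins_lin 1 2 3 scale_add_right scale_diff_right sq)
qed

lemma boundary_ins:
  assumes "c \<in> chains (link X w) n"
  shows "boundary (ins w c) = c - ins w (boundary c)"
proof -
  have "boundary (ins w c) = linext (\<lambda>xs. boundary (ins w (basis xs))) c"
    by (subst ins_eq_linext) (simp add: boundary_linext linext_linext)
  also have "\<dots> = linext (\<lambda>xs. basis xs - ins w (bdl xs)) c"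
  proof (rule linext_cong)
    fix xs assume "xs \<in> Poly_Mapping.keys c"
    then obtain p q where "xs = p @ q" "\<forall>y\<in>set p. y \<prec> w" "\<forall>y\<in>set q. w \<prec> y"
      by (rule simplices_link_split[OF keys_chains[OF assms]])
    then show "boundary (ins w (basis xs)) = basis xs - ins w (bdl xs)"
      by (simp only: boundary_ins_basis)
  qed
  also have "\<dots> = c - ins w (boundary c)"
    by (simp add: linext_fun_diff boundary_linext ins_linext)
  finally show ?thesis .
qed

lemma chains_insert_decomp:
  assumes c: "c \<in> chains (insert w X) (Suc n)" and w: "w \<notin> X"
  obtains a b where "a \<in> chains X (Suc n)" "b \<in> chains (link X w) n" "c = a + ins w b"
proof
  let ?a = "\<lambda>xs. if w \<in> set xs then 0 else basis xs :: 'b list \<Rightarrow>\<^sub>0 'k"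
  show "linext ?a c \<in> chains X (Suc n)"
    by (rule chains_linext) (use c in \<open>auto dest!: keys_chains simp: chains_def simplices_def\<close>)
  show "del w c \<in> chains (link X w) n"
    unfolding del_def
  proof (rule chains_linext)
    fix xs assume "xs \<in> Poly_Mapping.keys c"
    then have xs: "xs \<in> simplices (insert w X) (Suc n)" using c keys_chains by blast
    show "(if w \<in> set xs
     then Poly_Mapping.single (filter (\<lambda>y. y \<prec> w) xs @ filter (\<lambda>y. w \<prec> y) xs)
            ((-1) ^ length (filter (\<lambda>y. y \<prec> w) xs)) else 0) \<in> chains (link X w) n"
      using simplices_insert_split[OF xs _ w]
      by (auto simp: chains_closed filter_split irrefl elim!: simplices_insert_split[OF xs _ w] intro!: single_in_chains)
  qed
  have "linext ?a c + ins w (del w c) = linext (\<lambda>xs. ?a xs + ins w (del w (basis xs))) c"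
    by (simp add: linext_fun_add ins_linext[symmetric]) (simp add: del_def)
  also have "\<dots> = c"
  proof (rule linext_eq_self)
    fix xs assume "xs \<in> Poly_Mapping.keys c"
    then have xs: "xs \<in> simplices (insert w X) (Suc n)" using c keys_chains by blast
    show "?a xs + ins w (del w (basis xs)) = basis xs"
    proof (cases "w \<in> set xs")
      case True
      obtain p q where *: "xs = p @ w # q" "\<forall>y\<in>set p. y \<prec> w" "\<forall>y\<in>set q. w \<prec> y"
        using simplices_insert_split[OF xs True w] by metis
      have "ins w (Poly_Mapping.single (p @ q) ((-1) ^ length p)) = scale ((-1) ^ length p) (ins w (basis (p @ q)))"
        by (simp add: ins_lin(4)[symmetric])
      with * True show ?thesis
        by (simp add: del_basis ins_basis power_mult_distrib[symmetric])
    next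
      case False
      then show ?thesis by (simp add: del_def ins_lin)
    qed
  qed
  finally show "c = linext ?a c + ins w (del w c)" by simp
qed

text \<open>The terms of the boundary with and without \<open>w\<close> vanish separately. Thus
  \<open>b\<close> represents the image of the cycle under the connecting map to the homology of the
  link, and \<open>a\<close> shows that \<open>b\<close> bounds in \<open>X\<close>.\<close>

lemma cycle_insert_decomp:
  assumes a: "a \<in> chains X (Suc n)" and b: "b \<in> chains (link X w) n" and w: "w \<notin> X"
    and 0: "boundary (a + ins w b) = 0"
  shows "boundary b = 0" "boundary a = - b"
proof -
  have eq: "boundary a + b - ins w (boundary b) = 0"
    using 0 by (simp add: boundary_add boundary_ins[OF b] add_diff_eq)
  have "b \<in> chains X n" using b by (rule chains_mono[rotated]) (auto simp: link_def)
  then have "del w (boundary a + b) = 0"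
    using a w by (intro del_eq_zero[of _ X n]) (auto intro: chains_closed boundary_in_chains)
  with eq have "del w (ins w (boundary b)) = 0" by (metis del_lin(2) diff_0_right diff_self eq_iff_diff_eq_0)
  moreover have "del w (ins w (boundary b)) = boundary b"
  proof (cases n)
    case 0
    then show ?thesis using boundary_chains_0 b by (simp add: ins_lin del_lin)
  next
    case (Suc m)
    then show ?thesis using b by (intro del_ins[of _ X w m] boundary_in_chains) simp
  qed
  ultimately show "boundary b = 0" by simp
  with eq show "boundary a = - b" by (simp add: ins_lin eq_neg_iff_add_eq_0)
qed

text \<open>Adding \<open>w\<close> glues a cone over the link to \<open>X\<close>. For a cycle
  \<open>a + ins w b\<close>, a filling \<open>u\<close> of \<open>b\<close> in the link turns
  \<open>a\<close> into the cycle \<open>a + u\<close> of \<open>X\<close>, and a filling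
  \<open>v\<close> of that yields the filling \<open>v - ins w u\<close>.\<close>

lemma bounding_insert:
  assumes w: "w \<notin> X" and X: "bounding X (Suc n)" and L: "bounding (link X w) n"
  shows "bounding (insert w X) (Suc n)"
  unfolding bounding_def
proof (intro ballI impI)
  fix c assume c: "c \<in> chains (insert w X) (Suc n)" "boundary c = 0"
  obtain a b where ab: "a \<in> chains X (Suc n)" "b \<in> chains (link X w) n" "c = a + ins w b"
    using chains_insert_decomp[OF c(1) w] by blast
  note * = cycle_insert_decomp[OF ab(1,2) w c(2)[unfolded ab(3)]]
  from L ab * obtain u where u: "u \<in> chains (link X w) (Suc n)" "boundary u = b"
    by (auto simp: bounding_def)
  have uX: "u \<in> chains X (Suc n)" using u(1) by (rule chains_mono[rotated]) (auto simp: link_def)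
  with ab have "a + u \<in> chains X (Suc n)" "boundary (a + u) = 0"
    using * u by (auto intro: chains_closed simp: boundary_add)
  with X obtain v where v: "v \<in> chains X (Suc (Suc n))" "boundary v = a + u"
    by (auto simp: bounding_def)
  have "boundary (v - ins w u) = c"
    using v u ab by (simp add: boundary_diff boundary_ins)
  moreover have "v - ins w u \<in> chains (insert w X) (Suc (Suc n))"
    using chains_mono[OF subset_insertI v(1)] ins_in_chains[OF u(1)] by (rule chains_closed(3))
  ultimately show "\<exists>b\<in>chains (insert w X) (Suc (Suc n)). boundary b = c" by blast
qed

lemma acyclic_insert:
  assumes "w \<notin> X" "acyclic X" "acyclic (link X w)"
  shows "acyclic (insert w X)"
  unfolding acyclic_def
proof
  fix n
  show "bounding (insert w X) n"
    using assms by (cases n) (auto simp: acyclic_def bounding_0 intro: bounding_insert)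
qed

text \<open>Insertion of \<open>m\<close> is a contracting homotopy: all other points are comparable
  with \<open>m\<close>, so that they form its link.\<close>

lemma acyclic_cone:
  assumes m: "m \<in> X" and X: "\<And>x. x \<in> X \<Longrightarrow> x = m \<or> x \<prec> m \<or> m \<prec> x"
  shows "acyclic X"
  unfolding acyclic_def
proof
  fix n
  let ?X = "X - {m}"
  have ins: "insert m ?X = X" and link: "link ?X m = ?X" using m X by (auto simp: link_def)
  show "bounding X n"
  proof (cases n)
    case 0
    then show ?thesis using m by (auto intro: bounding_0)
  next
    case (Suc k)
    show ?thesis unfolding bounding_def Suc
    proof (intro ballI impI)
      fix c assume c: "c \<in> chains X (Suc k)" "boundary c = 0"
      then obtain a b where ab: "a \<in> chains ?X (Suc k)" "b \<in> chains (link ?X m) k" "c = a + ins m b"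
        using chains_insert_decomp[of c m ?X k] ins by auto
      note * = cycle_insert_decomp[OF ab(1,2) _ c(2)[unfolded ab(3)]]
      have "boundary (ins m a) = c"
        using boundary_ins[of a ?X m "Suc k"] ab * by (simp add: link ins_lin)
      moreover have "ins m a \<in> chains X (Suc (Suc k))"
        using ins_in_chains[of a ?X m] ab ins link by simp
      ultimately show "\<exists>b\<in>chains X (Suc (Suc k)). boundary b = c" by blast
    qed
  qed
qed

text \<open>A finite set is built from the top downwards. When \<open>x\<close> arrives, all points
  of \<open>D\<close> above it are present and none below it is, which determines its link at that
  moment.\<close>

lemma finite_upset_induct [consumes 1, case_names empty insert]:
  assumes "finite D" "P {}"
    and "\<And>E x. E \<subseteq> D \<Longrightarrow> x \<in> D \<Longrightarrow> x \<notin> E \<Longrightarrow> \<forall>y\<in>D. x \<prec> y \<longrightarrow> y \<in> E \<Longrightarrow> \<forall>y\<in>E. \<not> y \<prec> x \<Longrightarrow>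
      P E \<Longrightarrow> P (insert x E)"
  shows "P D"
proof -
  have "E \<subseteq> D \<Longrightarrow> \<forall>x\<in>E. \<forall>y\<in>D. x \<prec> y \<longrightarrow> y \<in> E \<Longrightarrow> P E" for E
  proof (induction "card E" arbitrary: E)
    case 0
    then have "E = {}" using assms(1) finite_subset by fastforce
    then show ?case using assms(2) by simp
  next
    case (Suc n)
    have fin: "finite E" using Suc.prems assms(1) finite_subset by blast
    have "E \<noteq> {}" using Suc.hyps by auto
    have "asymp_on E (\<prec>)" by (rule asymp_onI) (rule asym)
    moreover have "transp_on E (\<prec>)" by (rule transp_onI) (rule trans)
    ultimately have "\<exists>x\<in>E. \<forall>y\<in>E. y \<noteq> x \<longrightarrow> \<not> y \<prec> x"
      by (rule Finite_Set.bex_min_element[OF fin _ _ \<open>E \<noteq> {}\<close>])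
    then obtain x where x: "x \<in> E" "\<forall>y\<in>E. \<not> y \<prec> x"
      using irrefl by metis
    have "P (E - {x})"
      by (rule Suc.hyps(1)) (use Suc.hyps(2) Suc.prems x fin in auto)
    moreover have "\<forall>y\<in>D. x \<prec> y \<longrightarrow> y \<in> E - {x}" using Suc.prems x irrefl by blast
    ultimately have "P (insert x (E - {x}))"
      by (intro assms(3)) (use Suc.prems x in auto)
    then show ?case using x by (simp add: insert_absorb)
  qed
  then show ?thesis by simp
qed

text \<open>The combinatorial form of a deformation retraction of \<open>X\<close> onto the image of
  \<open>f\<close>. The points that are not fixed are added from the top. The points then present
  below \<open>x\<close> are fixed by \<open>f\<close>, hence at most \<open>f x\<close>, and those
  above \<open>x\<close> are above \<open>f x\<close>; so the link is a cone with apex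
  \<open>f x\<close>.\<close>

lemma acyclic_closure:
  assumes fin: "finite X" and fX: "\<And>x. x \<in> X \<Longrightarrow> f x \<in> X"
    and mono: "\<And>x y. x \<in> X \<Longrightarrow> y \<in> X \<Longrightarrow> x \<prec> y \<Longrightarrow> f x = f y \<or> f x \<prec> f y"
    and decr: "\<And>x. x \<in> X \<Longrightarrow> f x = x \<or> f x \<prec> x"
    and idem: "\<And>x. x \<in> X \<Longrightarrow> f (f x) = f x"
    and ac: "acyclic (f ` X)"
  shows "acyclic X"
proof -
  have "finite (X - f ` X)" using fin by simp
  then have "acyclic (f ` X \<union> (X - f ` X))"
  proof (induction rule: finite_upset_induct)
    case empty
    then show ?case using ac by simp
  next
    case (insert E x)
    have fx: "f x \<prec> x" using insert decr[of x] by force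
    have "acyclic (link (f ` X \<union> E) x)"
    proof (rule acyclic_cone[of "f x"])
      show "f x \<in> link (f ` X \<union> E) x" using insert fx by (auto simp: link_def)
      fix y assume y: "y \<in> link (f ` X \<union> E) x"
      show "y = f x \<or> y \<prec> f x \<or> f x \<prec> y"
      proof (cases "x \<prec> y")
        case True
        then show ?thesis using fx trans by blast
      next
        case False
        then have "y \<prec> x" "y \<in> f ` X" using y insert by (auto simp: link_def)
        then show ?thesis using mono[of y x] idem insert fX by force
      qed
    qed
    then have "acyclic (Set.insert x (f ` X \<union> E))"
      using insert by (intro acyclic_insert) auto
    then show ?case by simp
  qed
  moreover have "f ` X \<union> (X - f ` X) = X" using fX by auto
  ultimately show ?thesis by simp
qed

end

section \<open>Spherical sets with a basis of the top cycles\<close>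

context strict_poset
begin

text \<open>
  The chains \<open>e i\<close> for \<open>i \<in> I\<close> are coordinates on the cycles of top length \<open>n\<close>; since nothing bounds in
  that length, these cycles are the top homology. Note that a chain of length \<open>n\<close> has dimension \<open>n - 1\<close>.
\<close>

definition spherical :: "'b set \<Rightarrow> nat \<Rightarrow> 'i set \<Rightarrow> ('i \<Rightarrow> 'b list) \<Rightarrow> bool" where
  "spherical X n I e \<longleftrightarrow> (\<forall>m xs. xs \<in> simplices X m \<longrightarrow> m \<le> n) \<and> (\<forall>m<n. bounding X m)
     \<and> finite I \<and> e ` I \<subseteq> simplices X n
     \<and> (\<forall>h. \<exists>z\<in>chains X n. boundary z = 0 \<and> (\<forall>i\<in>I. Poly_Mapping.lookup z (e i) = h i))
     \<and> (\<forall>z\<in>chains X n. boundary z = 0 \<longrightarrow> (\<forall>i\<in>I. Poly_Mapping.lookup z (e i) = 0) \<longrightarrow> z = 0)"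

lemma sphericalD:
  assumes "spherical X n I e"
  shows "\<And>m xs. xs \<in> simplices X m \<Longrightarrow> m \<le> n" "\<And>m. m < n \<Longrightarrow> bounding X m"
    "finite I" "\<And>i. i \<in> I \<Longrightarrow> e i \<in> simplices X n"
    "\<And>h. \<exists>z\<in>chains X n. boundary z = 0 \<and> (\<forall>i\<in>I. Poly_Mapping.lookup z (e i) = h i)"
    "\<And>z. z \<in> chains X n \<Longrightarrow> boundary z = 0 \<Longrightarrow> (\<And>i. i \<in> I \<Longrightarrow> Poly_Mapping.lookup z (e i) = 0) \<Longrightarrow> z = 0"
  using assms unfolding spherical_def by blast+

lemma chains_eq_0: "c \<in> chains X n \<Longrightarrow> simplices X n = {} \<Longrightarrow> c = 0"
  by (auto simp: chains_def)

lemma simplices_0 [simp]: "simplices X 0 = {[]}"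
  by (auto simp: simplices_def)

lemma simplices_empty: "xs \<in> simplices {} n \<Longrightarrow> n = 0"
  by (auto simp: simplices_def)

lemma spherical_empty: "e i = [] \<Longrightarrow> spherical {} 0 {i} e"
proof -
  assume e: "e i = []"
  have "\<exists>z\<in>chains {} 0. boundary z = 0 \<and> (\<forall>j\<in>{i}. Poly_Mapping.lookup z (e j) = h j)" for h :: "'a \<Rightarrow> 'k"
    by (rule bexI[of _ "Poly_Mapping.single [] (h i)"]) (auto simp: e intro: single_in_chains)
  moreover have "z = 0" if "z \<in> chains {} 0" "Poly_Mapping.lookup z [] = 0" for z :: "'b list \<Rightarrow>\<^sub>0 'k"
  proof -
    have "Poly_Mapping.lookup z xs = 0" for xs
      using that by (cases "xs = []") (auto simp: chains_def in_keys_iff)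
    then show ?thesis by (intro poly_mapping_eqI) simp
  qed
  ultimately show ?thesis unfolding spherical_def using e simplices_empty by auto
qed

text \<open>Without chains of length \<open>n + 1\<close>, a cycle of length \<open>n\<close> that
  bounds is zero, so that no coordinates are left.\<close>

lemma spherical_acyclic:
  assumes ac: "acyclic X" and dim: "\<And>m xs. xs \<in> simplices X m \<Longrightarrow> m \<le> n"
  shows "spherical X n {} e"
proof -
  have "z = 0" if z: "z \<in> chains X n" "boundary z = 0" for z
  proof -
    from ac z obtain b where b: "b \<in> chains X (Suc n)" "boundary b = z"
      by (auto simp: acyclic_def bounding_def)
    have "simplices X (Suc n) = {}" using dim Suc_n_not_le_n by blast
    with b show ?thesis using chains_eq_0 by fastforce
  qed
  then show ?thesis using ac dim chains_closed(1) unfolding spherical_def acyclic_def by force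
qed

lemma spherical_reindex:
  assumes S: "spherical X n I e" and g: "bij_betw g J I" and e': "\<And>j. j \<in> J \<Longrightarrow> e' j = e (g j)"
  shows "spherical X n J e'"
proof -
  have gJ: "g j \<in> I" if "j \<in> J" for j using g that by (auto simp: bij_betw_def)
  have "\<exists>z\<in>chains X n. boundary z = 0 \<and> (\<forall>j\<in>J. Poly_Mapping.lookup z (e' j) = h j)" for h :: "'c \<Rightarrow> 'k"
  proof -
    obtain z where z: "z \<in> chains X n" "boundary z = 0"
      "\<forall>i\<in>I. Poly_Mapping.lookup z (e i) = h (inv_into J g i)"
      using sphericalD(5)[OF S, of "\<lambda>i. h (inv_into J g i)"] by auto
    then show ?thesis using e' gJ g
      by (intro bexI[of _ z]) (auto simp: bij_betw_def inv_into_f_f)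
  qed
  moreover have "z = 0"
    if "z \<in> chains X n" "boundary z = 0" "\<forall>j\<in>J. Poly_Mapping.lookup z (e' j) = 0" for z
  proof (rule sphericalD(6)[OF S that(1,2)])
    fix i assume "i \<in> I"
    then obtain j where "j \<in> J" "i = g j" using g by (auto simp: bij_betw_def)
    then show "Poly_Mapping.lookup z (e i) = 0" using that e' by metis
  qed
  moreover have "finite J" using g sphericalD(3)[OF S] bij_betw_finite by blast
  ultimately show ?thesis
    using sphericalD[OF S] e' gJ unfolding spherical_def by (auto simp: image_subset_iff)
qed

lemma lookup_ins:
  assumes b: "b \<in> chains (link X w) n" and pq: "\<forall>y\<in>set p. y \<prec> w" "\<forall>y\<in>set q. w \<prec> y"
  shows "Poly_Mapping.lookup (ins w b) (p @ w # q) = (-1) ^ length p * Poly_Mapping.lookup b (p @ q)"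
proof -
  have "Poly_Mapping.lookup (ins w b) (p @ w # q)
      = (\<Sum>xs\<in>Poly_Mapping.keys b. Poly_Mapping.lookup b xs * (if xs = p @ q then (-1) ^ length p else 0))"
    unfolding ins_eq_linext[of w b] lookup_linext
  proof (rule sum.cong, rule refl)
    fix xs assume "xs \<in> Poly_Mapping.keys b"
    then obtain p' q' where p': "xs = p' @ q'" "\<forall>y\<in>set p'. y \<prec> w" "\<forall>y\<in>set q'. w \<prec> y"
      by (rule simplices_link_split[OF keys_chains[OF b]])
    have "p' = p \<and> q' = q" if "p' @ w # q' = p @ w # q \<or> p' @ q' = p @ q"
      using arg_cong[of _ _ "filter (\<lambda>y. y \<prec> w)", OF disjE[OF that]]
        filter_split[OF p'(2,3)] filter_split[OF pq] that irrefl
      by (metis (no_types, lifting) append_Nil2 filter.simps(2) filter_append same_append_eq list.inject)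
    then show "Poly_Mapping.lookup b xs * Poly_Mapping.lookup (ins w (basis xs)) (p @ w # q) =
         Poly_Mapping.lookup b xs * (if xs = p @ q then (-1) ^ length p else 0)"
      by (auto simp: p'(1) ins_basis[OF p'(2,3)] lookup_single when_def)
  qed
  also have "\<dots> = (-1) ^ length p * Poly_Mapping.lookup b (p @ q)"
    by (simp add: if_distrib in_keys_iff mult.commute cong: if_cong)
  finally show ?thesis .
qed

lemma lookup_not_simplex: "c \<in> chains X n \<Longrightarrow> \<not> set xs \<subseteq> X \<Longrightarrow> Poly_Mapping.lookup c xs = 0"
  by (auto simp: chains_def simplices_def in_keys_iff)

text \<open>In the top degree the homology of \<open>X\<close>, of \<open>insert w X\<close> and of
  the link form a short exact sequence, because the homology of \<open>X\<close> vanishes one degree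
  below. The chains indexed by \<open>J\<close> pass through \<open>w\<close> and see only the link
  part of a cycle, while those indexed by \<open>I\<close> avoid \<open>w\<close>. So the two
  systems of coordinates are simply put together.\<close>

theorem spherical_insert:
  assumes w: "w \<notin> X" and X: "spherical X (Suc n) I e" and L: "spherical (link X w) n J f"
    and IJ: "I \<inter> J = {}"
    and e: "\<And>j. j \<in> J \<Longrightarrow> \<exists>p q. f j = p @ q \<and> e j = p @ w # q \<and> (\<forall>y\<in>set p. y \<prec> w) \<and> (\<forall>y\<in>set q. w \<prec> y)"
  shows "spherical (insert w X) (Suc n) (I \<union> J) e"
proof -
  note XD = sphericalD[OF X] and LD = sphericalD[OF L]
  have LX: "link X w \<subseteq> X" by (auto simp: link_def)
  have dim: "m \<le> Suc n" if xs: "xs \<in> simplices (insert w X) m" for m xs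
  proof (cases "w \<in> set xs")
    case True
    then show ?thesis using simplices_insert_split[OF xs True w] LD(1) by (metis Suc_le_mono)
  next
    case False
    then show ?thesis using xs XD(1)[of xs m] by (auto simp: simplices_def)
  qed
  have bnd: "bounding (insert w X) m" if "m < Suc n" for m
    using that XD(2) LD(2) w by (cases m) (auto simp: bounding_0 intro: bounding_insert)
  have eX: "\<not> set (e j) \<subseteq> X" if "j \<in> J" for j using e[OF that] w by auto
  have eL: "Poly_Mapping.lookup (ins w b) (e j) = (-1) ^ length (takeWhile (\<lambda>y. y \<prec> w) (f j)) * Poly_Mapping.lookup b (f j)"
    if j: "j \<in> J" and b: "b \<in> chains (link X w) n" for j b
  proof -
    obtain p q where pq: "f j = p @ q" "e j = p @ w # q" "\<forall>y\<in>set p. y \<prec> w" "\<forall>y\<in>set q. w \<prec> y"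
      using e[OF j] by blast
    have "takeWhile (\<lambda>y. y \<prec> w) (f j) = p"
      using pq by (cases q) (auto simp: takeWhile_append dest: asym)
    then show ?thesis using lookup_ins[OF b pq(3,4)] pq by simp
  qed
  have eI: "w \<notin> set (e i)" if "i \<in> I" for i using XD(4)[OF that] w by (auto simp: simplices_def)
  have lookI: "Poly_Mapping.lookup (ins w b) (e i) = 0" if i: "i \<in> I" and b: "b \<in> chains (link X w) n" for i b
  proof -
    have "Poly_Mapping.lookup (ins w (basis xs)) (e i) = 0" for xs
      using eI[OF i] in_set_conv_decomp[of w "e i"]
      by (simp add: ins_def Let_def lookup_single when_def) metis
    then show ?thesis by (subst ins_eq_linext) (simp add: lookup_linext)
  qed
  have ex: "\<exists>z\<in>chains (insert w X) (Suc n). boundary z = 0 \<and> (\<forall>i\<in>I \<union> J. Poly_Mapping.lookup z (e i) = h i)"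
    for h :: "'a \<Rightarrow> 'k"
  proof -
    obtain b where b: "b \<in> chains (link X w) n" "boundary b = 0"
      "\<forall>j\<in>J. Poly_Mapping.lookup b (f j) = (-1) ^ length (takeWhile (\<lambda>y. y \<prec> w) (f j)) * h j"
      using LD(5)[of "\<lambda>j. (-1) ^ length (takeWhile (\<lambda>y. y \<prec> w) (f j)) * h j"] by auto
    have "- b \<in> chains X n" using chains_mono[OF LX b(1)] by (rule chains_closed)
    then obtain a where a: "a \<in> chains X (Suc n)" "boundary a = - b"
      using XD(2)[of n] b by (auto simp: bounding_def boundary_uminus)
    \<comment> \<open>The choice of \<open>a\<close> disturbs the coordinates in \<open>I\<close>; a
      cycle of \<open>X\<close> corrects them without touching those in \<open>J\<close>, whose
      chains contain \<open>w\<close>.\<close>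
    obtain z where z: "z \<in> chains X (Suc n)" "boundary z = 0"
      "\<forall>i\<in>I. Poly_Mapping.lookup z (e i) = h i - Poly_Mapping.lookup a (e i)"
      using XD(5)[of "\<lambda>i. h i - Poly_Mapping.lookup a (e i)"] by auto
    let ?c = "a + z + ins w b"
    have "?c \<in> chains (insert w X) (Suc n)"
      using chains_mono[OF subset_insertI a(1)] chains_mono[OF subset_insertI z(1)] ins_in_chains[OF b(1)]
      by (intro chains_closed)
    moreover have "boundary ?c = 0"
      using a z b by (simp add: boundary_add boundary_ins[OF b(1)] ins_lin)
    moreover have "Poly_Mapping.lookup ?c (e i) = h i" if "i \<in> I" for i
      using z(3) that b by (simp add: lookup_add lookI)
    moreover have "Poly_Mapping.lookup ?c (e j) = h j" if "j \<in> J" for j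
      using that b eX[OF that] a z
      by (simp add: lookup_add eL lookup_not_simplex[of _ X "Suc n"] power_mult_distrib[symmetric]
          mult.assoc[symmetric])
    ultimately show ?thesis by blast
  qed
  have uniq: "z = 0" if z: "z \<in> chains (insert w X) (Suc n)" "boundary z = 0"
    "\<forall>i\<in>I \<union> J. Poly_Mapping.lookup z (e i) = 0" for z
  proof -
    obtain a b where ab: "a \<in> chains X (Suc n)" "b \<in> chains (link X w) n" "z = a + ins w b"
      using chains_insert_decomp[OF z(1) w] by blast
    note * = cycle_insert_decomp[OF ab(1,2) w z(2)[unfolded ab(3)]]
    have "b = 0"
    proof (rule LD(6)[OF ab(2) *(1)])
      fix j assume j: "j \<in> J"
      then have "Poly_Mapping.lookup z (e j) = 0" using z(3) by blast
      then show "Poly_Mapping.lookup b (f j) = 0"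
        using j ab eX[OF j] by (simp add: lookup_add eL lookup_not_simplex[of a X "Suc n"])
    qed
    moreover have "a = 0"
      by (rule XD(6)[OF ab(1)]) (use * z(3) ab \<open>b = 0\<close> in \<open>auto simp: ins_lin\<close>)
    ultimately show ?thesis using ab by (simp add: ins_lin)
  qed
  have "e ` (I \<union> J) \<subseteq> simplices (insert w X) (Suc n)"
  proof -
    have "e i \<in> simplices (insert w X) (Suc n)" if "i \<in> I" for i
      using XD(4)[OF that] by (auto simp: simplices_def)
    moreover have "e j \<in> simplices (insert w X) (Suc n)" if j: "j \<in> J" for j
    proof -
      obtain p q where "f j = p @ q" "e j = p @ w # q" "\<forall>y\<in>set p. y \<prec> w" "\<forall>y\<in>set q. w \<prec> y"
        using e[OF j] by blast
      then show ?thesis using LD(4)[OF j] LX by (auto simp: simplices_def sorted_wrt_append)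
    qed
    ultimately show ?thesis by blast
  qed
  with dim bnd ex uniq XD(3) LD(3) show ?thesis unfolding spherical_def by blast
qed

end

section \<open>Joins\<close>

text \<open>Equal lengths on the left make the cut of \<open>x @ y\<close> unambiguous.\<close>

lemma lookup_conc:
  assumes "\<And>xs. xs \<in> Poly_Mapping.keys c \<Longrightarrow> length xs = length x"
  shows "Poly_Mapping.lookup (conc c d) (x @ y) = Poly_Mapping.lookup c x * Poly_Mapping.lookup d y"
proof -
  have "Poly_Mapping.lookup (linext (\<lambda>ys. basis (xs @ ys)) d) (x @ y)
      = (if xs = x then Poly_Mapping.lookup d y else 0)" if "xs \<in> Poly_Mapping.keys c" for xs
  proof -
    have "Poly_Mapping.lookup (linext (\<lambda>ys. basis (xs @ ys)) d) (x @ y)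
        = (\<Sum>ys\<in>Poly_Mapping.keys d. if ys = y then (if xs = x then Poly_Mapping.lookup d y else 0) else 0)"
      unfolding lookup_linext
      by (rule sum.cong) (use assms[OF that] in \<open>auto simp: lookup_single when_def\<close>)
    then show ?thesis by (simp add: in_keys_iff)
  qed
  then have "Poly_Mapping.lookup (conc c d) (x @ y)
      = (\<Sum>xs\<in>Poly_Mapping.keys c. if xs = x then Poly_Mapping.lookup c x * Poly_Mapping.lookup d y else 0)"
    unfolding conc_def lookup_linext by (intro sum.cong) auto
  then show ?thesis by (simp add: in_keys_iff)
qed

context strict_poset
begin

context
  fixes A B :: "'b set"
  assumes AB: "\<And>x y. x \<in> A \<Longrightarrow> y \<in> B \<Longrightarrow> x \<prec> y"
begin

private definition fa :: "'b list \<Rightarrow> 'b list" where "fa = filter (\<lambda>x. x \<in> A)"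
private definition fb :: "'b list \<Rightarrow> 'b list" where "fb = filter (\<lambda>x. x \<in> B)"
text \<open>A chain of the join is a sum of products of chains of \<open>A\<close> with simplices
  \<open>\<beta>\<close> of \<open>B\<close>; this is the coefficient of
  \<open>\<beta>\<close>.\<close>

private definition slice :: "'b list \<Rightarrow> ('b list \<Rightarrow>\<^sub>0 'k) \<Rightarrow> ('b list \<Rightarrow>\<^sub>0 'k)" where
  "slice \<beta> = linext (\<lambda>xs. if fb xs = \<beta> then basis (fa xs) else 0)"

private lemma disj: "x \<in> A \<Longrightarrow> x \<in> B \<Longrightarrow> False"
  using AB irrefl by blast

private lemma fa_append: "set \<alpha> \<subseteq> A \<Longrightarrow> set \<beta> \<subseteq> B \<Longrightarrow> fa (\<alpha> @ \<beta>) = \<alpha>"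
  unfolding fa_def filter_append
  by (subst filter_True, blast, subst filter_False) (use disj in auto)

private lemma fb_append: "set \<alpha> \<subseteq> A \<Longrightarrow> set \<beta> \<subseteq> B \<Longrightarrow> fb (\<alpha> @ \<beta>) = \<beta>"
  unfolding fb_def filter_append
  by (subst filter_False) (use disj in \<open>auto simp: filter_id_conv\<close>)

private lemma simplices_split:
  assumes "xs \<in> simplices (A \<union> B) n"
  shows "xs = fa xs @ fb xs" "fa xs \<in> simplices A (length (fa xs))" "fb xs \<in> simplices B (length (fb xs))"
    "length (fa xs) + length (fb xs) = n"
proof -
  have "sorted_wrt (\<prec>) xs \<Longrightarrow> set xs \<subseteq> A \<union> B \<Longrightarrow> xs = fa xs @ fb xs" for xs
  proof (induction xs)
    case (Cons x xs)
    show ?case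
    proof (cases "x \<in> A")
      case True
      then show ?thesis using Cons disj by (auto simp: fa_def fb_def)
    next
      case False
      then have "x \<in> B" using Cons by auto
      then have "set xs \<inter> A = {}" using Cons.prems AB asym by fastforce
      then have "fa xs = []" by (auto simp: fa_def filter_empty_conv)
      then show ?thesis using Cons False \<open>x \<in> B\<close> by (auto simp: fa_def fb_def)
    qed
  qed (simp add: fa_def fb_def)
  then show 1: "xs = fa xs @ fb xs" using assms by (auto simp: simplices_def)
  show "fa xs \<in> simplices A (length (fa xs))" "fb xs \<in> simplices B (length (fb xs))"
    using assms by (auto simp: simplices_def fa_def fb_def intro: sorted_wrt_filter)
  show "length (fa xs) + length (fb xs) = n"
    using arg_cong[OF 1, of length] assms by (simp add: simplices_def)
qed

private lemma simplices_join:
  "\<alpha> \<in> simplices A k \<Longrightarrow> \<beta> \<in> simplices B l \<Longrightarrow> \<alpha> @ \<beta> \<in> simplices (A \<union> B) (k + l)"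
  using AB by (auto simp: simplices_def sorted_wrt_append)

private lemma conc_in_chains:
  "c \<in> chains A k \<Longrightarrow> d \<in> chains B l \<Longrightarrow> conc c d \<in> chains (A \<union> B) (k + l)"
  unfolding conc_def by (intro chains_linext single_in_chains simplices_join) (auto dest: keys_chains)

private lemma slice_in_chains:
  assumes "c \<in> chains (A \<union> B) n"
  shows "slice \<beta> c \<in> chains A (n - length \<beta>)"
  unfolding slice_def
proof (rule chains_linext)
  fix xs assume "xs \<in> Poly_Mapping.keys c"
  note * = simplices_split[OF keys_chains[OF assms this]]
  have "length (fa xs) = n - length (fb xs)" using *(4) by simp
  with *(2) show "(if fb xs = \<beta> then basis (fa xs) else 0) \<in> chains A (n - length \<beta>)"
    by (auto intro: chains_closed single_in_chains)
qed

private lemma slice_sum: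
  assumes "c \<in> chains (A \<union> B) n" and S: "finite S" "\<And>xs. xs \<in> Poly_Mapping.keys c \<Longrightarrow> fb xs \<in> S"
  shows "(\<Sum>\<beta>\<in>S. conc (slice \<beta> c) (basis \<beta>)) = c"
proof -
  have "(\<Sum>\<beta>\<in>S. conc (slice \<beta> c) (basis \<beta>))
      = linext (\<lambda>xs. \<Sum>\<beta>\<in>S. if fb xs = \<beta> then basis (fa xs @ \<beta>) else 0) c"
    unfolding slice_def conc_linext_left
    by (simp add: linext_def sum.swap[of _ S] scale_sum if_distrib[of "\<lambda>c. conc c _"] cong: if_cong)
  also have "\<dots> = c"
    by (rule linext_eq_self) (use S simplices_split(1)[OF keys_chains[OF assms(1)]] in auto)
  finally show ?thesis .
qed

text \<open>Deleting a point of the \<open>B\<close>-part leaves it shorter than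
  \<open>\<beta>\<close>, so that only deletions in the \<open>A\<close>-part contribute to the
  slice at \<open>\<beta>\<close>.\<close>

private lemma slice_boundary:
  assumes c: "c \<in> chains (A \<union> B) n"
    and len: "\<And>xs. xs \<in> Poly_Mapping.keys c \<Longrightarrow> length (fb xs) \<le> length \<beta>"
  shows "slice \<beta> (boundary c) = boundary (slice \<beta> c)"
proof -
  have "slice \<beta> (bdl xs) = boundary (slice \<beta> (basis xs))" if "xs \<in> Poly_Mapping.keys c" for xs
  proof -
    note sp = simplices_split[OF keys_chains[OF c that]]
    define \<alpha> \<beta>' where "\<alpha> = fa xs" and "\<beta>' = fb xs"
    have xs: "xs = \<alpha> @ \<beta>'" and sub: "set \<alpha> \<subseteq> A" "set \<beta>' \<subseteq> B" and l: "length \<beta>' \<le> length \<beta>"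
      using sp len[OF that] by (auto simp: \<alpha>_def \<beta>'_def fa_def fb_def)
    have "slice \<beta> (conc (bdl \<alpha>) (basis \<beta>')) = (if \<beta>' = \<beta> then bdl \<alpha> else 0)"
    proof -
      have "set ys \<subseteq> A" if "ys \<in> Poly_Mapping.keys (bdl \<alpha> :: 'b list \<Rightarrow>\<^sub>0 'k)" for ys
        using keys_bdl[of \<alpha>] that sub by fastforce
      then have "slice \<beta> (conc (bdl \<alpha>) (basis \<beta>')) = linext (\<lambda>ys. if \<beta>' = \<beta> then basis ys else 0) (bdl \<alpha>)"
        unfolding conc_basis_right slice_def linext_linext
        using fa_append[OF _ sub(2)] fb_append[OF _ sub(2)] by (intro linext_cong) auto
      then show ?thesis by auto
    qed
    moreover have "slice \<beta> (conc (basis \<alpha>) (bdl \<beta>')) = 0"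
      unfolding conc_basis_left slice_def linext_linext
    proof (rule linext_eq_zero)
      fix ys assume "ys \<in> Poly_Mapping.keys (bdl \<beta>' :: 'b list \<Rightarrow>\<^sub>0 'k)"
      then obtain p x q where "\<beta>' = p @ x # q" "ys = p @ q" using keys_bdl[of \<beta>'] by blast
      then have "set ys \<subseteq> B" "length ys < length \<beta>" using sub l by auto
      then show "linext (\<lambda>xs. if fb xs = \<beta> then basis (fa xs) else 0) (basis (\<alpha> @ ys)) = (0 :: 'b list \<Rightarrow>\<^sub>0 'k)"
        using fb_append[OF sub(1), of ys] by auto
    qed
    moreover have "slice \<beta> (basis xs) = (if \<beta>' = \<beta> then basis \<alpha> else 0)"
      by (simp add: slice_def \<alpha>_def \<beta>'_def)
    moreover have "slice \<beta> (u + scale a v) = slice \<beta> u + scale a (slice \<beta> v)" for u v a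
      by (simp add: slice_def linext_add linext_scale)
    ultimately show ?thesis by (simp add: xs bdl_append)
  qed
  then have "linext (\<lambda>xs. slice \<beta> (bdl xs)) c = linext (\<lambda>xs. boundary (slice \<beta> (basis xs))) c"
    by (rule linext_cong)
  then show ?thesis by (simp add: boundary_linext slice_def linext_linext)
qed

text \<open>Here all \<open>A\<close>-parts have the top length \<open>a\<close>. The slices are
  then top cycles of \<open>A\<close> and expand in the basis \<open>\<epsilon>\<close> dual to the
  coordinates; collecting the coefficients gives the \<open>d i\<close>.\<close>

private lemma top_decomposition:
  assumes SA: "spherical A a I e"
    and \<epsilon>: "\<And>i. \<epsilon> i \<in> chains A a" "\<And>i. boundary (\<epsilon> i) = 0"
      "\<And>i j. j \<in> I \<Longrightarrow> Poly_Mapping.lookup (\<epsilon> i) (e j) = (if i = j then 1 else 0)"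
    and c: "c \<in> chains (A \<union> B) (a + p)" "boundary c = 0"
      "\<And>xs. xs \<in> Poly_Mapping.keys c \<Longrightarrow> length (fb xs) = p"
  obtains d where "\<And>i. i \<in> I \<Longrightarrow> d i \<in> chains B p" "\<And>i. i \<in> I \<Longrightarrow> boundary (d i) = 0"
    "c = (\<Sum>i\<in>I. conc (\<epsilon> i) (d i))"
proof -
  note AD = sphericalD[OF SA]
  let ?S = "fb ` Poly_Mapping.keys c"
  have S: "\<beta> \<in> simplices B p" if "\<beta> \<in> ?S" for \<beta>
    using that simplices_split(3)[OF keys_chains[OF c(1)]] c(3) by force
  have lenS: "length \<beta> = p" if "\<beta> \<in> ?S" for \<beta> using S[OF that] by (simp add: simplices_def)
  define d where "d i = (\<Sum>\<beta>\<in>?S. Poly_Mapping.single \<beta> (Poly_Mapping.lookup (slice \<beta> c) (e i)))" for i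
  have dB: "d i \<in> chains B p" for i
    unfolding d_def using S by (intro chains_sum single_in_chains) auto
  have sl: "slice \<beta> c = (\<Sum>i\<in>I. scale (Poly_Mapping.lookup (slice \<beta> c) (e i)) (\<epsilon> i))" if \<beta>: "\<beta> \<in> ?S" for \<beta>
  proof -
    have mem: "slice \<beta> c \<in> chains A a" using slice_in_chains[OF c(1), of \<beta>] lenS[OF \<beta>] by simp
    have bd: "boundary (slice \<beta> c) = 0"
      using slice_boundary[OF c(1), of \<beta>] c lenS[OF \<beta>] by (simp add: slice_def)
    have "slice \<beta> c - (\<Sum>i\<in>I. scale (Poly_Mapping.lookup (slice \<beta> c) (e i)) (\<epsilon> i)) = 0"
    proof (rule AD(6))
      show "slice \<beta> c - (\<Sum>i\<in>I. scale (Poly_Mapping.lookup (slice \<beta> c) (e i)) (\<epsilon> i)) \<in> chains A a"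
        using mem \<epsilon> by (intro chains_closed chains_sum) auto
      show "boundary (slice \<beta> c - (\<Sum>i\<in>I. scale (Poly_Mapping.lookup (slice \<beta> c) (e i)) (\<epsilon> i))) = 0"
        using bd \<epsilon> by (simp add: boundary_diff boundary_sum boundary_scale)
    next
      fix j assume "j \<in> I"
      then show "Poly_Mapping.lookup (slice \<beta> c - (\<Sum>i\<in>I. scale (Poly_Mapping.lookup (slice \<beta> c) (e i)) (\<epsilon> i))) (e j) = 0"
        by (simp add: lookup_minus lookup_sum \<epsilon>(3)[OF \<open>j \<in> I\<close>] AD(3) if_distrib cong: if_cong)
    qed
    then show ?thesis by simp
  qed
  have "c = (\<Sum>\<beta>\<in>?S. conc (slice \<beta> c) (basis \<beta>))"
    by (rule slice_sum[OF c(1), symmetric]) auto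
  also have "\<dots> = (\<Sum>\<beta>\<in>?S. \<Sum>i\<in>I. conc (\<epsilon> i) (Poly_Mapping.single \<beta> (Poly_Mapping.lookup (slice \<beta> c) (e i))))"
  proof (rule sum.cong[OF refl])
    fix \<beta> assume "\<beta> \<in> ?S"
    have *: "conc (scale r u) (basis \<beta>) = conc u (Poly_Mapping.single \<beta> r)" for r and u :: "'b list \<Rightarrow>\<^sub>0 'k"
      using conc_linear(4)[of u r "basis \<beta>"] by simp
    have "conc (slice \<beta> c) (basis \<beta>)
        = conc (\<Sum>i\<in>I. scale (Poly_Mapping.lookup (slice \<beta> c) (e i)) (\<epsilon> i)) (basis \<beta>)"
      by (rule arg_cong[OF sl[OF \<open>\<beta> \<in> ?S\<close>]])
    also have "\<dots> = (\<Sum>i\<in>I. conc (\<epsilon> i) (Poly_Mapping.single \<beta> (Poly_Mapping.lookup (slice \<beta> c) (e i))))"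
      by (simp only: conc_sum_left *)
    finally show "conc (slice \<beta> c) (basis \<beta>)
        = (\<Sum>i\<in>I. conc (\<epsilon> i) (Poly_Mapping.single \<beta> (Poly_Mapping.lookup (slice \<beta> c) (e i))))" .
  qed
  also have "\<dots> = (\<Sum>i\<in>I. conc (\<epsilon> i) (d i))"
    by (subst sum.swap) (simp add: d_def conc_sum_right)
  finally have cd: "c = (\<Sum>i\<in>I. conc (\<epsilon> i) (d i))" .
  have keys_\<epsilon>: "length xs = a" if "xs \<in> Poly_Mapping.keys (\<epsilon> i)" for xs i
    using keys_chains[OF \<epsilon>(1) that] by (simp add: simplices_def)
  have "boundary (d j) = 0" if j: "j \<in> I" for j
  proof (rule poly_mapping_eqI)
    fix \<gamma>
    have len: "length (e j) = a" using AD(4)[OF j] by (simp add: simplices_def)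
    \<comment> \<open>The coefficient at \<open>e j @ \<gamma>\<close> isolates
      \<open>boundary (d j)\<close>, as \<open>\<epsilon>\<close> is dual to
      \<open>e\<close>.\<close>
    have "0 = Poly_Mapping.lookup (boundary (\<Sum>i\<in>I. conc (\<epsilon> i) (d i))) (e j @ \<gamma>)"
      using c(2) cd by simp
    also have "\<dots> = (\<Sum>i\<in>I. (-1) ^ a * Poly_Mapping.lookup (conc (\<epsilon> i) (boundary (d i))) (e j @ \<gamma>))"
      by (simp add: boundary_sum boundary_conc[OF keys_\<epsilon>] \<epsilon>(2) lookup_sum)
    also have "\<dots> = (\<Sum>i\<in>I. if i = j then (-1) ^ a * Poly_Mapping.lookup (boundary (d j)) \<gamma> else 0)"
      by (intro sum.cong) (auto simp: lookup_conc keys_\<epsilon> len \<epsilon>(3) j)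
    also have "\<dots> = (-1) ^ a * Poly_Mapping.lookup (boundary (d j)) \<gamma>"
      using j AD(3) by simp
    finally show "Poly_Mapping.lookup (boundary (d j)) \<gamma> = Poly_Mapping.lookup 0 \<gamma>" by simp
  qed
  with dB cd show thesis by (intro that) auto
qed

text \<open>The Kuenneth formula for joins: top cycles are sums of products of top cycles, so that
  the index sets multiply. That shorter cycles bound is shown by induction on a bound for the
  lengths of the \<open>B\<close>-parts. The longest ones are removed by filling their slices in
  \<open>A\<close>; once the \<open>A\<close>-parts have top length, the cofactors
  \<open>d i\<close> are filled in \<open>B\<close> instead.\<close>

theorem spherical_join:
  assumes SA: "spherical A a I e" and SB: "spherical B b J f"
  shows "spherical (A \<union> B) (a + b) (I \<times> J) (\<lambda>(i, j). e i @ f j)"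
proof -
  note AD = sphericalD[OF SA] and BD = sphericalD[OF SB]
  have "\<exists>z\<in>chains A a. boundary z = 0 \<and> (\<forall>j\<in>I. Poly_Mapping.lookup z (e j) = (if i = j then 1 else 0))" for i
    using AD(5)[of "\<lambda>j. if i = j then 1 else 0"] .
  then obtain \<epsilon> where \<epsilon>: "\<And>i. \<epsilon> i \<in> chains A a" "\<And>i. boundary (\<epsilon> i) = 0"
    "\<And>i j. j \<in> I \<Longrightarrow> Poly_Mapping.lookup (\<epsilon> i) (e j) = (if i = j then 1 else 0)"
    by metis
  have keys_\<epsilon>: "length xs = a" if "xs \<in> Poly_Mapping.keys (\<epsilon> i)" for xs i
    using keys_chains[OF \<epsilon>(1) that] by (simp add: simplices_def)
  have bnd: "\<exists>b\<in>chains (A \<union> B) (Suc n). boundary b = c"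
    if "n < a + b" "c \<in> chains (A \<union> B) n" "boundary c = 0"
      "\<And>xs. xs \<in> Poly_Mapping.keys c \<Longrightarrow> length (fb xs) < p" for n c p
    using that(2-)
  proof (induction p arbitrary: c)
    case 0
    then have "Poly_Mapping.keys c = {}" by blast
    then show ?case using chains_closed(1) by (intro bexI[of _ 0]) auto
  next
    case (Suc p)
    note sp = simplices_split[OF keys_chains[OF Suc.prems(1)]]
    show ?case
    proof (cases "n < a + p")
      case True
      define S where "S = {\<beta> \<in> fb ` Poly_Mapping.keys c. length \<beta> = p}"
      have S: "\<beta> \<in> simplices B p" "p \<le> n" if "\<beta> \<in> S" for \<beta>
        using that sp(3,4) unfolding S_def by force+
      have "\<exists>u\<in>chains A (Suc (n - p)). boundary u = slice \<beta> c" if "\<beta> \<in> S" for \<beta>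
      proof -
        have "slice \<beta> c \<in> chains A (n - p)" using slice_in_chains[OF Suc.prems(1), of \<beta>] that by (simp add: S_def)
        moreover have "boundary (slice \<beta> c) = 0"
          using slice_boundary[OF Suc.prems(1), of \<beta>] that Suc.prems(2,3)
          by (force simp: S_def slice_def less_Suc_eq_le)
        moreover have "bounding A (n - p)" using AD(2) True S(2)[OF that] by simp
        ultimately show ?thesis by (auto simp: bounding_def)
      qed
      then obtain u where u: "\<And>\<beta>. \<beta> \<in> S \<Longrightarrow> u \<beta> \<in> chains A (Suc (n - p))" "\<And>\<beta>. \<beta> \<in> S \<Longrightarrow> boundary (u \<beta>) = slice \<beta> c"
        by metis
      \<comment> \<open>The remainder \<open>r\<close> of the boundary of \<open>v\<close> only has
        \<open>B\<close>-parts shorter than \<open>p\<close>, and so has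
        \<open>c - boundary v\<close>, to which the induction hypothesis applies.\<close>
      define v where "v = (\<Sum>\<beta>\<in>S. conc (u \<beta>) (basis \<beta>))"
      have v: "v \<in> chains (A \<union> B) (Suc n)"
        unfolding v_def
      proof (rule chains_sum)
        fix \<beta> assume \<beta>: "\<beta> \<in> S"
        show "conc (u \<beta>) (basis \<beta>) \<in> chains (A \<union> B) (Suc n)"
          using conc_in_chains[OF u(1)[OF \<beta>] single_in_chains[OF S(1)[OF \<beta>]]] S(2)[OF \<beta>] by (simp add: Suc_diff_le)
      qed
      define r where "r = (\<Sum>\<beta>\<in>S. scale ((-1) ^ Suc (n - p)) (conc (u \<beta>) (bdl \<beta>)))"
      have bv: "boundary v = (\<Sum>\<beta>\<in>S. conc (slice \<beta> c) (basis \<beta>)) + r"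
        unfolding v_def r_def boundary_sum sum.distrib[symmetric]
      proof (rule sum.cong[OF refl])
        fix \<beta> assume \<beta>: "\<beta> \<in> S"
        have "length xs = Suc (n - p)" if "xs \<in> Poly_Mapping.keys (u \<beta>)" for xs
          using keys_chains[OF u(1)[OF \<beta>] that] by (simp add: simplices_def)
        then show "boundary (conc (u \<beta>) (basis \<beta>)) = conc (slice \<beta> c) (basis \<beta>) + scale ((-1) ^ Suc (n - p)) (conc (u \<beta>) (bdl \<beta>))"
          by (simp add: boundary_conc u(2)[OF \<beta>])
      qed
      let ?K = "{xs. length (fb xs) < p}"
      have "Poly_Mapping.keys (c - boundary v) \<subseteq> ?K"
      proof -
        have "c = (\<Sum>\<beta>\<in>fb ` Poly_Mapping.keys c. conc (slice \<beta> c) (basis \<beta>))"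
          by (rule slice_sum[OF Suc.prems(1), symmetric]) auto
        also have "\<dots> = (\<Sum>\<beta>\<in>S. conc (slice \<beta> c) (basis \<beta>))
            + (\<Sum>\<beta>\<in>fb ` Poly_Mapping.keys c - S. conc (slice \<beta> c) (basis \<beta>))"
          by (subst sum.subset_diff[of S]) (auto simp: S_def add.commute)
        finally have e: "c = \<dots>" .
        have "c = u + u' \<Longrightarrow> c - (u + r) = u' - r" for u u' by simp
        from this[OF e] have "c - boundary v = (\<Sum>\<beta>\<in>fb ` Poly_Mapping.keys c - S. conc (slice \<beta> c) (basis \<beta>)) - r"
          unfolding bv .
        moreover have "Poly_Mapping.keys (\<Sum>\<beta>\<in>fb ` Poly_Mapping.keys c - S. conc (slice \<beta> c) (basis \<beta>)) \<subseteq> ?K"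
        proof (intro keys_sum_subset)
          fix \<beta> assume \<beta>: "\<beta> \<in> fb ` Poly_Mapping.keys c - S"
          then have "set \<beta> \<subseteq> B" "length \<beta> < p" using Suc.prems(3) by (auto simp: S_def fb_def less_Suc_eq)
          moreover have "set \<alpha> \<subseteq> A" if "\<alpha> \<in> Poly_Mapping.keys (slice \<beta> c)" for \<alpha>
            using keys_chains[OF slice_in_chains[OF Suc.prems(1)] that] by (simp add: simplices_def)
          ultimately show "Poly_Mapping.keys (conc (slice \<beta> c) (basis \<beta>)) \<subseteq> ?K"
            unfolding conc_basis_right by (intro keys_linext_subset) (auto simp: fb_append)
        qed
        moreover have "Poly_Mapping.keys r \<subseteq> ?K"
          unfolding r_def
        proof (intro keys_sum_subset order_trans[OF keys_scale])
          fix \<beta> assume \<beta>: "\<beta> \<in> S"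
          show "Poly_Mapping.keys (conc (u \<beta>) (bdl \<beta>)) \<subseteq> ?K"
            unfolding conc_def
          proof (intro keys_linext_subset)
            fix x y assume x: "x \<in> Poly_Mapping.keys (u \<beta>)" and y: "y \<in> Poly_Mapping.keys (bdl \<beta> :: 'b list \<Rightarrow>\<^sub>0 'k)"
            have "set x \<subseteq> A" using keys_chains[OF u(1)[OF \<beta>] x] by (simp add: simplices_def)
            moreover have "set y \<subseteq> B" "length y < p"
              using y keys_bdl[of \<beta>] S(1)[OF \<beta>] by (fastforce simp: simplices_def)+
            ultimately show "Poly_Mapping.keys (basis (x @ y) :: 'b list \<Rightarrow>\<^sub>0 'k) \<subseteq> ?K" by (simp add: fb_append)
          qed
        qed
        ultimately show ?thesis by (simp add: keys_diff_subset)
      qed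
      then have "\<exists>b\<in>chains (A \<union> B) (Suc n). boundary b = c - boundary v"
        using Suc.prems v by (intro Suc.IH) (auto intro: chains_closed boundary_in_chains simp: boundary_diff)
      then obtain b where "b \<in> chains (A \<union> B) (Suc n)" "boundary b = c - boundary v" by blast
      then show ?thesis using v by (intro bexI[of _ "b + v"]) (auto simp: boundary_add chains_closed)
    next
      case False
      \<comment> \<open>The lengths of the two parts are at most \<open>a\<close> and
        \<open>p\<close> but add up to \<open>n \<ge> a + p\<close>, so that both are
        extremal.\<close>
      have len: "length (fb xs) = p \<and> n = a + p" if "xs \<in> Poly_Mapping.keys c" for xs
        using sp(4)[OF that] AD(1)[OF sp(2)[OF that]] Suc.prems(3)[OF that] False by linarith
      show ?thesis
      proof (cases "c = 0")
        case True
        then show ?thesis using chains_closed(1) by (intro bexI[of _ 0]) auto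
      next
        case False
        then have n: "n = a + p" using len by (metis all_not_in_conv keys_eq_empty)
        obtain d where d: "\<And>i. i \<in> I \<Longrightarrow> d i \<in> chains B p" "\<And>i. i \<in> I \<Longrightarrow> boundary (d i) = 0"
          "c = (\<Sum>i\<in>I. conc (\<epsilon> i) (d i))"
          by (rule top_decomposition[OF SA \<epsilon> Suc.prems(1)[unfolded n] Suc.prems(2)]) (use len in auto)
        have "p < b" using n \<open>n < a + b\<close> by simp
        then have "\<forall>i\<in>I. \<exists>v\<in>chains B (Suc p). boundary v = d i"
          using BD(2) d by (auto simp: bounding_def)
        then obtain v where v: "\<And>i. i \<in> I \<Longrightarrow> v i \<in> chains B (Suc p)" "\<And>i. i \<in> I \<Longrightarrow> boundary (v i) = d i"
          by metis
        let ?b = "\<Sum>i\<in>I. scale ((-1) ^ a) (conc (\<epsilon> i) (v i))"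
        have "?b \<in> chains (A \<union> B) (Suc n)"
        proof (intro chains_sum chains_closed)
          fix i assume "i \<in> I"
          then show "conc (\<epsilon> i) (v i) \<in> chains (A \<union> B) (Suc n)"
            using conc_in_chains[OF \<epsilon>(1) v(1)] n by simp
        qed
        moreover have "boundary ?b = c"
          by (simp add: d(3) boundary_sum boundary_scale boundary_conc[OF keys_\<epsilon>] \<epsilon>(2) v(2)
              power_mult_distrib[symmetric])
        ultimately show ?thesis by blast
      qed
    qed
  qed
  have "bounding (A \<union> B) n" if "n < a + b" for n
    unfolding bounding_def
  proof (intro ballI impI)
    fix c assume c: "c \<in> chains (A \<union> B) n" "boundary c = 0"
    show "\<exists>b\<in>chains (A \<union> B) (Suc n). boundary b = c"
      by (rule bnd[OF that c, of "Suc n"])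
        (use simplices_split(4)[OF keys_chains[OF c(1)]] in force)
  qed
  moreover have "m \<le> a + b" if "xs \<in> simplices (A \<union> B) m" for m xs
    using AD(1)[OF simplices_split(2)[OF that]] BD(1)[OF simplices_split(3)[OF that]]
      simplices_split(4)[OF that] by simp
  moreover have "(\<lambda>(i, j). e i @ f j) ` (I \<times> J) \<subseteq> simplices (A \<union> B) (a + b)"
    using simplices_join AD(4) BD(4) by auto
  moreover have "\<exists>z\<in>chains (A \<union> B) (a + b). boundary z = 0 \<and>
      (\<forall>ij\<in>I \<times> J. Poly_Mapping.lookup z ((\<lambda>(i, j). e i @ f j) ij) = h ij)" for h :: "'a \<times> 'c \<Rightarrow> 'k"
  proof -
    have "\<exists>z\<in>chains B b. boundary z = 0 \<and> (\<forall>j\<in>J. Poly_Mapping.lookup z (f j) = h (i, j))" for i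
      using BD(5)[of "\<lambda>j. h (i, j)"] .
    then obtain d where d: "\<And>i. d i \<in> chains B b" "\<And>i. boundary (d i) = 0"
      "\<And>i j. j \<in> J \<Longrightarrow> Poly_Mapping.lookup (d i) (f j) = h (i, j)" by metis
    let ?z = "\<Sum>i\<in>I. conc (\<epsilon> i) (d i)"
    have "?z \<in> chains (A \<union> B) (a + b)" by (intro chains_sum conc_in_chains \<epsilon> d)
    moreover have "boundary ?z = 0"
      by (simp add: boundary_sum boundary_conc[OF keys_\<epsilon>] \<epsilon>(2) d(2))
    moreover have "Poly_Mapping.lookup ?z (e i @ f j) = h (i, j)" if ij: "i \<in> I" "j \<in> J" for i j
    proof -
      have len: "length (e i) = a" using AD(4)[OF ij(1)] by (simp add: simplices_def)
      have "Poly_Mapping.lookup ?z (e i @ f j) = (\<Sum>i'\<in>I. if i' = i then h (i, j) else 0)"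
        unfolding lookup_sum
        by (intro sum.cong) (auto simp: lookup_conc keys_\<epsilon> len \<epsilon>(3) ij d(3))
      then show ?thesis using AD(3) ij by simp
    qed
    ultimately show ?thesis by (intro bexI[of _ ?z]) auto
  qed
  moreover have "z = 0" if z: "z \<in> chains (A \<union> B) (a + b)" "boundary z = 0"
    "\<forall>ij\<in>I \<times> J. Poly_Mapping.lookup z ((\<lambda>(i, j). e i @ f j) ij) = 0" for z
  proof -
    have len: "length (fb xs) = b" if "xs \<in> Poly_Mapping.keys z" for xs
      using AD(1)[OF simplices_split(2)[OF keys_chains[OF z(1) that]]]
        BD(1)[OF simplices_split(3)[OF keys_chains[OF z(1) that]]]
        simplices_split(4)[OF keys_chains[OF z(1) that]] by simp
    obtain d where d: "\<And>i. i \<in> I \<Longrightarrow> d i \<in> chains B b" "\<And>i. i \<in> I \<Longrightarrow> boundary (d i) = 0"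
      "z = (\<Sum>i\<in>I. conc (\<epsilon> i) (d i))"
      by (rule top_decomposition[OF SA \<epsilon> z(1,2) len]) auto
    have "d i = 0" if i: "i \<in> I" for i
    proof (rule BD(6)[OF d(1)[OF i] d(2)[OF i]])
      fix j assume j: "j \<in> J"
      have len: "length (e i) = a" using AD(4)[OF i] by (simp add: simplices_def)
      have "0 = Poly_Mapping.lookup (\<Sum>i'\<in>I. conc (\<epsilon> i') (d i')) (e i @ f j)"
        using z(3) i j d(3) by auto
      also have "\<dots> = (\<Sum>i'\<in>I. if i' = i then Poly_Mapping.lookup (d i) (f j) else 0)"
        unfolding lookup_sum
        by (intro sum.cong) (auto simp: lookup_conc keys_\<epsilon> len \<epsilon>(3) i)
      finally show "Poly_Mapping.lookup (d i) (f j) = 0" using AD(3) i by simp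
    qed
    then show ?thesis using d(3) by simp
  qed
  ultimately show ?thesis using AD(3) BD(3) unfolding spherical_def by blast
qed

end

end

section \<open>Isomorphisms, ranks and semimodularity\<close>

lemma bdl_map: "bdl (map f xs) = pushforward (map f) (bdl xs)"
  by (induction xs) (simp_all add: pushforward_linext linext_diff linext_linext)

lemma boundary_pushforward: "boundary (pushforward (map f) c) = pushforward (map f) (boundary c)"
  by (simp add: boundary_linext pushforward_linext linext_linext bdl_map)

lemma pushforward_0 [simp]: "pushforward f 0 = 0"
  by (simp add: pushforward_linext)

text \<open>The two orders live on whole types, while the bijections of interest only compare them
  on a subset.\<close>

locale strict_poset_iso = A: strict_poset K lt + B: strict_poset K lt'
  for K :: "'k::field itself" and lt :: "'b \<Rightarrow> 'b \<Rightarrow> bool" and lt' :: "'c \<Rightarrow> 'c \<Rightarrow> bool" +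
  fixes \<phi> :: "'b \<Rightarrow> 'c" and X :: "'b set"
  assumes inj: "inj_on \<phi> X" and iso: "x \<in> X \<Longrightarrow> y \<in> X \<Longrightarrow> lt' (\<phi> x) (\<phi> y) \<longleftrightarrow> lt x y"
begin

abbreviation "psi \<equiv> inv_into X \<phi>"

lemma simplices_map: "xs \<in> A.simplices X n \<Longrightarrow> map \<phi> xs \<in> B.simplices (\<phi> ` X) n"
  by (auto simp: A.simplices_def B.simplices_def sorted_wrt_map subset_iff iso elim!: sorted_wrt_mono_rel[rotated])

lemma simplices_map_inv:
  assumes "ys \<in> B.simplices (\<phi> ` X) n"
  shows "map psi ys \<in> A.simplices X n" "map \<phi> (map psi ys) = ys"
proof -
  have sub: "set ys \<subseteq> \<phi> ` X" using assms by (simp add: B.simplices_def)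
  then show eq: "map \<phi> (map psi ys) = ys" by (auto intro!: map_idI simp: f_inv_into_f subset_iff)
  have "lt (psi x) (psi y)" if "x \<in> set ys" "y \<in> set ys" "lt' x y" for x y
    using that subsetD[OF sub that(1)] subsetD[OF sub that(2)]
    by (subst iso[symmetric]) (simp_all only: inv_into_into f_inv_into_f)
  then show "map psi ys \<in> A.simplices X n"
    using assms by (auto simp: A.simplices_def B.simplices_def sorted_wrt_map inv_into_into
        elim!: sorted_wrt_mono_rel[rotated])
qed

lemma chains_map: "c \<in> A.chains X n \<Longrightarrow> pushforward (map \<phi>) c \<in> B.chains (\<phi> ` X) n"
  unfolding pushforward_linext
  by (intro B.chains_linext B.single_in_chains simplices_map) (rule A.keys_chains)

lemma chains_map_inv:
  assumes "c \<in> B.chains (\<phi> ` X) n"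
  shows "pushforward (map psi) c \<in> A.chains X n" "pushforward (map \<phi>) (pushforward (map psi) c) = c"
  unfolding pushforward_linext linext_linext
  using simplices_map_inv[OF B.keys_chains[OF assms]]
  by (auto intro!: A.chains_linext A.single_in_chains linext_eq_self)

lemma lookup_map:
  assumes "c \<in> A.chains X n" "xs \<in> A.simplices X n"
  shows "Poly_Mapping.lookup (pushforward (map \<phi>) c) (map \<phi> xs) = Poly_Mapping.lookup c xs"
proof (rule lookup_pushforward_inj[of _ "lists X"])
  show "inj_on (map \<phi>) (lists X)" by (rule inj_on_mapI, rule inj_on_subset[OF inj]) auto
qed (use assms in \<open>auto simp: A.chains_def A.simplices_def\<close>)

lemma bounding_iso:
  assumes "A.bounding X n"
  shows "B.bounding (\<phi> ` X) n"
  unfolding B.bounding_def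
proof (intro ballI impI)
  fix c :: "'c list \<Rightarrow>\<^sub>0 'k" assume c: "c \<in> B.chains (\<phi> ` X) n" "boundary c = 0"
  have "boundary (pushforward (map psi) c) = 0"
    by (simp add: boundary_pushforward c)
  then obtain b where b: "b \<in> A.chains X (Suc n)" "boundary b = pushforward (map psi) c"
    using assms chains_map_inv(1)[OF c(1)] unfolding A.bounding_def by blast
  then have "boundary (pushforward (map \<phi>) b) = c"
    by (simp add: boundary_pushforward chains_map_inv(2)[OF c(1)])
  with chains_map[OF b(1)] show "\<exists>b\<in>B.chains (\<phi> ` X) (Suc n). boundary b = c" by blast
qed

lemma spherical_iso:
  assumes S: "A.spherical X n I e"
  shows "B.spherical (\<phi> ` X) n I (\<lambda>i. map \<phi> (e i))"
proof -
  note AD = A.sphericalD[OF S]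
  have "\<exists>z\<in>B.chains (\<phi> ` X) n. boundary z = 0 \<and> (\<forall>i\<in>I. Poly_Mapping.lookup z (map \<phi> (e i)) = h i)"
    for h :: "'a \<Rightarrow> 'k"
  proof -
    obtain z where z: "z \<in> A.chains X n" "boundary z = 0" "\<forall>i\<in>I. Poly_Mapping.lookup z (e i) = h i"
      using AD(5)[of h] by blast
    then show ?thesis
      using chains_map lookup_map AD(4)
      by (intro bexI[of _ "pushforward (map \<phi>) z"]) (auto simp: boundary_pushforward)
  qed
  moreover have "z = 0"
    if z: "z \<in> B.chains (\<phi> ` X) n" "boundary z = 0" "\<forall>i\<in>I. Poly_Mapping.lookup z (map \<phi> (e i)) = 0" for z
  proof -
    note inv = chains_map_inv[OF z(1)]
    have "pushforward (map psi) z = 0"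
    proof (rule AD(6)[OF inv(1)])
      show "boundary (pushforward (map psi) z) = 0"
        by (simp add: boundary_pushforward z)
      fix i assume "i \<in> I"
      then show "Poly_Mapping.lookup (pushforward (map psi) z) (e i) = 0"
        using lookup_map[OF inv(1) AD(4)] inv(2) z(3) by simp
    qed
    with inv(2) show ?thesis by simp
  qed
  moreover have "m \<le> n" if "xs \<in> B.simplices (\<phi> ` X) m" for m xs
    using AD(1) simplices_map_inv(1)[OF that] .
  moreover have "(\<lambda>i. map \<phi> (e i)) ` I \<subseteq> B.simplices (\<phi> ` X) n"
    using AD(4) simplices_map by blast
  ultimately show ?thesis
    unfolding B.spherical_def using AD(2,3) bounding_iso by blast
qed

end

context strict_poset
begin

lemma simplices_length:
  fixes rk :: "'b \<Rightarrow> nat"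
  assumes mono: "\<And>x y. x \<in> X \<Longrightarrow> y \<in> X \<Longrightarrow> x \<prec> y \<Longrightarrow> rk x < rk y"
    and range: "\<And>x. x \<in> X \<Longrightarrow> rk x \<in> {lo..<hi}" and xs: "xs \<in> simplices X m"
  shows "m \<le> hi - lo"
proof -
  have "sorted_wrt (<) (map rk xs)"
    unfolding sorted_wrt_map
    by (rule sorted_wrt_mono_rel[of _ "(\<prec>)"]) (use xs mono in \<open>auto simp: simplices_def\<close>)
  then have "distinct (map rk xs)" by (simp add: strict_sorted_iff)
  then have "m = card (set (map rk xs))" using xs by (simp only: distinct_card) (simp add: simplices_def)
  also have "\<dots> \<le> card {lo..<hi}"
    by (rule card_mono) (use xs range in \<open>auto simp: simplices_def\<close>)
  finally show ?thesis by simp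
qed

context
  fixes P :: "'b set" and rk :: "'b \<Rightarrow> nat"
  assumes fin: "finite P"
    and rk: "x \<in> P \<Longrightarrow> y \<in> P \<Longrightarrow> x \<prec> y \<Longrightarrow> rk x < rk y"
    and graded: "x \<in> P \<Longrightarrow> y \<in> P \<Longrightarrow> x \<prec> y \<Longrightarrow> \<exists>c\<in>P. (x = c \<or> x \<prec> c) \<and> c \<prec> y \<and> rk y = Suc (rk c)"
    and semimodular: "\<lbrakk>x \<in> P; y \<in> P; z \<in> P; t \<in> P; x \<prec> z; y \<prec> z; x \<noteq> y; rk z = Suc (rk x); rk z = Suc (rk y);
      t = x \<or> t \<prec> x; t = y \<or> t \<prec> y\<rbrakk> \<Longrightarrow> \<exists>u\<in>P. (t = u \<or> t \<prec> u) \<and> u \<prec> x \<and> u \<prec> y \<and> rk x = Suc (rk u)"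
begin

text \<open>
  Adding the ideals below the coatoms one at a time, each intersection is again a union of such ideals, one
  rank lower, by semimodularity.
\<close>

lemma bounding_coatom_ideals:
  fixes t :: 'b
  defines "ideal \<equiv> \<lambda>S. {u \<in> P. t \<prec> u \<and> (\<exists>a\<in>S. u = a \<or> u \<prec> a)}"
  assumes t: "t \<in> P" and z: "z \<in> P" "S \<subseteq> {c \<in> P. c \<prec> z \<and> rk z = Suc (rk c) \<and> (t = c \<or> t \<prec> c)}" "S \<noteq> {}"
    "Suc l < rk z - rk t"
  shows "bounding (ideal S) l"
  using z
proof (induction "rk z" arbitrary: z S l rule: less_induct)
  case less
  let ?C = "\<lambda>z. {c \<in> P. c \<prec> z \<and> rk z = Suc (rk c) \<and> (t = c \<or> t \<prec> c)}"
  \<comment> \<open>The rank gap is at least two, so that no coatom coincides with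
    \<open>t\<close>.\<close>
  have tC: "t \<prec> c" if "c \<in> ?C z" for c
    using that less.prems(4) by auto
  show ?case
  proof (cases l)
    case 0
    from less.prems obtain a where "a \<in> S" "a \<in> ?C z" by blast
    with tC have "a \<in> ideal S" unfolding ideal_def by auto
    then show ?thesis using 0 bounding_0 by blast
  next
    case (Suc k)
    have "finite S" using less.prems(2) fin finite_subset by fastforce
    then show ?thesis
      using \<open>S \<noteq> {}\<close> \<open>S \<subseteq> ?C z\<close>
    proof (induction S rule: finite_ne_induct)
      case (singleton a)
      have "acyclic (ideal {a})"
        by (rule acyclic_cone[of a]) (use singleton tC[of a] in \<open>auto simp: ideal_def\<close>)
      then show ?case by (simp add: acyclic_def)
    next
      case (insert a S)
      let ?J = "{b \<in> ?C a. \<exists>a'\<in>S. b = a' \<or> b \<prec> a'}"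
      have a: "a \<in> ?C z" "a \<notin> S" and S: "S \<subseteq> ?C z" using insert by auto
      have meet: "\<exists>b\<in>?J. s = b \<or> s \<prec> b"
        if s: "s \<in> P" "t = s \<or> t \<prec> s" "s = a \<or> s \<prec> a" "a' \<in> S" "s = a' \<or> s \<prec> a'" for s a'
      proof -
        have "\<exists>u\<in>P. (s = u \<or> s \<prec> u) \<and> u \<prec> a \<and> u \<prec> a' \<and> rk a = Suc (rk u)"
          by (rule semimodular[of a a' z s]) (use s a S less.prems in auto)
        then show ?thesis using s by (auto dest: trans)
      qed
      have "ideal S \<inter> ideal {a} = ideal ?J"
      proof (intro equalityI subsetI)
        fix u assume "u \<in> ideal S \<inter> ideal {a}"
        then obtain a' where "u \<in> P" "t \<prec> u" "a' \<in> S" "u = a' \<or> u \<prec> a'" "u = a \<or> u \<prec> a"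
          by (auto simp: ideal_def)
        with meet[of u a'] show "u \<in> ideal ?J" by (auto simp: ideal_def)
      next
        fix u assume "u \<in> ideal ?J"
        then obtain b a' where "u \<in> P" "t \<prec> u" "u = b \<or> u \<prec> b" "b \<prec> a" "a' \<in> S" "b = a' \<or> b \<prec> a'"
          by (auto simp: ideal_def)
        then show "u \<in> ideal S \<inter> ideal {a}" by (auto simp: ideal_def dest: trans)
      qed
      moreover have "bounding (ideal ?J) k"
      proof (rule less.hyps)
        show "rk a < rk z" "a \<in> P" using a by auto
        show "?J \<subseteq> ?C a" by blast
        obtain a' where "a' \<in> S" using insert by blast
        then show "?J \<noteq> {}" using meet[of t a'] t a S by blast
        show "Suc k < rk a - rk t" using less.prems(4) Suc a by auto
      qed
      moreover have "acyclic (ideal {a})"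
        by (rule acyclic_cone[of a]) (use a tC[of a] in \<open>auto simp: ideal_def\<close>)
      moreover have "bounding (ideal S) (Suc k)" using insert.IH[OF S] Suc by blast
      \<comment> \<open>The largest element of a chain decides, as an ideal contains everything
        between \<open>t\<close> and its members.\<close>
      moreover have "set xs \<subseteq> ideal S \<or> set xs \<subseteq> ideal {a}"
        if xs: "xs \<in> simplices (ideal S \<union> ideal {a}) (Suc k)" for xs
      proof -
        have ne: "xs \<noteq> []" and sub: "set xs \<subseteq> ideal S \<union> ideal {a}" using xs by (auto simp: simplices_def)
        have "sorted_wrt (\<prec>) (butlast xs @ [last xs])" using xs ne by (simp add: simplices_def)
        then have le: "x = last xs \<or> x \<prec> last xs" if "x \<in> set xs" for x
          using that ne by (metis append_butlast_last_id in_set_conv_decomp rotate1.simps(2)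
              set_ConsD set_rotate1 sorted_wrt_append list.set_intros(1))
        have "last xs \<in> ideal S \<union> ideal {a}" using sub last_in_set[OF ne] by blast
        moreover have "set xs \<subseteq> ideal T" if "last xs \<in> ideal T" for T
          using that le sub unfolding ideal_def by (auto dest: trans)
        ultimately show ?thesis by blast
      qed
      ultimately have "bounding (ideal S \<union> ideal {a}) (Suc k)"
        by (intro Mayer_Vietoris) (auto simp: acyclic_def)
      moreover have "ideal S \<union> ideal {a} = ideal (insert a S)" by (auto simp: ideal_def)
      ultimately show ?case using Suc by simp
    qed
  qed
qed

text \<open>The open interval is the union of the ideals below all its coatoms, which settles the
  lengths below the top one, and longer chains do not exist. The excluded \<open>l\<close> is the
  length \<open>rk y - rk x - 1\<close> of the maximal chains.\<close>

theorem bounding_interval: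
  assumes xy: "x \<in> P" "y \<in> P" "x \<prec> y" and l: "Suc l \<noteq> rk y - rk x"
  shows "bounding {z \<in> P. x \<prec> z \<and> z \<prec> y} l"
proof (cases "Suc l < rk y - rk x")
  case True
  let ?C = "{c \<in> P. c \<prec> y \<and> rk y = Suc (rk c) \<and> (x = c \<or> x \<prec> c)}"
  have "?C \<noteq> {}" using graded[OF xy] by blast
  then have "bounding {u \<in> P. x \<prec> u \<and> (\<exists>a\<in>?C. u = a \<or> u \<prec> a)} l"
    by (intro bounding_coatom_ideals[where z = y]) (use xy True in auto)
  also have "{u \<in> P. x \<prec> u \<and> (\<exists>a\<in>?C. u = a \<or> u \<prec> a)} = {z \<in> P. x \<prec> z \<and> z \<prec> y}"
  proof (intro equalityI subsetI)
    fix u assume "u \<in> {z \<in> P. x \<prec> z \<and> z \<prec> y}"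
    then have u: "u \<in> P" "x \<prec> u" "u \<prec> y" by auto
    from graded[OF u(1) xy(2) u(3)] u
    show "u \<in> {u \<in> P. x \<prec> u \<and> (\<exists>a\<in>?C. u = a \<or> u \<prec> a)}" by (auto dest: trans)
  qed (auto dest: trans)
  finally show ?thesis .
next
  case False
  have "m \<le> rk y - Suc (rk x)" if "xs \<in> simplices {z \<in> P. x \<prec> z \<and> z \<prec> y} m" for xs m
    by (rule simplices_length[OF _ _ that, of rk]) (use rk xy in \<open>auto simp: Suc_le_eq\<close>)
  then have "simplices {z \<in> P. x \<prec> z \<and> z \<prec> y} l = {}" using False l rk[OF xy] by fastforce
  then show ?thesis unfolding bounding_def using chains_eq_0 chains_closed(1) by fastforce
qed

end

end

section \<open>The order on decorated partitions: rank, covers, semimodularity, retractions\<close>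

section \<open>Decorated partitions as sets of decorated blocks\<close>

text \<open>
  A decorated partition is encoded as the set of the pairs of a block and its decoration. Its support, the union
  of the blocks, is allowed to vary: the empty partition then serves as the adjoined least element, and the
  decorated partitions of \<open>N\<close> in which the block of \<open>s\<close> is decorated by \<open>{s}\<close> correspond, by removing this block,
  to decorated partitions with support in \<open>N - {s}\<close>.
\<close>

type_synonym 'a dpart = "('a set \<times> 'a set) set"

definition supp :: "'a dpart \<Rightarrow> 'a set" where
  "supp x = \<Union> (fst ` x)"

definition dpart :: "'a dpart \<Rightarrow> bool" where
  "dpart x \<longleftrightarrow> (\<forall>B S. (B, S) \<in> x \<longrightarrow> S \<noteq> {} \<and> S \<subseteq> B)
     \<and> (\<forall>B S C R a. (B, S) \<in> x \<longrightarrow> (C, R) \<in> x \<longrightarrow> a \<in> B \<longrightarrow> a \<in> C \<longrightarrow> B = C \<and> S = R)"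

text \<open>That \<open>Q\<close> meets each block of \<open>y\<close> inside \<open>A\<close> in
  nothing or in its whole decoration means that \<open>Q\<close> is the union of the decorations of
  some of these blocks, as in the operadic composition. Blocks of \<open>y\<close> off
  \<open>supp x\<close> are free: they belong to the block left out of \<open>x\<close>, whose
  decoration lies outside \<open>supp y\<close>.\<close>

definition coarser :: "'a dpart \<Rightarrow> 'a dpart \<Rightarrow> bool" (infix "\<preceq>" 50) where
  "x \<preceq> y \<longleftrightarrow> supp x \<subseteq> supp y \<and> (\<forall>B S. (B, S) \<in> y \<longrightarrow>
     B \<inter> supp x = {} \<or> (\<exists>A Q. (A, Q) \<in> x \<and> B \<subseteq> A \<and> (Q \<inter> B = {} \<or> Q \<inter> B = S)))"

text \<open>Well-formedness is built in, because \<open>coarser\<close> is antisymmetric on the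
  \<open>dpart\<close>s while the locale asks for a strict order on the whole type.\<close>

definition scoarser :: "'a dpart \<Rightarrow> 'a dpart \<Rightarrow> bool" (infix "\<lless>" 50) where
  "x \<lless> y \<longleftrightarrow> dpart x \<and> dpart y \<and> x \<preceq> y \<and> x \<noteq> y"

definition dparts :: "'a set \<Rightarrow> 'a dpart set" where
  "dparts N = {x. dpart x \<and> supp x = N}"

definition singles :: "'a set \<Rightarrow> 'a dpart" where
  "singles T = (\<lambda>a. ({a}, {a})) ` T"

definition decs :: "'a dpart \<Rightarrow> 'a set" where
  "decs x = \<Union> (snd ` x)"

lemma dpartD:
  assumes "dpart x" "(B, S) \<in> x"
  shows "S \<noteq> {}" "S \<subseteq> B" "B \<noteq> {}" "B \<subseteq> supp x"
  using assms by (force simp: dpart_def supp_def)+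

lemma dpart_unique:
  "dpart x \<Longrightarrow> (B, S) \<in> x \<Longrightarrow> (C, R) \<in> x \<Longrightarrow> a \<in> B \<Longrightarrow> a \<in> C \<Longrightarrow> B = C \<and> S = R"
  by (simp add: dpart_def)

lemma in_supp: "a \<in> supp x \<longleftrightarrow> (\<exists>B S. (B, S) \<in> x \<and> a \<in> B)"
  by (force simp: supp_def)

lemma in_decs: "a \<in> decs x \<longleftrightarrow> (\<exists>B S. (B, S) \<in> x \<and> a \<in> S)"
  by (force simp: decs_def)

lemma supp_simps [simp]:
  "supp {} = {}" "supp (insert (B, S) x) = B \<union> supp x" "supp (x \<union> y) = supp x \<union> supp y" "supp (singles T) = T"
  by (auto simp: supp_def singles_def)

lemma dpart_empty [simp]: "dpart {}"
  by (simp add: dpart_def)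

lemma dpart_supp_empty: "dpart x \<Longrightarrow> supp x = {} \<longleftrightarrow> x = {}"
  by (metis dpartD(3,4) ex_in_conv subset_empty supp_simps(1) surj_pair)

lemma in_singles: "(B, S) \<in> singles T \<longleftrightarrow> (\<exists>a\<in>T. B = {a} \<and> S = {a})"
  by (auto simp: singles_def)

lemma dpart_singles [simp]: "dpart (singles T)"
  by (auto simp: dpart_def in_singles)

lemma dpart_Un: "dpart x \<Longrightarrow> dpart y \<Longrightarrow> supp x \<inter> supp y = {} \<Longrightarrow> dpart (x \<union> y)"
  unfolding dpart_def by (auto simp: disjoint_iff in_supp)

lemma dpartI:
  assumes "\<And>B S. (B, S) \<in> x \<Longrightarrow> S \<noteq> {} \<and> S \<subseteq> B"
    "\<And>B S C R a. (B, S) \<in> x \<Longrightarrow> (C, R) \<in> x \<Longrightarrow> a \<in> B \<Longrightarrow> a \<in> C \<Longrightarrow> B = C \<and> S = R"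
  shows "dpart x"
  unfolding dpart_def using assms by metis

lemma dpart_subset:
  assumes "dpart x" "y \<subseteq> x"
  shows "dpart y"
proof (rule dpartI)
  show "S \<noteq> {} \<and> S \<subseteq> B" if "(B, S) \<in> y" for B S
    using dpartD[OF assms(1) subsetD[OF assms(2) that]] by simp
  show "B = C \<and> S = R" if "(B, S) \<in> y" "(C, R) \<in> y" "a \<in> B" "a \<in> C" for B S C R a
    by (rule dpart_unique[OF assms(1) subsetD[OF assms(2) that(1)] subsetD[OF assms(2) that(2)] that(3,4)])
qed

lemma dpart_insert:
  assumes "dpart x" "S \<noteq> {}" "S \<subseteq> B" "B \<inter> supp x = {}"
  shows "dpart (insert (B, S) x)"
proof -
  have "dpart {(B, S)}" using assms(2,3) by (simp add: dpart_def)
  from dpart_Un[OF this assms(1)] assms(4) show ?thesis by simp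
qed

lemma dpart_subset_Pow:
  assumes "dpart x" "supp x \<subseteq> N"
  shows "x \<subseteq> Pow N \<times> Pow N"
proof (rule subrelI)
  fix B S assume "(B, S) \<in> x"
  then have "S \<subseteq> B" "B \<subseteq> supp x" using dpartD(2,4)[OF assms(1)] by blast+
  then show "(B, S) \<in> Pow N \<times> Pow N" using assms(2) by auto
qed

lemma finite_dparts_subset: "finite N \<Longrightarrow> finite {x. dpart x \<and> supp x \<subseteq> N}"
  by (rule finite_subset[of _ "Pow (Pow N \<times> Pow N)"]) (use dpart_subset_Pow[of _ N] in auto)

lemma finite_dparts: "finite N \<Longrightarrow> finite (dparts N)"
  by (rule finite_subset[OF _ finite_dparts_subset[of N]]) (auto simp: dparts_def)

lemma finite_dpart: "dpart x \<Longrightarrow> finite (supp x) \<Longrightarrow> finite x"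
  by (rule finite_subset[OF dpart_subset_Pow[of x "supp x"]]) auto

lemma coarser_refl [simp]:
  assumes "dpart x"
  shows "x \<preceq> x"
proof -
  have "S \<inter> B = S" if "(B, S) \<in> x" for B S using dpartD(2)[OF assms that] by blast
  then show ?thesis unfolding coarser_def by blast
qed

lemma coarser_supp: "x \<preceq> y \<Longrightarrow> supp x \<subseteq> supp y"
  by (simp add: coarser_def)

lemma coarserE:
  assumes "x \<preceq> y" "(B, S) \<in> y" "B \<inter> supp x \<noteq> {}"
  obtains A Q where "(A, Q) \<in> x" "B \<subseteq> A" "Q \<inter> B = {} \<or> Q \<inter> B = S"
proof -
  from assms(1,2) have "B \<inter> supp x = {} \<or> (\<exists>A Q. (A, Q) \<in> x \<and> B \<subseteq> A \<and> (Q \<inter> B = {} \<or> Q \<inter> B = S))"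
    unfolding coarser_def by blast
  with assms(3) that show thesis by blast
qed

lemma coarser_trans:
  assumes xy: "x \<preceq> y" and yz: "y \<preceq> z"
  shows "x \<preceq> z"
  unfolding coarser_def
proof (intro conjI allI impI)
  show "supp x \<subseteq> supp z" using xy yz by (auto simp: coarser_def)
  fix C R assume C: "(C, R) \<in> z"
  show "C \<inter> supp x = {} \<or> (\<exists>A Q. (A, Q) \<in> x \<and> C \<subseteq> A \<and> (Q \<inter> C = {} \<or> Q \<inter> C = R))"
  proof (cases "C \<inter> supp x = {}")
    case False
    then have "C \<inter> supp y \<noteq> {}" using coarser_supp[OF xy] by blast
    then obtain B S where B: "(B, S) \<in> y" "C \<subseteq> B" "S \<inter> C = {} \<or> S \<inter> C = R"
      using yz C coarserE by metis
    with False have "B \<inter> supp x \<noteq> {}" by blast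
    then obtain A Q where A: "(A, Q) \<in> x" "B \<subseteq> A" "Q \<inter> B = {} \<or> Q \<inter> B = S"
      using xy B(1) coarserE by metis
    have "Q \<inter> C = (Q \<inter> B) \<inter> C" using B(2) by blast
    then have "Q \<inter> C = {} \<or> Q \<inter> C = R" using A(3) B(3) by auto
    then show ?thesis using A(1,2) B(2) by blast
  qed simp
qed

lemma coarser_block:
  assumes "x \<preceq> y" "dpart x" "(A, Q) \<in> x" "a \<in> A"
  obtains B S where "(B, S) \<in> y" "a \<in> B" "B \<subseteq> A" "Q \<inter> B = {} \<or> Q \<inter> B = S"
proof -
  have "a \<in> supp x" using dpartD(4)[OF assms(2,3)] assms(4) by blast
  moreover then have "a \<in> supp y" using coarser_supp[OF assms(1)] by blast
  then obtain B S where B: "(B, S) \<in> y" "a \<in> B" by (auto simp: in_supp)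
  ultimately obtain A' Q' where A: "(A', Q') \<in> x" "B \<subseteq> A'" "Q' \<inter> B = {} \<or> Q' \<inter> B = S"
    using assms(1) coarserE[of x y B S] by blast
  then have "A' = A \<and> Q' = Q" using dpart_unique[OF assms(2) A(1) assms(3), of a] B assms(4) by blast
  then show thesis using that[OF B] A by blast
qed

lemma coarser_decs:
  assumes "x \<preceq> y" "dpart x"
  shows "decs x \<subseteq> decs y"
proof
  fix a assume "a \<in> decs x"
  then obtain A Q where A: "(A, Q) \<in> x" "a \<in> Q" by (auto simp: in_decs)
  then have "a \<in> A" using dpartD(2)[OF assms(2)] by blast
  then obtain B S where "(B, S) \<in> y" "a \<in> B" "B \<subseteq> A" "Q \<inter> B = {} \<or> Q \<inter> B = S"
    using coarser_block[OF assms A(1)] by metis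
  then show "a \<in> decs y" using A(2) by (auto simp: in_decs)
qed

text \<open>Through a point of a block of \<open>x\<close> there is a block of \<open>y\<close>
  inside it, and a block of \<open>x\<close> inside that one. The latter is the first block again,
  so that all three coincide.\<close>

lemma coarser_antisym:
  assumes "x \<preceq> y" "y \<preceq> x" "dpart x" "dpart y"
  shows "x = y"
proof -
  have "x \<subseteq> y" if xy: "x \<preceq> y" "y \<preceq> x" "dpart x" "dpart y" for x y :: "'a dpart"
  proof (rule subrelI)
    fix B S assume B: "(B, S) \<in> x"
    then obtain b where b: "b \<in> B" using dpartD(3)[OF xy(3)] by blast
    obtain C R where C: "(C, R) \<in> y" "b \<in> C" "C \<subseteq> B" "S \<inter> C = {} \<or> S \<inter> C = R"
      using coarser_block[OF xy(1,3) B b] .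
    obtain D T where D: "(D, T) \<in> x" "b \<in> D" "D \<subseteq> C" "R \<inter> D = {} \<or> R \<inter> D = T"
      using coarser_block[OF xy(2,4) C(1,2)] .
    have "D = B \<and> T = S" using dpart_unique[OF xy(3) D(1) B D(2) b] .
    then have "C = B" using C D by blast
    moreover have "R = S" using C(4) dpartD(1,2)[OF xy(3) B] \<open>C = B\<close> by blast
    ultimately show "(B, S) \<in> y" using C(1) by simp
  qed
  then show ?thesis using assms by blast
qed

lemma strict_poset_scoarser: "strict_poset scoarser"
proof
  show "\<not> x \<lless> x" for x :: "'a dpart" by (simp add: scoarser_def)
  show "x \<lless> y \<Longrightarrow> y \<lless> z \<Longrightarrow> x \<lless> z" for x y z :: "'a dpart"
    unfolding scoarser_def using coarser_trans coarser_antisym by metis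
qed

lemma coarser_iff_scoarser: "dpart x \<Longrightarrow> dpart y \<Longrightarrow> x \<preceq> y \<longleftrightarrow> x = y \<or> x \<lless> y"
  by (auto simp: scoarser_def)

lemma empty_coarser [simp]: "{} \<preceq> x"
  by (simp add: coarser_def)

lemma coarser_singles: "dpart x \<Longrightarrow> x \<preceq> singles T \<longleftrightarrow> supp x \<subseteq> T"
proof
  assume "dpart x" and sub: "supp x \<subseteq> T"
  show "x \<preceq> singles T"
    unfolding coarser_def
  proof (intro conjI allI impI)
    fix B S assume "(B, S) \<in> singles T"
    then obtain a where a: "B = {a}" "S = {a}" by (auto simp: in_singles)
    show "B \<inter> supp x = {} \<or> (\<exists>A Q. (A, Q) \<in> x \<and> B \<subseteq> A \<and> (Q \<inter> B = {} \<or> Q \<inter> B = S))"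
      using a by (cases "a \<in> supp x") (auto simp: in_supp)
  qed (simp add: sub)
qed (use coarser_supp in fastforce)

text \<open>The order on unions with supports in separate sets is the product order, because no
  block straddles \<open>T\<close> and \<open>T'\<close>.\<close>

lemma coarser_Un_iff:
  assumes "supp x \<union> supp x' \<subseteq> T" "supp z \<union> supp z' \<subseteq> T'" "T \<inter> T' = {}"
    "dpart x" "dpart x'" "dpart z" "dpart z'"
  shows "x \<union> z \<preceq> x' \<union> z' \<longleftrightarrow> x \<preceq> x' \<and> z \<preceq> z'"
proof
  assume L: "x \<union> z \<preceq> x' \<union> z'"
  have *: "x \<preceq> x'" if h: "x \<union> z \<preceq> x' \<union> z'" "supp x \<union> supp x' \<subseteq> T" "supp z \<union> supp z' \<subseteq> T'" "T \<inter> T' = {}" "dpart x'" "dpart z"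
    for x x' z z' :: "'a dpart" and T T'
    unfolding coarser_def
  proof (intro conjI allI impI)
    show "supp x \<subseteq> supp x'"
      using coarser_supp[OF h(1)] h(2-4) unfolding supp_simps by (blast dest: equalityD1)
    fix B S assume B: "(B, S) \<in> x'"
    have BT: "B \<subseteq> T" "B \<noteq> {}" using dpartD(3,4)[OF h(5) B] h(2) by auto
    show "B \<inter> supp x = {} \<or> (\<exists>A Q. (A, Q) \<in> x \<and> B \<subseteq> A \<and> (Q \<inter> B = {} \<or> Q \<inter> B = S))"
    proof (cases "B \<inter> supp x = {}")
      case False
      then obtain A Q where A: "(A, Q) \<in> x \<union> z" "B \<subseteq> A" "Q \<inter> B = {} \<or> Q \<inter> B = S"
        using coarserE[OF h(1), of B S] B by auto
      moreover have "(A, Q) \<notin> z" using A(2) BT h(3,4) dpartD(4)[OF h(6), of A Q] by blast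
      ultimately show ?thesis by blast
    qed simp
  qed
  show "x \<preceq> x' \<and> z \<preceq> z'"
    using *[OF L assms(1-3,5,6)] *[of z x z' x' T' T] L assms by (simp add: Un_commute Int_commute)
next
  assume R: "x \<preceq> x' \<and> z \<preceq> z'"
  then have s: "supp x \<subseteq> supp x'" "supp z \<subseteq> supp z'" by (auto dest: coarser_supp)
  show "x \<union> z \<preceq> x' \<union> z'"
    unfolding coarser_def
  proof (intro conjI allI impI)
    show "supp (x \<union> z) \<subseteq> supp (x' \<union> z')" using s by auto
    fix B S assume "(B, S) \<in> x' \<union> z'"
    then show "B \<inter> supp (x \<union> z) = {} \<or> (\<exists>A Q. (A, Q) \<in> x \<union> z \<and> B \<subseteq> A \<and> (Q \<inter> B = {} \<or> Q \<inter> B = S))"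
    proof
      assume B: "(B, S) \<in> x'"
      have "B \<inter> supp z = {}" using dpartD(4)[OF assms(5) B] assms(1-3) by blast
      show ?thesis
      proof (cases "B \<inter> supp x = {}")
        case True
        then show ?thesis using \<open>B \<inter> supp z = {}\<close> by (simp add: Int_Un_distrib)
      next
        case False
        then obtain A Q where "(A, Q) \<in> x" "B \<subseteq> A" "Q \<inter> B = {} \<or> Q \<inter> B = S"
          using R B coarserE by metis
        then show ?thesis by blast
      qed
    next
      assume B: "(B, S) \<in> z'"
      have "B \<inter> supp x = {}" using dpartD(4)[OF assms(7) B] assms(1-3) by blast
      show ?thesis
      proof (cases "B \<inter> supp z = {}")
        case True
        then show ?thesis using \<open>B \<inter> supp x = {}\<close> by (simp add: Int_Un_distrib)
      next
        case False
        then obtain A Q where "(A, Q) \<in> z" "B \<subseteq> A" "Q \<inter> B = {} \<or> Q \<inter> B = S"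
          using R B coarserE by metis
        then show ?thesis by blast
      qed
    qed
  qed
qed

text \<open>Inside each block of \<open>x\<close> choose a block of \<open>y\<close> compatible with
  the decoration; the choice is injective. If it were also onto, the chosen block would fill the
  block of \<open>x\<close> and, decorations being nonempty, carry its decoration. The number of
  blocks will serve as the rank.\<close>

lemma card_less:
  assumes "x \<lless> y" "finite (supp y)"
  shows "card x < card y"
proof -
  have d: "dpart x" "dpart y" "x \<preceq> y" "x \<noteq> y" using assms by (auto simp: scoarser_def)
  have fin: "finite x" "finite y"
    using finite_dpart d(1,2) assms(2) coarser_supp[OF d(3)] finite_subset by blast+
  have "\<exists>b\<in>y. fst b \<subseteq> fst a \<and> (snd a \<inter> fst b = {} \<or> snd a \<inter> fst b = snd b)" if ax: "a \<in> x" for a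
  proof -
    obtain A Q where a: "a = (A, Q)" by force
    with ax have AQ: "(A, Q) \<in> x" by simp
    then obtain e where e: "e \<in> A" using dpartD(3)[OF d(1)] by blast
    obtain B S where B: "(B, S) \<in> y" "e \<in> B" "B \<subseteq> A" "Q \<inter> B = {} \<or> Q \<inter> B = S"
      using coarser_block[OF d(3,1) AQ e] .
    show ?thesis by (rule bexI[OF _ B(1)]) (use B in \<open>simp add: a\<close>)
  qed
  then obtain g where g: "\<And>a. a \<in> x \<Longrightarrow> g a \<in> y" "\<And>a. a \<in> x \<Longrightarrow> fst (g a) \<subseteq> fst a"
    "\<And>a. a \<in> x \<Longrightarrow> snd a \<inter> fst (g a) = {} \<or> snd a \<inter> fst (g a) = snd (g a)" by metis
  have inj: "inj_on g x"
  proof (rule inj_onI)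
    fix a a' assume a: "a \<in> x" "a' \<in> x" "g a = g a'"
    obtain e where "e \<in> fst (g a)" using dpartD(3)[OF d(2), of "fst (g a)" "snd (g a)"] g(1)[OF a(1)] by auto
    then show "a = a'"
      using dpart_unique[OF d(1), of "fst a" "snd a" "fst a'" "snd a'" e] g(2)[of a] g(2)[of a'] a
      by (auto simp: prod_eq_iff)
  qed
  have "card x \<noteq> card y"
  proof
    assume "card x = card y"
    then have gy: "g ` x = y"
      using inj g(1) fin by (metis card_image card_subset_eq image_subsetI)
    have "g a = a" if a: "a \<in> x" for a
    proof -
      obtain A Q where AQ: "a = (A, Q)" by force
      have "A \<subseteq> fst (g a)"
      proof
        fix e assume e: "e \<in> A"
        then obtain B S where B: "(B, S) \<in> y" "e \<in> B" "B \<subseteq> A"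
          using coarser_block[OF d(3,1) a[unfolded AQ] e] by metis
        then obtain a' where a': "a' \<in> x" "g a' = (B, S)" using gy by force
        then have "e \<in> fst a'" using g(2)[OF a'(1)] B by auto
        then have "a' = a"
          using dpart_unique[OF d(1), of "fst a'" "snd a'" A Q e] a' a AQ e by (auto simp: prod_eq_iff)
        then show "e \<in> fst (g a)" using a' B by simp
      qed
      then have "fst (g a) = A" using g(2)[OF a] AQ by auto
      moreover have "snd (g a) = Q"
        using g(3)[OF a] dpartD(1,2)[OF d(1), of A Q] a AQ \<open>fst (g a) = A\<close> by (auto simp: Int_absorb2)
      ultimately show ?thesis using AQ by (metis prod.collapse)
    qed
    then have "x = y" using gy by force
    then show False using d by simp
  qed
  moreover have "card x \<le> card y" using card_inj_on_le[OF inj _ fin(2)] g(1) by blast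
  ultimately show ?thesis by simp
qed

lemma card_singles [simp]: "card (singles T) = card T"
  by (simp add: singles_def card_image inj_on_def)

section \<open>Merging blocks\<close>

definition merge :: "'a dpart \<Rightarrow> 'a set \<times> 'a set \<Rightarrow> 'a set \<times> 'a set \<Rightarrow> 'a set \<Rightarrow> 'a dpart" where
  "merge z b c T = insert (fst b \<union> fst c, T) (z - {b, c})"

text \<open>The three elements of \<open>ComTriAss\<close> on a two-element set, evaluated at the
  decorations of \<open>b\<close> and \<open>c\<close>.\<close>

definition vdec :: "'a set \<times> 'a set \<Rightarrow> 'a set \<times> 'a set \<Rightarrow> 'a set \<Rightarrow> bool" where
  "vdec b c T \<longleftrightarrow> T \<in> {snd b, snd c, snd b \<union> snd c}"

lemma merge_commute: "merge z b c T = merge z c b T"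
  by (simp add: merge_def Un_commute insert_commute)

lemma vdec_commute: "vdec b c T = vdec c b T"
  by (auto simp: vdec_def)

lemma vdec_UnI:
  "X = Y \<union> Z \<Longrightarrow> Y = {} \<or> Y = snd b \<Longrightarrow> Z = {} \<or> Z = snd c \<Longrightarrow> X \<noteq> {} \<Longrightarrow> vdec b c X"
  by (auto simp: vdec_def)

lemma block_eqI:
  assumes "dpart z" "b \<in> z" "c \<in> z" "a \<in> fst b" "a \<in> fst c"
  shows "b = c"
  using dpart_unique[of z "fst b" "snd b" "fst c" "snd c" a] assms by (simp add: prod_eq_iff)

lemma block_nonempty:
  assumes "dpart z" "b \<in> z"
  obtains a where "a \<in> fst b"
proof -
  have "fst b \<noteq> {}" using dpartD(3)[OF assms(1), of "fst b" "snd b"] assms(2) by simp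
  then show thesis using that by blast
qed

lemma block_disjoint: "dpart z \<Longrightarrow> b \<in> z \<Longrightarrow> c \<in> z \<Longrightarrow> b \<noteq> c \<Longrightarrow> fst b \<inter> fst c = {}"
  using block_eqI[of z b c] by blast

lemma block_dec: "dpart z \<Longrightarrow> b \<in> z \<Longrightarrow> snd b \<noteq> {} \<and> snd b \<subseteq> fst b \<and> fst b \<subseteq> supp z"
  using dpartD(1,2,4)[of z "fst b" "snd b"] by simp

lemma merge_block_notin:
  assumes "dpart z" "b \<in> z" "c \<in> z" "b \<noteq> c"
  shows "(fst b \<union> fst c, T) \<notin> z"
proof
  assume *: "(fst b \<union> fst c, T) \<in> z"
  obtain a a' where a: "a \<in> fst b" "a' \<in> fst c" using block_nonempty assms by metis
  have "b = (fst b \<union> fst c, T)"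
    by (rule block_eqI[OF assms(1) assms(2) *, of a]) (use a in auto)
  moreover have "c = (fst b \<union> fst c, T)"
    by (rule block_eqI[OF assms(1) assms(3) *, of a']) (use a in auto)
  ultimately show False using assms(4) by metis
qed

lemma supp_image_Un: "b \<in> z \<Longrightarrow> c \<in> z \<Longrightarrow> supp z = fst b \<union> fst c \<union> supp (z - {b, c})"
  by (auto simp: supp_def)

lemma supp_merge:
  assumes "b \<in> z" "c \<in> z"
  shows "supp (merge z b c T) = supp z"
  by (simp add: merge_def supp_image_Un[OF assms] Un_assoc)

lemma dpart_merge:
  assumes z: "dpart z" and b: "b \<in> z" "c \<in> z" and T: "vdec b c T"
  shows "dpart (merge z b c T)"
  unfolding merge_def
proof (rule dpart_insert)
  show "dpart (z - {b, c})" using z by (rule dpart_subset) auto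
  show "T \<noteq> {}" "T \<subseteq> fst b \<union> fst c" using T block_dec[OF z b(1)] block_dec[OF z b(2)] by (auto simp: vdec_def)
  show "(fst b \<union> fst c) \<inter> supp (z - {b, c}) = {}"
  proof (rule ccontr)
    assume "(fst b \<union> fst c) \<inter> supp (z - {b, c}) \<noteq> {}"
    then obtain a d where "d \<in> z" "d \<noteq> b" "d \<noteq> c" "a \<in> fst d" "a \<in> fst b \<or> a \<in> fst c"
      unfolding supp_def by blast
    then show False using block_eqI[OF z] b by blast
  qed
qed

lemma card_merge:
  assumes "dpart z" "finite z" "b \<in> z" "c \<in> z" "b \<noteq> c"
  shows "card z = Suc (card (merge z b c T))"
proof -
  have "card {b, c} \<le> card z" by (rule card_mono) (use assms in auto)
  moreover have "card (z - {b, c}) = card z - card {b, c}" by (rule card_Diff_subset) (use assms in auto)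
  ultimately have "card (z - {b, c}) = card z - 2" "2 \<le> card z" using assms(5) by simp_all
  then show ?thesis
    using assms merge_block_notin[of z b c T] by (simp add: merge_def)
qed

lemma merge_coarser:
  assumes z: "dpart z" and b: "b \<in> z" "c \<in> z" "b \<noteq> c" and T: "vdec b c T"
  shows "merge z b c T \<preceq> z"
  unfolding coarser_def
proof (intro conjI allI impI disjI2)
  show "supp (merge z b c T) \<subseteq> supp z" using b by (simp add: supp_merge)
  fix B S assume B: "(B, S) \<in> z"
  note db = block_dec[OF z b(1)] and dc = block_dec[OF z b(2)] and dis = block_disjoint[OF z b]
  have T': "T = snd b \<or> T = snd c \<or> T = snd b \<union> snd c" using T by (simp add: vdec_def)
  show "\<exists>A Q. (A, Q) \<in> merge z b c T \<and> B \<subseteq> A \<and> (Q \<inter> B = {} \<or> Q \<inter> B = S)"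
  proof (cases "(B, S) = b \<or> (B, S) = c")
    case True
    then have "T \<inter> B = {} \<or> T \<inter> B = S" "B \<subseteq> fst b \<union> fst c"
      using T' db dc dis by (elim disjE; auto; blast)+
    then show ?thesis unfolding merge_def by blast
  next
    case False
    then have "(B, S) \<in> merge z b c T" "S \<inter> B = S" using B dpartD(2)[OF z B] by (auto simp: merge_def)
    then show ?thesis by blast
  qed
qed

lemma coarser_mergeI:
  assumes t: "t \<preceq> z" and b: "b \<in> z" "c \<in> z" and D: "(D, Q) \<in> t" "fst b \<union> fst c \<subseteq> D"
    "Q \<inter> (fst b \<union> fst c) = {} \<or> Q \<inter> (fst b \<union> fst c) = T"
  shows "t \<preceq> merge z b c T"
  unfolding coarser_def
proof (intro conjI allI impI)
  show "supp t \<subseteq> supp (merge z b c T)" using coarser_supp[OF t] b by (simp add: supp_merge)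
  fix B S assume "(B, S) \<in> merge z b c T"
  then consider "B = fst b \<union> fst c" "S = T" | "(B, S) \<in> z" by (auto simp: merge_def)
  then show "B \<inter> supp t = {} \<or> (\<exists>A Q. (A, Q) \<in> t \<and> B \<subseteq> A \<and> (Q \<inter> B = {} \<or> Q \<inter> B = S))"
  proof cases
    case 1
    then show ?thesis using D by blast
  next
    case 2
    then show ?thesis using t unfolding coarser_def by blast
  qed
qed

lemma coarser_mergeE:
  assumes t: "t \<preceq> merge z b c T" "supp t = supp z" and z: "dpart z" and b: "b \<in> z" "c \<in> z"
  obtains D Q where "(D, Q) \<in> t" "fst b \<union> fst c \<subseteq> D" "Q \<inter> (fst b \<union> fst c) = {} \<or> Q \<inter> (fst b \<union> fst c) = T"
proof (rule coarserE[OF t(1), of "fst b \<union> fst c" T])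
  show "(fst b \<union> fst c, T) \<in> merge z b c T" by (simp add: merge_def)
  obtain a where "a \<in> fst b" using block_nonempty[OF z b(1)] .
  then show "(fst b \<union> fst c) \<inter> supp t \<noteq> {}" using t(2) block_dec[OF z b(1)] by blast
qed (rule that)

text \<open>By pigeonhole: as \<open>x\<close> has fewer blocks, two blocks of \<open>z\<close> lie
  in a common block of \<open>x\<close>, and merging these stays above \<open>x\<close>.\<close>

lemma between_merge:
  assumes N: "finite N" and x: "x \<in> dparts N" and z: "z \<in> dparts N" and xz: "x \<lless> z"
  obtains b c T where "b \<in> z" "c \<in> z" "b \<noteq> c" "vdec b c T" "x \<preceq> merge z b c T"
proof -
  have d: "dpart x" "dpart z" "supp x = N" "supp z = N" "x \<preceq> z"
    using x z xz by (auto simp: dparts_def scoarser_def)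
  have fin: "finite x" "finite z" using finite_dpart d N by metis+
  have "\<exists>a\<in>x. fst b \<subseteq> fst a \<and> (snd a \<inter> fst b = {} \<or> snd a \<inter> fst b = snd b)" if b: "b \<in> z" for b
  proof -
    have "fst b \<inter> supp x \<noteq> {}"
      using block_nonempty[OF d(2) b] block_dec[OF d(2) b] d(3,4) by blast
    then obtain A Q where A: "(A, Q) \<in> x" "fst b \<subseteq> A" "Q \<inter> fst b = {} \<or> Q \<inter> fst b = snd b"
      using coarserE[OF d(5), of "fst b" "snd b"] b by auto
    show ?thesis by (rule bexI[OF _ A(1)]) (use A in simp)
  qed
  then obtain h where h: "\<And>b. b \<in> z \<Longrightarrow> h b \<in> x" "\<And>b. b \<in> z \<Longrightarrow> fst b \<subseteq> fst (h b)"
    "\<And>b. b \<in> z \<Longrightarrow> snd (h b) \<inter> fst b = {} \<or> snd (h b) \<inter> fst b = snd b" by metis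
  have "card x < card z" using card_less[OF xz] d N by simp
  then have "\<not> inj_on h z"
    using card_inj_on_le[of h z x] h(1) fin(1) by (auto simp: image_subset_iff)
  then obtain b c where b: "b \<in> z" "c \<in> z" "b \<noteq> c" "h b = h c" by (auto simp: inj_on_def)
  let ?BC = "fst b \<union> fst c" and ?Q = "snd (h b)"
  \<comment> \<open>The decoration that \<open>x\<close> induces on the merged block; if it induces
    none, any of the three will do.\<close>
  define T where "T = (if ?Q \<inter> ?BC = {} then snd b else ?Q \<inter> ?BC)"
  have "?Q \<inter> ?BC = (?Q \<inter> fst b) \<union> (?Q \<inter> fst c)" by blast
  from vdec_UnI[OF this] have "?Q \<inter> ?BC \<noteq> {} \<Longrightarrow> vdec b c (?Q \<inter> ?BC)"
    using h(3)[OF b(1)] h(3)[OF b(2)] unfolding b(4) by blast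
  then have "vdec b c T" by (auto simp: T_def vdec_def)
  moreover have "x \<preceq> merge z b c T"
  proof (rule coarser_mergeI[OF d(5) b(1,2)])
    show "(fst (h b), ?Q) \<in> x" using h(1)[OF b(1)] by simp
    show "?BC \<subseteq> fst (h b)" using h(2)[OF b(1)] h(2)[OF b(2)] b(4) by simp
    show "?Q \<inter> ?BC = {} \<or> ?Q \<inter> ?BC = T" by (auto simp: T_def)
  qed
  ultimately show thesis using that b by blast
qed

lemma covered_eq_merge:
  assumes N: "finite N" and x: "x \<in> dparts N" and z: "z \<in> dparts N" and xz: "x \<lless> z" and c: "card z = Suc (card x)"
  obtains b c T where "b \<in> z" "c \<in> z" "b \<noteq> c" "vdec b c T" "x = merge z b c T"
proof -
  obtain b c T where *: "b \<in> z" "c \<in> z" "b \<noteq> c" "vdec b c T" "x \<preceq> merge z b c T"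
    using between_merge[OF N x z xz] .
  have z': "dpart z" "supp z = N" "dpart x" using z x by (auto simp: dparts_def)
  have "finite z" using finite_dpart[of z] z' N by simp
  then have "card (merge z b c T) = card x"
    using card_merge[OF z'(1) _ *(1-3), of T] c by simp
  then have "x = merge z b c T"
    using card_less[of x "merge z b c T"] * dpart_merge[OF z'(1) *(1,2,4)] z' N
    by (auto simp: scoarser_def supp_merge)
  with * show thesis using that by blast
qed

text \<open>Above a partition, \<open>between_merge\<close> provides the coatom. The adjoined least
  element fits in, since \<open>{}\<close> has no blocks and is covered by the partitions with one
  block.\<close>

lemma graded_dparts:
  assumes N: "finite N" and x: "x \<in> insert {} (dparts N)" and z: "z \<in> insert {} (dparts N)" and xz: "x \<lless> z"
  shows "\<exists>c\<in>insert {} (dparts N). (x = c \<or> x \<lless> c) \<and> c \<lless> z \<and> card z = Suc (card c)"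
proof -
  have "z \<noteq> {}" using xz coarser_supp[of x "{}"] by (auto simp: scoarser_def dpart_supp_empty)
  then have z': "z \<in> dparts N" "dpart z" "supp z = N" using z by (auto simp: dparts_def)
  have fin: "finite z" using finite_dpart[of z] z' N by simp
  have ok: ?thesis if b: "b \<in> z" "c \<in> z" "b \<noteq> c" "vdec b c T" "x \<preceq> merge z b c T" for b c T
  proof -
    note card = card_merge[OF z'(2) fin b(1-3), of T]
    have d: "dpart (merge z b c T)" using dpart_merge[OF z'(2) b(1,2,4)] .
    moreover have "merge z b c T \<noteq> z" using card by auto
    moreover have "merge z b c T \<in> dparts N" using d b z'(3) by (simp add: dparts_def supp_merge)
    ultimately show ?thesis
      using card b merge_coarser[OF z'(2) b(1-4)] z'(2) xz
      by (intro bexI[of _ "merge z b c T"]) (auto simp: scoarser_def)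
  qed
  show ?thesis
  proof (cases "x = {}")
    case False
    then have "x \<in> dparts N" using x by simp
    then show ?thesis using between_merge[OF N _ z'(1) xz] ok by metis
  next
    case x: True
    show ?thesis
    proof (cases "card z = 1")
      case True
      then show ?thesis using x xz by (intro bexI[of _ "{}"]) auto
    next
      case False
      moreover have "card z \<noteq> 0" using \<open>z \<noteq> {}\<close> fin by simp
      ultimately have "\<not> card z \<le> Suc 0" by simp
      then obtain b c where "b \<in> z" "c \<in> z" "b \<noteq> c" using card_le_Suc0_iff_eq[OF fin] by blast
      then show ?thesis using ok[of b c "snd b"] x by (simp add: vdec_def)
    qed
  qed
qed

section \<open>Semimodularity\<close>

context
  fixes z t :: "'a dpart" and N :: "'a set"
  assumes N: "finite N" and z: "dpart z" "supp z = N" and t: "dpart t" "t = {} \<or> supp t = N"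
begin

private lemma fin: "finite z"
  using finite_dpart[of z] z N by simp

private abbreviation "meets x y \<equiv> \<exists>u\<in>insert {} (dparts N). t \<preceq> u \<and> u \<preceq> x \<and> u \<preceq> y \<and> card z = Suc (Suc (card u))"

text \<open>Merges of disjoint pairs commute, and the common lower cover performs both.\<close>

private lemma meet_disjoint:
  assumes b: "b \<in> z" "c \<in> z" "b \<noteq> c" "vdec b c T" and b': "b' \<in> z" "c' \<in> z" "b' \<noteq> c'" "vdec b' c' T'"
    and dis: "{b, c} \<inter> {b', c'} = {}" and tx: "t \<preceq> merge z b c T" "t \<preceq> merge z b' c' T'"
  shows "meets (merge z b c T) (merge z b' c' T')"
proof -
  let ?x = "merge z b c T" and ?y = "merge z b' c' T'"
  have x: "dpart ?x" "supp ?x = N" "b' \<in> ?x" "c' \<in> ?x"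
    using dpart_merge[OF z(1) b(1,2,4)] supp_merge[OF b(1,2)] b' z dis by (auto simp: merge_def[of z])
  have y: "dpart ?y" "b \<in> ?y" "c \<in> ?y"
    using dpart_merge[OF z(1) b'(1,2,4)] b dis by (auto simp: merge_def[of z])
  let ?u = "merge ?x b' c' T'"
  have "(fst b \<union> fst c, T) \<notin> {b', c'}" "(fst b' \<union> fst c', T') \<notin> {b, c}"
    using merge_block_notin[OF z(1) b(1-3), of T] merge_block_notin[OF z(1) b'(1-3), of T'] b b' by auto
  then have u: "?u = merge ?y b c T" using dis unfolding merge_def by auto
  have "t \<preceq> ?u"
  proof (cases "t = {}")
    case False
    then have "supp t = supp z" using t z by simp
    then obtain D Q where "(D, Q) \<in> t" "fst b' \<union> fst c' \<subseteq> D" "Q \<inter> (fst b' \<union> fst c') = {} \<or> Q \<inter> (fst b' \<union> fst c') = T'"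
      using coarser_mergeE[OF tx(2) _ z(1) b'(1,2)] by metis
    then show ?thesis using coarser_mergeI[OF tx(1) x(3,4)] by metis
  qed simp
  moreover have "?u \<preceq> ?x" by (rule merge_coarser[OF x(1,3,4) b'(3,4)])
  moreover have "?u \<preceq> ?y" unfolding u by (rule merge_coarser[OF y b(3,4)])
  moreover have "finite ?x" using fin by (simp add: merge_def)
  then have "card z = Suc (Suc (card ?u))"
    using card_merge[OF z(1) fin b(1-3), of T] card_merge[OF x(1) _ x(3,4) b'(3), of T'] by simp
  moreover have "?u \<in> dparts N"
    using dpart_merge[OF x(1,3,4) b'(4)] x by (simp add: dparts_def supp_merge)
  ultimately show ?thesis by blast
qed

text \<open>For two pairs with the common block \<open>b\<close>, the lower cover merges all three
  blocks, with a decoration \<open>V\<close> that arises in either order of merging.\<close>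

private lemma meet_chain:
  assumes b: "b \<in> z" "c \<in> z" "d \<in> z" "b \<noteq> c" "b \<noteq> d" "c \<noteq> d" and T: "vdec b c T" "vdec b d T'"
    and V: "vdec (fst b \<union> fst c, T) d V" "vdec (fst b \<union> fst d, T') c V"
    and tV: "t = {} \<or> (\<exists>D Q. (D, Q) \<in> t \<and> fst b \<union> fst c \<union> fst d \<subseteq> D \<and>
       (Q \<inter> (fst b \<union> fst c \<union> fst d) = {} \<or> Q \<inter> (fst b \<union> fst c \<union> fst d) = V))"
    and tx: "t \<preceq> merge z b c T"
  shows "meets (merge z b c T) (merge z b d T')"
proof -
  let ?x = "merge z b c T" and ?y = "merge z b d T'"
  let ?bc = "(fst b \<union> fst c, T)" and ?bd = "(fst b \<union> fst d, T')"
  have nin: "?bc \<notin> z" "?bd \<notin> z" using merge_block_notin[OF z(1)] b by blast+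
  have x: "dpart ?x" "supp ?x = N" "?bc \<in> ?x" "d \<in> ?x" "?bc \<noteq> d"
    using dpart_merge[OF z(1) b(1,2) T(1)] supp_merge[OF b(1,2)] b z nin by (auto simp: merge_def[of z])
  have y: "dpart ?y" "?bd \<in> ?y" "c \<in> ?y" "?bd \<noteq> c"
    using dpart_merge[OF z(1) b(1,3) T(2)] b nin by (auto simp: merge_def[of z])
  let ?u = "merge ?x ?bc d V"
  have u: "?u = merge ?y ?bd c V" using nin unfolding merge_def by (auto simp: Un_ac)
  have "t \<preceq> ?u"
  proof (cases "t = {}")
    case False
    with tV obtain D Q where "(D, Q) \<in> t" "fst b \<union> fst c \<union> fst d \<subseteq> D"
       "Q \<inter> (fst b \<union> fst c \<union> fst d) = {} \<or> Q \<inter> (fst b \<union> fst c \<union> fst d) = V" by blast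
    then show ?thesis by (intro coarser_mergeI[OF tx x(3,4)]) auto
  qed simp
  moreover have "?u \<preceq> ?x" by (rule merge_coarser[OF x(1,3,4,5) V(1)])
  moreover have "?u \<preceq> ?y" unfolding u by (rule merge_coarser[OF y V(2)])
  moreover have "finite ?x" using fin by (simp add: merge_def)
  then have "card z = Suc (Suc (card ?u))"
    using card_merge[OF z(1) fin b(1,2,4), of T] card_merge[OF x(1) _ x(3,4,5), of V] by simp
  moreover have "?u \<in> dparts N"
    using dpart_merge[OF x(1,3,4) V(1)] x by (simp add: dparts_def supp_merge)
  ultimately show ?thesis by blast
qed

text \<open>If the block of \<open>t\<close> has decoration inside the three blocks, this decoration
  is \<open>V\<close>, and the compatibility with \<open>T\<close> and \<open>T'\<close> makes it
  arise in both orders. Otherwise any such \<open>V\<close> will do, and one exists for each of the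
  nine pairs of choices for \<open>T\<close> and \<open>T'\<close>.\<close>

private lemma meet_adjacent:
  assumes b: "b \<in> z" "c \<in> z" "d \<in> z" "b \<noteq> c" "b \<noteq> d" "c \<noteq> d" and T: "vdec b c T" "vdec b d T'"
    and tx: "t \<preceq> merge z b c T" "t \<preceq> merge z b d T'"
  shows "meets (merge z b c T) (merge z b d T')"
proof -
  note db = block_dec[OF z(1) b(1)] and dc = block_dec[OF z(1) b(2)] and dd = block_dec[OF z(1) b(3)]
    and dis = block_disjoint[OF z(1) b(1,2,4)] block_disjoint[OF z(1) b(1,3,5)] block_disjoint[OF z(1) b(2,3,6)]
  let ?B = "fst b \<union> fst c \<union> fst d"
  have "\<exists>V. vdec (fst b \<union> fst c, T) d V \<and> vdec (fst b \<union> fst d, T') c V \<and>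
    (t = {} \<or> (\<exists>D Q. (D, Q) \<in> t \<and> ?B \<subseteq> D \<and> (Q \<inter> ?B = {} \<or> Q \<inter> ?B = V)))"
  proof -
    have any: "\<exists>V. vdec (fst b \<union> fst c, T) d V \<and> vdec (fst b \<union> fst d, T') c V"
      using T by (auto simp: vdec_def Un_ac)
    show ?thesis
    proof (cases "t = {}")
      case False
      then have st: "supp t = supp z" using t z by simp
      obtain D Q where D: "(D, Q) \<in> t" "fst b \<union> fst c \<subseteq> D" "Q \<inter> (fst b \<union> fst c) = {} \<or> Q \<inter> (fst b \<union> fst c) = T"
        using coarser_mergeE[OF tx(1) st z(1) b(1,2)] .
      obtain D' Q' where D': "(D', Q') \<in> t" "fst b \<union> fst d \<subseteq> D'" "Q' \<inter> (fst b \<union> fst d) = {} \<or> Q' \<inter> (fst b \<union> fst d) = T'"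
        using coarser_mergeE[OF tx(2) st z(1) b(1,3)] .
      obtain a where a: "a \<in> fst b" using block_nonempty[OF z(1) b(1)] .
      have eq: "D' = D \<and> Q' = Q"
        by (rule dpart_unique[OF t(1) D'(1) D(1), of a]) (use a D D' in auto)
      have DB: "?B \<subseteq> D" using D D' eq by blast
      show ?thesis
      proof (cases "Q \<inter> ?B = {}")
        case True
        then show ?thesis using any D(1) DB by blast
      next
        case False
        have 1: "Q \<inter> fst c = {} \<or> Q \<inter> fst c = snd c"
        proof -
          have "Q \<inter> fst c = (Q \<inter> (fst b \<union> fst c)) \<inter> fst c" by blast
          moreover have "T \<inter> fst c = {} \<or> T \<inter> fst c = snd c" using T(1) db dc dis unfolding vdec_def by blast
          ultimately show ?thesis using D(3) by auto
        qed
        have 2: "Q \<inter> fst d = {} \<or> Q \<inter> fst d = snd d"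
        proof -
          have "Q \<inter> fst d = (Q \<inter> (fst b \<union> fst d)) \<inter> fst d" by blast
          moreover have "T' \<inter> fst d = {} \<or> T' \<inter> fst d = snd d" using T(2) db dd dis unfolding vdec_def by blast
          ultimately show ?thesis using D'(3) eq by auto
        qed
        have "Q \<inter> ?B = (Q \<inter> (fst b \<union> fst c)) \<union> (Q \<inter> fst d)" by blast
        then have "vdec (fst b \<union> fst c, T) d (Q \<inter> ?B)"
          by (rule vdec_UnI) (use D(3) 2 False in simp_all)
        moreover have "Q \<inter> ?B = (Q \<inter> (fst b \<union> fst d)) \<union> (Q \<inter> fst c)" by blast
        then have "vdec (fst b \<union> fst d, T') c (Q \<inter> ?B)"
          by (rule vdec_UnI) (use D'(3) eq 1 False in simp_all)
        ultimately show ?thesis using D(1) DB by blast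
      qed
    qed (use any in blast)
  qed
  then obtain V where "vdec (fst b \<union> fst c, T) d V" "vdec (fst b \<union> fst d, T') c V"
    "t = {} \<or> (\<exists>D Q. (D, Q) \<in> t \<and> ?B \<subseteq> D \<and> (Q \<inter> ?B = {} \<or> Q \<inter> ?B = V))" by blast
  then show ?thesis by (rule meet_chain[OF b T _ _ _ tx(1)])
qed

text \<open>
  Different decorations of the same merged block force the block to meet no decoration of \<open>t\<close>, so that it can be
  merged further with a block whose decoration is kept.
\<close>

private lemma meet_same:
  assumes b: "b \<in> z" "c \<in> z" "b \<noteq> c" and T: "vdec b c T" "vdec b c T'" "T \<noteq> T'"
    and tx: "t \<preceq> merge z b c T" "t \<preceq> merge z b c T'"
  shows "meets (merge z b c T) (merge z b c T')"
proof -
  let ?B = "fst b \<union> fst c"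
  have "meets (merge z b c T) (merge z b c T')"
    if d: "d \<in> z" "d \<noteq> b" "d \<noteq> c" and
      td: "t = {} \<or> (\<exists>D Q. (D, Q) \<in> t \<and> ?B \<union> fst d \<subseteq> D \<and> Q \<inter> (?B \<union> fst d) = snd d)" for d
  proof -
    let ?x = "merge z b c T" and ?y = "merge z b c T'"
    let ?bT = "(?B, T)" and ?bT' = "(?B, T')"
    have nin: "?bT \<notin> z" "?bT' \<notin> z" using merge_block_notin[OF z(1) b] by blast+
    have x: "dpart ?x" "supp ?x = N" "?bT \<in> ?x" "d \<in> ?x" "?bT \<noteq> d"
      using dpart_merge[OF z(1) b(1,2) T(1)] supp_merge[OF b(1,2)] d z nin by (auto simp: merge_def[of z])
    have y: "dpart ?y" "?bT' \<in> ?y" "d \<in> ?y" "?bT' \<noteq> d"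
      using dpart_merge[OF z(1) b(1,2) T(2)] d nin by (auto simp: merge_def[of z])
    have V: "vdec ?bT d (snd d)" "vdec ?bT' d (snd d)" by (auto simp: vdec_def)
    let ?u = "merge ?x ?bT d (snd d)"
    have u: "?u = merge ?y ?bT' d (snd d)" using nin unfolding merge_def by auto
    have "t \<preceq> ?u"
    proof (cases "t = {}")
      case False
      with td obtain D Q where "(D, Q) \<in> t" "?B \<union> fst d \<subseteq> D" "Q \<inter> (?B \<union> fst d) = snd d" by blast
      then show ?thesis by (intro coarser_mergeI[OF tx(1) x(3,4)]) auto
    qed simp
    moreover have "?u \<preceq> ?x" by (rule merge_coarser[OF x(1,3,4,5) V(1)])
    moreover have "?u \<preceq> ?y" unfolding u by (rule merge_coarser[OF y V(2)])
    moreover have "finite ?x" using fin by (simp add: merge_def)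
    then have "card z = Suc (Suc (card ?u))"
      using card_merge[OF z(1) fin b, of T] card_merge[OF x(1) _ x(3,4,5), of "snd d"] by simp
    moreover have "?u \<in> dparts N"
      using dpart_merge[OF x(1,3,4) V(1)] x by (simp add: dparts_def supp_merge)
    ultimately show ?thesis by blast
  qed
  note extend = this
  show ?thesis
  proof (cases "t = {}")
    case True
    show ?thesis
    proof (cases "z = {b, c}")
      case True
      \<comment> \<open>Without a third block, the common lower cover is the adjoined least
        element.\<close>
      then show ?thesis using \<open>t = {}\<close> b(3) by (intro bexI[of _ "{}"]) auto
    next
      case False
      then obtain d where "d \<in> z" "d \<noteq> b" "d \<noteq> c" using b by blast
      then show ?thesis using extend True by blast
    qed
  next
    case False
    then have st: "supp t = supp z" using t z by simp
    obtain D Q where D: "(D, Q) \<in> t" "?B \<subseteq> D" "Q \<inter> ?B = {} \<or> Q \<inter> ?B = T"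
      using coarser_mergeE[OF tx(1) st z(1) b(1,2)] .
    obtain D' Q' where D': "(D', Q') \<in> t" "?B \<subseteq> D'" "Q' \<inter> ?B = {} \<or> Q' \<inter> ?B = T'"
      using coarser_mergeE[OF tx(2) st z(1) b(1,2)] .
    obtain a where a: "a \<in> fst b" using block_nonempty[OF z(1) b(1)] .
    have eq: "D' = D \<and> Q' = Q"
      by (rule dpart_unique[OF t(1) D'(1) D(1), of a]) (use a D D' in auto)
    then have QB: "Q \<inter> ?B = {}" using D(3) D'(3) T(3) by auto
    \<comment> \<open>The decoration of the block of \<open>t\<close> is nonempty but avoids both
      merged blocks. A block of \<open>z\<close> containing one of its points is the third block to
      merge, and its decoration survives.\<close>
    obtain q where q: "q \<in> Q" "q \<in> D" using dpartD(1,2)[OF t(1) D(1)] by blast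
    have tz: "t \<preceq> z" using tx(1) merge_coarser[OF z(1) b T(1)] by (rule coarser_trans)
    obtain C S where C: "(C, S) \<in> z" "q \<in> C" "C \<subseteq> D" "Q \<inter> C = {} \<or> Q \<inter> C = S"
      using coarser_block[OF tz t(1) D(1) q(2)] .
    have "Q \<inter> (?B \<union> C) = S" using QB C q by blast
    moreover have "(C, S) \<noteq> b" "(C, S) \<noteq> c" using QB C q by auto
    ultimately show ?thesis using extend[of "(C, S)"] C D(1,2) by auto
  qed
qed

lemma meet_merges:
  assumes b: "b \<in> z" "c \<in> z" "b \<noteq> c" "vdec b c T" and b': "b' \<in> z" "c' \<in> z" "b' \<noteq> c'" "vdec b' c' T'"
    and tx: "t \<preceq> merge z b c T" "t \<preceq> merge z b' c' T'" and ne: "merge z b c T \<noteq> merge z b' c' T'"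
  shows "meets (merge z b c T) (merge z b' c' T')"
proof -
  have adj: "meets (merge z b c T) (merge z b' c' T')"
    if "p \<in> z" "q \<in> z" "r \<in> z" "p \<noteq> q" "p \<noteq> r" "q \<noteq> r" "vdec p q T" "vdec p r T'"
      "merge z b c T = merge z p q T" "merge z b' c' T' = merge z p r T'" for p q r
    using meet_adjacent[OF that(1-8)] tx unfolding that(9,10) .
  have same: "meets (merge z b c T) (merge z b' c' T')"
    if "merge z b' c' T' = merge z b c T'" "vdec b c T'"
  proof -
    have "T \<noteq> T'" using ne that by auto
    then show ?thesis using meet_same[OF b that(2)] tx unfolding that(1) by blast
  qed
  consider "{b, c} \<inter> {b', c'} = {}" | "b = b'" "c = c'" | "b = c'" "c = b'"
    | "b = b'" "c \<noteq> c'" | "b = c'" "c \<noteq> b'" | "c = b'" "b \<noteq> c'" | "c = c'" "b \<noteq> b'" by blast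
  then show ?thesis
  proof cases
    case 1
    then show ?thesis by (rule meet_disjoint[OF b b' _ tx])
  next
    case 2
    then show ?thesis using same b' by simp
  next
    case 3
    then show ?thesis using same b' by (simp add: merge_commute vdec_commute)
  next
    case 4
    then show ?thesis using adj[of b c c'] b b' by simp
  next
    case 5
    then show ?thesis using adj[of b c b'] b b' by (simp add: merge_commute vdec_commute)
  next
    case 6
    then show ?thesis using adj[of c b c'] b b' by (simp add: merge_commute vdec_commute)
  next
    case 7
    then show ?thesis using adj[of c b b'] b b' by (simp add: merge_commute vdec_commute)
  qed
qed

end

lemma semimodular_dparts:
  assumes N: "finite N" and mem: "x \<in> insert {} (dparts N)" "y \<in> insert {} (dparts N)" "z \<in> insert {} (dparts N)"
    "t \<in> insert {} (dparts N)" and xz: "x \<lless> z" "y \<lless> z" "x \<noteq> y" and card: "card z = Suc (card x)" "card z = Suc (card y)"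
    and tx: "t = x \<or> t \<lless> x" "t = y \<or> t \<lless> y"
  shows "\<exists>u\<in>insert {} (dparts N). (t = u \<or> t \<lless> u) \<and> u \<lless> x \<and> u \<lless> y \<and> card x = Suc (card u)"
proof -
  have d: "dpart x" "dpart y" "dpart z" "dpart t" using mem by (auto simp: dparts_def)
  have fin: "finite v" if "v \<in> insert {} (dparts N)" for v
    using that finite_dpart[of v] N by (auto simp: dparts_def)
  have "x \<noteq> {}" "y \<noteq> {}" using xz(3) card fin[OF mem(1)] fin[OF mem(2)] by auto
  moreover have "z \<noteq> {}" using card by auto
  ultimately have xyz: "x \<in> dparts N" "y \<in> dparts N" "z \<in> dparts N" using mem by auto
  obtain b c T where b: "b \<in> z" "c \<in> z" "b \<noteq> c" "vdec b c T" "x = merge z b c T"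
    using covered_eq_merge[OF N xyz(1,3) xz(1) card(1)] .
  obtain b' c' T' where b': "b' \<in> z" "c' \<in> z" "b' \<noteq> c'" "vdec b' c' T'" "y = merge z b' c' T'"
    using covered_eq_merge[OF N xyz(2,3) xz(2) card(2)] .
  have z: "dpart z" "supp z = N" and t: "dpart t" "t = {} \<or> supp t = N" using xyz mem by (auto simp: dparts_def)
  have "t \<preceq> x" "t \<preceq> y" using tx d coarser_iff_scoarser by blast+
  then obtain u where u: "u \<in> insert {} (dparts N)" "t \<preceq> u" "u \<preceq> x" "u \<preceq> y" "card z = Suc (Suc (card u))"
    using meet_merges[OF N z t b(1-4) b'(1-4)] xz(3) unfolding b(5) b'(5) by blast
  then have "dpart u" by (auto simp: dparts_def)
  moreover have "u \<noteq> x" "u \<noteq> y" using u(5) card by auto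
  ultimately have "u \<lless> x" "u \<lless> y" "t = u \<or> t \<lless> u" using u d by (auto simp: scoarser_def)
  then show ?thesis using u(1,5) card by (intro bexI[of _ u]) auto
qed

section \<open>Growing a block and restricting to blocks off a set\<close>

definition grow :: "'a set \<Rightarrow> 'a set \<Rightarrow> 'a dpart \<Rightarrow> 'a dpart" where
  "grow N S y = insert (N - supp y, S) y"

definition off :: "'a set \<Rightarrow> 'a dpart \<Rightarrow> 'a dpart" where
  "off S y = {b \<in> y. fst b \<inter> S = {}}"

lemma decs_simps [simp]:
  "decs {} = {}" "decs (insert (B, S) x) = S \<union> decs x" "decs (x \<union> y) = decs x \<union> decs y" "decs (singles T) = T"
  by (auto simp: decs_def singles_def)

lemma decs_subset_supp: "dpart x \<Longrightarrow> decs x \<subseteq> supp x"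
  unfolding decs_def supp_def using dpartD(2) by fastforce

lemma decs_Int_block:
  assumes "dpart x" "(B, R) \<in> x"
  shows "decs x \<inter> B = R"
proof
  show "decs x \<inter> B \<subseteq> R"
  proof
    fix a assume a: "a \<in> decs x \<inter> B"
    then obtain C S where C: "(C, S) \<in> x" "a \<in> S" by (auto simp: in_decs)
    then have "a \<in> C" using dpartD(2)[OF assms(1)] by blast
    then show "a \<in> R" using dpart_unique[OF assms C(1), of a] a C(2) by blast
  qed
  show "R \<subseteq> decs x \<inter> B" using assms(2) dpartD(2)[OF assms] in_decs by fast
qed

lemma in_grow: "(B, R) \<in> grow N S y \<longleftrightarrow> (B = N - supp y \<and> R = S) \<or> (B, R) \<in> y"
  by (auto simp: grow_def)

lemma supp_grow: "supp y \<subseteq> N \<Longrightarrow> supp (grow N S y) = N"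
  by (auto simp: grow_def)

lemma decs_grow: "decs (grow N S y) = S \<union> decs y"
  by (simp add: grow_def)

lemma dpart_grow: "dpart y \<Longrightarrow> S \<noteq> {} \<Longrightarrow> S \<subseteq> N - supp y \<Longrightarrow> dpart (grow N S y)"
  unfolding grow_def by (rule dpart_insert) auto

lemma grow_in_dparts: "dpart y \<Longrightarrow> S \<noteq> {} \<Longrightarrow> S \<subseteq> N \<Longrightarrow> supp y \<subseteq> N - S \<Longrightarrow> grow N S y \<in> dparts N"
  unfolding dparts_def using supp_grow[of y N S] dpart_grow[of y S N] by blast

text \<open>The two added blocks are comparable if and only if
  \<open>supp x \<subseteq> supp y\<close>, and a block of \<open>y\<close> off
  \<open>supp x\<close> falls into the block added to \<open>x\<close>, where \<open>S\<close> does
  not meet it. This is what the clauses of \<open>coarser\<close> about supports are made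
  for.\<close>

lemma grow_coarser_iff:
  assumes S: "S \<noteq> {}" "S \<subseteq> N" and x: "dpart x" "supp x \<subseteq> N - S" and y: "dpart y" "supp y \<subseteq> N - S"
  shows "grow N S x \<preceq> grow N S y \<longleftrightarrow> x \<preceq> y"
proof
  assume L: "grow N S x \<preceq> grow N S y"
  have sx: "supp (grow N S x) = N" by (rule supp_grow) (use x in blast)
  show "x \<preceq> y"
    unfolding coarser_def
  proof (intro conjI allI impI)
    obtain s where s: "s \<in> S" using S by blast
    have "(N - supp y, S) \<in> grow N S y" by (simp add: in_grow)
    moreover have "(N - supp y) \<inter> supp (grow N S x) \<noteq> {}" using s S y sx by blast
    ultimately obtain A Q where A: "(A, Q) \<in> grow N S x" "N - supp y \<subseteq> A" "Q \<inter> (N - supp y) = {} \<or> Q \<inter> (N - supp y) = S"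
      using coarserE[OF L] by metis
    have "s \<in> A" using A(2) s S y by blast
    moreover have "(A, Q) \<notin> x" using \<open>s \<in> A\<close> dpartD(4)[OF x(1)] x(2) s by blast
    ultimately have "A = N - supp x" using A(1) by (simp add: in_grow)
    then show "supp x \<subseteq> supp y" using A(2) x by blast
    fix B R assume B: "(B, R) \<in> y"
    show "B \<inter> supp x = {} \<or> (\<exists>A Q. (A, Q) \<in> x \<and> B \<subseteq> A \<and> (Q \<inter> B = {} \<or> Q \<inter> B = R))"
    proof (cases "B \<inter> supp x = {}")
      case False
      then have "B \<inter> supp (grow N S x) \<noteq> {}" using sx x by blast
      then obtain A Q where A: "(A, Q) \<in> grow N S x" "B \<subseteq> A" "Q \<inter> B = {} \<or> Q \<inter> B = R"
        using coarserE[OF L, of B R] B by (metis in_grow)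
      moreover have "A \<noteq> N - supp x" using A(2) False by blast
      ultimately show ?thesis by (metis in_grow)
    qed simp
  qed
next
  assume R: "x \<preceq> y"
  show "grow N S x \<preceq> grow N S y"
    unfolding coarser_def
  proof (intro conjI allI impI disjI2)
    have "supp (grow N S x) = N" "supp (grow N S y) = N" using x y by (auto intro!: supp_grow)
    then show "supp (grow N S x) \<subseteq> supp (grow N S y)" by simp
    fix B R' assume "(B, R') \<in> grow N S y"
    then consider "B = N - supp y" "R' = S" | "(B, R') \<in> y" by (auto simp: in_grow)
    then show "\<exists>A Q. (A, Q) \<in> grow N S x \<and> B \<subseteq> A \<and> (Q \<inter> B = {} \<or> Q \<inter> B = R')"
    proof cases
      case 1
      have "B \<subseteq> N - supp x" "S \<inter> B = R'" using 1 coarser_supp[OF R] y S by auto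
      then show ?thesis by (metis in_grow)
    next
      case 2
      show ?thesis
      proof (cases "B \<inter> supp x = {}")
        case True
        have "B \<subseteq> supp y" using dpartD(4)[OF y(1) 2] .
        then have "B \<subseteq> N - supp x" "S \<inter> B = {}" using True y by auto
        then show ?thesis by (metis in_grow)
      next
        case False
        then show ?thesis using coarserE[OF R 2] by (metis in_grow)
      qed
    qed
  qed
qed

lemma grow_inj:
  assumes S: "S \<noteq> {}" "S \<subseteq> N" and x: "dpart x" "supp x \<subseteq> N - S" and y: "dpart y" "supp y \<subseteq> N - S"
    and eq: "grow N S x = grow N S y"
  shows "x = y"
proof -
  have "dpart (grow N S x)" by (rule dpart_grow) (use S x in auto)
  then have "grow N S x \<preceq> grow N S y" "grow N S y \<preceq> grow N S x" using eq by simp_all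
  then show ?thesis
    using grow_coarser_iff[OF S x y] grow_coarser_iff[OF S y x] coarser_antisym x y by blast
qed

lemma off_grow:
  assumes S: "S \<noteq> {}" "S \<subseteq> N" and x: "dpart x" "supp x \<subseteq> N - S"
  shows "off S (grow N S x) = x"
proof -
  have "fst b \<inter> S = {}" if "b \<in> x" for b
    using block_dec[OF x(1) that] x(2) by blast
  moreover have "(N - supp x) \<inter> S \<noteq> {}" using S x by blast
  ultimately show ?thesis by (auto simp: off_def grow_def)
qed

lemma dpart_off: "dpart y \<Longrightarrow> dpart (off S y)"
  by (rule dpart_subset) (auto simp: off_def)

lemma supp_off_disjoint: "supp (off S y) \<inter> S = {}"
  by (auto simp: supp_def off_def)

lemma supp_off: "supp (off S y) \<subseteq> supp y - S"
  by (auto simp: supp_def off_def)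

lemma in_off: "(B, R) \<in> off S y \<longleftrightarrow> (B, R) \<in> y \<and> B \<inter> S = {}"
  by (simp add: off_def)

lemma off_mono:
  assumes yz: "y \<preceq> z" "dpart y"
  shows "off S y \<preceq> off S z"
  unfolding coarser_def
proof (intro conjI allI impI)
  show "supp (off S y) \<subseteq> supp (off S z)"
  proof
    fix e assume "e \<in> supp (off S y)"
    then obtain B R where B: "(B, R) \<in> y" "B \<inter> S = {}" "e \<in> B" by (auto simp: in_supp in_off)
    obtain C T where "(C, T) \<in> z" "e \<in> C" "C \<subseteq> B" using coarser_block[OF yz B(1,3)] by metis
    then show "e \<in> supp (off S z)" using B(2) by (auto simp: in_supp in_off)
  qed
  fix C T assume "(C, T) \<in> off S z"
  then have C: "(C, T) \<in> z" "C \<inter> S = {}" by (auto simp: in_off)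
  show "C \<inter> supp (off S y) = {} \<or> (\<exists>A Q. (A, Q) \<in> off S y \<and> C \<subseteq> A \<and> (Q \<inter> C = {} \<or> Q \<inter> C = T))"
  proof (cases "C \<inter> supp (off S y) = {}")
    case False
    then obtain e B R where e: "e \<in> C" "e \<in> B" "(B, R) \<in> y" "B \<inter> S = {}" by (auto simp: in_supp in_off)
    then have "C \<inter> supp y \<noteq> {}" using dpartD(4)[OF yz(2)] by blast
    then obtain A Q where A: "(A, Q) \<in> y" "C \<subseteq> A" "Q \<inter> C = {} \<or> Q \<inter> C = T"
      using coarserE[OF yz(1) C(1)] by metis
    then have "A = B" using dpart_unique[OF yz(2) A(1) e(3), of e] e by blast
    then show ?thesis using A e(4) by (auto simp: in_off)
  qed simp
qed

definition atom :: "'a set \<Rightarrow> 'a set \<Rightarrow> 'a dpart" where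
  "atom N S = {(N, S)}"

lemma atom_eq_grow: "atom N S = grow N S {}"
  by (simp add: atom_def grow_def)

lemma atom_in_dparts: "S \<noteq> {} \<Longrightarrow> S \<subseteq> N \<Longrightarrow> atom N S \<in> dparts N"
  by (auto simp: atom_eq_grow intro: grow_in_dparts)

lemma decs_atom [simp]: "decs (atom N S) = S"
  by (simp add: atom_def)

lemma atom_coarser_block:
  assumes "atom N S \<preceq> y" "y \<in> dparts N" "(B, R) \<in> y"
  shows "S \<inter> B = {} \<or> S \<inter> B = R"
proof -
  have "B \<inter> supp (atom N S) \<noteq> {}"
    using assms(2,3) dpartD(3,4)[of y B R] by (auto simp: atom_def dparts_def)
  then show ?thesis using coarserE[OF assms(1,3)] by (metis Pair_inject atom_def singletonD)
qed

text \<open>Together with \<open>coarser_decs\<close>: among the sets \<open>S\<close> with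
  \<open>atom N S\<close> below \<open>y\<close>, the largest one is \<open>decs y\<close>.\<close>

lemma atom_coarser_decs:
  assumes "y \<in> dparts N"
  shows "atom N (decs y) \<preceq> y"
  unfolding coarser_def
proof (intro conjI allI impI disjI2)
  show "supp (atom N (decs y)) \<subseteq> supp y" using assms by (simp add: atom_def dparts_def)
  fix B S assume B: "(B, S) \<in> y"
  then have "B \<subseteq> N" "decs y \<inter> B = S"
    using assms dpartD(4)[of y B S] decs_Int_block[of y B S] by (auto simp: dparts_def)
  then show "\<exists>A Q. (A, Q) \<in> atom N (decs y) \<and> B \<subseteq> A \<and> (Q \<inter> B = {} \<or> Q \<inter> B = S)"
    by (auto simp: atom_def)
qed

lemma below_atom:
  assumes "finite N" "N \<noteq> {}" "y \<in> dparts N"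
  shows "\<not> y \<lless> atom N S"
proof
  assume l: "y \<lless> atom N S"
  have "card y < card (atom N S)" using card_less[OF l] assms(1) by (simp add: atom_def)
  moreover have "finite y" using assms finite_dpart[of y] by (auto simp: dparts_def)
  ultimately have "y = {}" by (simp add: atom_def)
  then show False using assms(2,3) by (auto simp: dparts_def)
qed

text \<open>Here \<open>grow N S (off S y)\<close> is obtained from \<open>y\<close> by merging the blocks that meet \<open>S\<close>.\<close>

lemma grow_off_coarser:
  assumes a: "atom N S \<preceq> y" and y: "y \<in> dparts N"
  shows "grow N S (off S y) \<preceq> y"
  unfolding coarser_def
proof (intro conjI allI impI disjI2)
  have s: "supp (off S y) \<subseteq> N" using supp_off[of S y] y by (auto simp: dparts_def)
  then show "supp (grow N S (off S y)) \<subseteq> supp y" using y by (simp add: supp_grow dparts_def)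
  fix B R assume B: "(B, R) \<in> y"
  show "\<exists>A Q. (A, Q) \<in> grow N S (off S y) \<and> B \<subseteq> A \<and> (Q \<inter> B = {} \<or> Q \<inter> B = R)"
  proof (cases "B \<inter> S = {}")
    case True
    moreover have "R \<inter> B = R" using dpartD(2)[of y B R] B y by (auto simp: dparts_def)
    ultimately show ?thesis using B by (metis in_grow in_off order_refl)
  next
    case False
    have "B \<inter> supp (off S y) = {}"
    proof (rule ccontr)
      assume "B \<inter> supp (off S y) \<noteq> {}"
      then obtain e C T where "e \<in> B" "e \<in> C" "(C, T) \<in> y" "C \<inter> S = {}" by (auto simp: in_supp in_off)
      then show False using dpart_unique[of y B R C T e] B y False by (auto simp: dparts_def)
    qed
    moreover have "B \<subseteq> N" using dpartD(4)[of y B R] B y by (auto simp: dparts_def)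
    ultimately have "B \<subseteq> N - supp (off S y)" by blast
    then show ?thesis using atom_coarser_block[OF a y B] by (metis in_grow)
  qed
qed

lemma decs_off:
  assumes a: "atom N S \<preceq> y" and y: "y \<in> dparts N"
  shows "decs (off S y) = decs y - S"
proof
  have "dpart y" using y by (simp add: dparts_def)
  have "decs (off S y) \<inter> S = {}"
    using decs_subset_supp[OF dpart_off[OF \<open>dpart y\<close>], of S] supp_off_disjoint[of S y] by blast
  moreover have "decs (off S y) \<subseteq> decs y" unfolding decs_def off_def by blast
  ultimately show "decs (off S y) \<subseteq> decs y - S" by blast
  show "decs y - S \<subseteq> decs (off S y)"
  proof
    fix q assume q: "q \<in> decs y - S"
    then obtain B R where B: "(B, R) \<in> y" "q \<in> R" by (auto simp: in_decs)
    then have "S \<inter> B = {}" using atom_coarser_block[OF a y B(1)] q by blast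
    then show "q \<in> decs (off S y)" using B by (auto simp: in_decs in_off)
  qed
qed

text \<open>Every block contains a nonempty decoration and distinct blocks are disjoint, which
  leaves room for one block only.\<close>

lemma decs_singleton:
  assumes y: "y \<in> dparts N" and d: "decs y = {s}"
  shows "y = atom N {s}"
proof -
  have dy: "dpart y" "supp y = N" using y by (auto simp: dparts_def)
  obtain B R where B: "(B, R) \<in> y" "s \<in> R" using d by (metis in_decs singletonI)
  have *: "S = {s} \<and> s \<in> C" if "(C, S) \<in> y" for C S
  proof -
    have "S \<subseteq> {s}" using that d by (metis in_decs subsetI)
    then show ?thesis using dpartD(1,2)[OF dy(1) that] by blast
  qed
  have "y = {(B, {s})}"
  proof (intro equalityI subrelI)
    fix C S assume C: "(C, S) \<in> y"
    then show "(C, S) \<in> {(B, {s})}"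
      using dpart_unique[OF dy(1) C B(1), of s] *[OF C] *[OF B(1)] by simp
  qed (use B *[OF B(1)] in auto)
  then show ?thesis using dy(2) by (auto simp: atom_def)
qed

text \<open>An atom decorated by \<open>{s}\<close> below \<open>y\<close> forces the decoration
  \<open>{s}\<close> on the block of \<open>s\<close>, so that nothing is lost by leaving this block
  out. In this way the partitions above \<open>atom N {s}\<close> become those with support in
  \<open>N - {s}\<close>.\<close>

lemma grow_off_singleton:
  assumes a: "atom N {s} \<preceq> y" and y: "y \<in> dparts N" and s: "s \<in> N"
  shows "grow N {s} (off {s} y) = y"
proof (rule coarser_antisym)
  have dy: "dpart y" "supp y = N" using y by (auto simp: dparts_def)
  have sub: "supp (off {s} y) \<subseteq> N - {s}" using supp_off[of "{s}" y] dy by simp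
  show "grow N {s} (off {s} y) \<preceq> y" by (rule grow_off_coarser[OF a y])
  show "dpart (grow N {s} (off {s} y))"
    using grow_in_dparts[OF dpart_off[OF dy(1)] _ _ sub] s by (simp add: dparts_def)
  show "dpart y" by (rule dy)
  show "y \<preceq> grow N {s} (off {s} y)"
    unfolding coarser_def
  proof (intro conjI allI impI disjI2)
    show "supp y \<subseteq> supp (grow N {s} (off {s} y))"
      using supp_grow[of "off {s} y" N "{s}"] sub dy by auto
    fix B R assume B: "(B, R) \<in> grow N {s} (off {s} y)"
    show "\<exists>A Q. (A, Q) \<in> y \<and> B \<subseteq> A \<and> (Q \<inter> B = {} \<or> Q \<inter> B = R)"
    proof (cases "(B, R) \<in> off {s} y")
      case True
      then have "(B, R) \<in> y" by (simp add: in_off)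
      then show ?thesis using dpartD(2)[OF dy(1)] by blast
    next
      case False
      then have BR: "B = N - supp (off {s} y)" "R = {s}" using B by (auto simp: in_grow)
      obtain A Q where A: "(A, Q) \<in> y" "s \<in> A" using s dy(2) by (metis in_supp)
      have "Q = {s}" using atom_coarser_block[OF a y A(1)] A(2) by auto
      have "B \<subseteq> A"
      proof
        fix e assume e: "e \<in> B"
        then obtain C T where C: "(C, T) \<in> y" "e \<in> C" using BR dy(2) by (metis DiffD1 in_supp)
        have "s \<in> C"
        proof (rule ccontr)
          assume "s \<notin> C"
          then have "(C, T) \<in> off {s} y" using C by (simp add: in_off)
          then show False using e BR C(2) by (auto simp: in_supp)
        qed
        then show "e \<in> A" using dpart_unique[OF dy(1) C(1) A(1), of s] A C by blast
      qed
      moreover have "s \<in> B" using BR sub s by blast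
      ultimately show ?thesis using A \<open>Q = {s}\<close> BR by blast
    qed
  qed
qed

lemma off_supp:
  assumes wy: "w \<preceq> y" and y: "dpart y"
  shows "supp (off (supp w) y) = supp y - supp w"
proof
  show "supp (off (supp w) y) \<subseteq> supp y - supp w" by (rule supp_off)
  show "supp y - supp w \<subseteq> supp (off (supp w) y)"
  proof
    fix e assume e: "e \<in> supp y - supp w"
    then obtain B R where B: "(B, R) \<in> y" "e \<in> B" by (auto simp: in_supp)
    have "B \<inter> supp w = {}"
    proof (rule ccontr)
      assume "B \<inter> supp w \<noteq> {}"
      then obtain A Q where "(A, Q) \<in> w" "B \<subseteq> A" using coarserE[OF wy B(1)] by metis
      then show False using e B(2) by (auto simp: in_supp)
    qed
    then show "e \<in> supp (off (supp w) y)" using B by (auto simp: in_supp in_off)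
  qed
qed

text \<open>The blocks of \<open>y\<close> inside \<open>supp w\<close> are merged back into those
  of \<open>w\<close>; no block of \<open>y\<close> straddles \<open>supp w\<close>, because
  \<open>w\<close> is coarser than \<open>y\<close>.\<close>

lemma Un_off_coarser:
  assumes wy: "w \<preceq> y" and y: "dpart y"
  shows "w \<union> off (supp w) y \<preceq> y"
  unfolding coarser_def
proof (intro conjI allI impI disjI2)
  show "supp (w \<union> off (supp w) y) \<subseteq> supp y" using off_supp[OF assms] coarser_supp[OF wy] by auto
  fix B R assume B: "(B, R) \<in> y"
  show "\<exists>A Q. (A, Q) \<in> w \<union> off (supp w) y \<and> B \<subseteq> A \<and> (Q \<inter> B = {} \<or> Q \<inter> B = R)"
  proof (cases "B \<inter> supp w = {}")
    case True
    then have "(B, R) \<in> w \<union> off (supp w) y" "R \<inter> B = R" using B dpartD(2)[OF y B] by (auto simp: in_off)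
    then show ?thesis by blast
  next
    case False
    then obtain A Q where "(A, Q) \<in> w" "B \<subseteq> A" "Q \<inter> B = {} \<or> Q \<inter> B = R" by (rule coarserE[OF wy B])
    then show ?thesis by blast
  qed
qed

lemma off_Un_off:
  assumes "dpart w"
  shows "off (supp w) (w \<union> off (supp w) y) = off (supp w) y"
proof -
  have "fst b \<inter> supp w \<noteq> {}" if "b \<in> w" for b
    using block_nonempty[OF assms that] block_dec[OF assms that] by blast
  then show ?thesis by (auto simp: off_def)
qed

lemma off_singles_Un:
  assumes wy: "singles T \<preceq> y" and y: "dpart y"
  shows "off T y \<union> singles T = y"
proof (intro equalityI subrelI)
  fix B R assume "(B, R) \<in> off T y \<union> singles T"
  then consider "(B, R) \<in> y" | a where "a \<in> T" "B = {a}" "R = {a}" by (auto simp: in_off in_singles)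
  then show "(B, R) \<in> y"
  proof cases
    case 2
    have "a \<in> supp y" using coarser_supp[OF wy] 2 by auto
    then obtain C S where C: "(C, S) \<in> y" "a \<in> C" by (auto simp: in_supp)
    then have "C \<inter> supp (singles T) \<noteq> {}" using 2 by auto
    then obtain A Q where "(A, Q) \<in> singles T" "C \<subseteq> A" using coarserE[OF wy C(1)] by metis
    then have "C = {a}" using C(2) by (auto simp: in_singles)
    moreover then have "S = {a}" using dpartD(1,2)[OF y C(1)] by blast
    ultimately show ?thesis using C 2 by simp
  qed
next
  fix B R assume B: "(B, R) \<in> y"
  show "(B, R) \<in> off T y \<union> singles T"
  proof (cases "B \<inter> T = {}")
    case False
    then obtain A Q where "(A, Q) \<in> singles T" "B \<subseteq> A" using coarserE[OF wy B] by (metis supp_simps(4))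
    then obtain a where a: "a \<in> T" "B \<subseteq> {a}" by (auto simp: in_singles)
    then have "B = {a}" "R = {a}" using dpartD(1,2,3)[OF y B] by blast+
    then show ?thesis using a by (simp add: in_singles)
  qed (use B in \<open>simp add: in_off\<close>)
qed

section \<open>Trees and the recursion for the homology\<close>

section \<open>The chain of a tree\<close>

definition trees :: "'a set \<Rightarrow> 'a planar_tree set" where
  "trees N = {t. leaves t \<in> enumerations N}"

definition ltrees :: "'a \<Rightarrow> 'a set \<Rightarrow> 'a planar_tree set" where
  "ltrees s T = {t. distinct (leaves t) \<and> set (leaves t) = insert s T \<and> hd (leaves t) = s}"

definition rest :: "'a planar_tree \<Rightarrow> 'a set" where
  "rest t = set (tl (leaves t))"

text \<open>From a chain of \<open>R\<close> to one of \<open>Q\<close>: the block of the first leaf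
  is put back, and the entry \<open>{}\<close> yields the one-block partition decorated by that
  leaf. The chain is an argument, which lets \<open>rchain\<close> recur without a mutual
  definition. A leaf gives the empty chain, as \<open>qset\<close> of a single point is
  empty.\<close>

definition qlift :: "'a planar_tree \<Rightarrow> 'a dpart list \<Rightarrow> 'a dpart list" where
  "qlift t c = (case t of Tip _ \<Rightarrow> []
     | Node _ _ \<Rightarrow> map (grow (set (leaves t)) {hd (leaves t)}) ({} # c))"

text \<open>
  In a chain \<open>rchain t\<close>, the block of the first leaf \<open>s\<close> of \<open>t\<close> is left out. For \<open>t = Node u v\<close>, going down from
  the partition into singletons, first the leaves of \<open>v\<close> are merged as prescribed by \<open>qchain v\<close>, then they are joined to
  \<open>s\<close>, and the remaining leaves are merged as prescribed by \<open>u\<close>.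
\<close>

fun rchain :: "'a planar_tree \<Rightarrow> 'a dpart list" where
  "rchain (Tip s) = []"
| "rchain (Node u v) = rchain u @ (case u of Tip _ \<Rightarrow> [] | Node _ _ \<Rightarrow> [singles (rest u)])
     @ map (\<lambda>y. y \<union> singles (rest u)) (qlift v (rchain v))"

definition qchain :: "'a planar_tree \<Rightarrow> 'a dpart list" where
  "qchain t = qlift t (rchain t)"

definition qset :: "'a set \<Rightarrow> 'a dpart set" where
  "qset N = dparts N - {singles N}"

text \<open>The partitions strictly between the atom decorated by a further point and the top, with
  the block of that point left out: \<open>{}\<close> stands for the atom, \<open>singles T\<close>
  for the top.\<close>

definition rset :: "'a set \<Rightarrow> 'a dpart set" where
  "rset T = {x. dpart x \<and> supp x \<subseteq> T \<and> x \<noteq> {} \<and> x \<noteq> singles T}"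

lemma leaves_ne [simp]: "leaves t \<noteq> []"
  by (induction t) auto

lemma leaves_Cons: "leaves t = hd (leaves t) # tl (leaves t)"
  by simp

lemma ltrees_rest:
  assumes "t \<in> ltrees s T" "s \<notin> T"
  shows "rest t = T"
proof -
  have *: "leaves t = s # tl (leaves t)" using assms leaves_Cons[of t] by (auto simp: ltrees_def)
  have "distinct (s # tl (leaves t))" "set (s # tl (leaves t)) = insert s T"
    using assms(1) * unfolding ltrees_def by (metis (mono_tags) mem_Collect_eq)+
  then show ?thesis using assms(2) by (auto simp: rest_def)
qed

lemma trees_ltrees: "s \<in> N \<Longrightarrow> t \<in> ltrees s (N - {s}) \<longleftrightarrow> t \<in> trees N \<and> hd (leaves t) = s"
  by (auto simp: ltrees_def trees_def enumerations_def insert_absorb)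

lemma trees_Union: "trees N = (\<Union>s\<in>N. ltrees s (N - {s}))"
proof (intro equalityI subsetI)
  fix t assume t: "t \<in> trees N"
  have "hd (leaves t) \<in> set (leaves t)" by simp
  then have "hd (leaves t) \<in> N" using t unfolding trees_def enumerations_def by blast
  moreover from this have "t \<in> ltrees (hd (leaves t)) (N - {hd (leaves t)})"
    using t by (simp add: trees_ltrees)
  ultimately show "t \<in> (\<Union>s\<in>N. ltrees s (N - {s}))" by (rule UN_I)
next
  fix t assume "t \<in> (\<Union>s\<in>N. ltrees s (N - {s}))"
  then obtain s where "s \<in> N" "t \<in> ltrees s (N - {s})" by (rule UN_E)
  then show "t \<in> trees N" by (simp add: trees_ltrees)
qed

lemma ltrees_empty: "ltrees s {} = {Tip s}"
proof -
  have "t = Tip s" if "t \<in> ltrees s {}" for t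
  proof (cases t)
    case (Node u v)
    have "set (leaves u) \<inter> set (leaves v) = {}" "set (leaves u) \<union> set (leaves v) = {s}"
      using that Node by (auto simp: ltrees_def)
    note uv = this
    have "set (leaves u) \<subseteq> {s}" "set (leaves v) \<subseteq> {s}"
      unfolding uv(2)[symmetric] by simp_all
    moreover have "set (leaves u) \<noteq> {}" "set (leaves v) \<noteq> {}" by simp_all
    ultimately have "set (leaves u) = {s}" "set (leaves v) = {s}"
      unfolding subset_singleton_iff by simp_all
    with uv(1) show ?thesis by simp
  qed (use that in \<open>simp add: ltrees_def\<close>)
  then show ?thesis by (auto simp: ltrees_def)
qed

text \<open>The recursion for trees that matches \<open>rset_step\<close>; for
  \<open>T' = {}\<close> the tree \<open>u\<close> is the leaf \<open>s\<close>.\<close>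

lemma Node_ltrees:
  assumes s: "s \<notin> T"
  shows "Node u v \<in> ltrees s T \<longleftrightarrow> (\<exists>T'. T' \<subset> T \<and> u \<in> ltrees s T' \<and> v \<in> trees (T - T'))"
proof
  assume L: "Node u v \<in> ltrees s T"
  let ?T' = "set (leaves u) - {s}"
  have *: "distinct (leaves u)" "distinct (leaves v)" "set (leaves u) \<inter> set (leaves v) = {}"
    "set (leaves u) \<union> set (leaves v) = insert s T" "hd (leaves u) = s"
    using L by (auto simp: ltrees_def)
  have su: "s \<in> set (leaves u)" using *(5) by (metis hd_in_set leaves_ne)
  have "U - {s} \<subset> T \<and> insert s (U - {s}) = U \<and> T - (U - {s}) = V"
    if "U \<inter> V = {}" "U \<union> V = insert s T" "s \<in> U" "V \<noteq> {}" for U V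
  proof -
    have "s \<notin> V" using that(1,3) by (simp add: disjoint_iff)
    then have "U - {s} = T - V" "V \<subseteq> T" using that s by auto
    then show ?thesis using that(3,4) by auto
  qed
  from this[OF *(3,4) su] have "?T' \<subset> T \<and> insert s ?T' = set (leaves u) \<and> T - ?T' = set (leaves v)"
    by simp
  then have "?T' \<subset> T \<and> u \<in> ltrees s ?T' \<and> v \<in> trees (T - ?T')"
    using * by (simp add: ltrees_def trees_def enumerations_def)
  then show "\<exists>T'. T' \<subset> T \<and> u \<in> ltrees s T' \<and> v \<in> trees (T - T')" by (rule exI)
next
  assume "\<exists>T'. T' \<subset> T \<and> u \<in> ltrees s T' \<and> v \<in> trees (T - T')"
  then obtain T' where T': "T' \<subseteq> T" and u: "distinct (leaves u)" "set (leaves u) = insert s T'" "hd (leaves u) = s"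
    and v: "distinct (leaves v)" "set (leaves v) = T - T'"
    by (auto simp: ltrees_def trees_def enumerations_def)
  have "insert s T' \<inter> (T - T') = {}" "insert s T' \<union> (T - T') = insert s T" using T' s by auto
  then show "Node u v \<in> ltrees s T" using u v by (simp add: ltrees_def)
qed

lemma qchain_Tip: "qchain (Tip a) = []"
  by (simp add: qchain_def qlift_def)

lemma singles_inj: "singles T = singles T' \<longleftrightarrow> T = T'"
proof
  assume "singles T = singles T'"
  then have "supp (singles T) = supp (singles T')" by (rule arg_cong)
  then show "T = T'" by simp
qed simp

lemma grow_singles:
  assumes "s \<in> N"
  shows "grow N {s} (singles (N - {s})) = singles N"
proof -
  have "N - supp (singles (N - {s})) = {s}" using assms by auto
  moreover have "insert ({s}, {s}) (singles (N - {s})) = singles (insert s (N - {s}))"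
    unfolding singles_def by (rule image_insert[symmetric])
  ultimately show ?thesis using assms by (simp only: grow_def insert_Diff)
qed

lemma qset_subset_rset: "T \<noteq> {} \<Longrightarrow> qset T \<subseteq> rset T"
  by (auto simp: qset_def rset_def dparts_def)

lemma rset_scoarser: "x \<in> rset T \<Longrightarrow> x \<lless> singles T"
  using coarser_singles[of x T] by (auto simp: rset_def scoarser_def)

lemma finite_rset: "finite T \<Longrightarrow> finite (rset T)"
  by (rule finite_subset[OF _ finite_dparts_subset[of T]]) (auto simp: rset_def)

lemma rset_card:
  assumes "finite T" "x \<in> rset T"
  shows "card x \<in> {1..<card T}"
proof -
  have "card x < card T" using card_less[OF rset_scoarser[OF assms(2)]] assms(1) by simp
  moreover have "finite x"
    using finite_dpart[of x] assms finite_subset by (auto simp: rset_def)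
  then have "card x \<noteq> 0" using assms(2) by (auto simp: rset_def)
  ultimately show ?thesis by simp
qed

section \<open>The homology of the posets of decorated partitions\<close>

context
  fixes K :: "'k::field itself"
begin

interpretation dp: strict_poset K scoarser
  by (rule strict_poset_scoarser)

lemma rset_simplices_length:
  assumes T: "finite T" and xs: "xs \<in> dp.simplices (rset T) m"
  shows "m \<le> card T - 1"
proof (rule dp.simplices_length[OF _ rset_card[OF T] xs])
  fix x y assume "x \<in> rset T" "y \<in> rset T" "x \<lless> y"
  then show "card x < card y" using card_less[of x y] T finite_subset by (auto simp: rset_def)
qed

lemma spherical_image:
  assumes "inj_on \<phi> X" "\<And>x y. x \<in> X \<Longrightarrow> y \<in> X \<Longrightarrow> \<phi> x \<lless> \<phi> y \<longleftrightarrow> x \<lless> y" "dp.spherical X n I e"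
  shows "dp.spherical (\<phi> ` X) n I (\<lambda>i. map \<phi> (e i))"
proof -
  interpret iso: strict_poset_iso K scoarser scoarser \<phi> X
    by unfold_locales (use assms in auto)
  show ?thesis by (rule iso.spherical_iso[OF assms(3)])
qed

text \<open>
  Gluing \<open>atom N S\<close> to the partitions with larger total decoration: its link contracts to the partitions with a single
  block meeting \<open>S\<close>.
\<close>

lemma acyclic_above_atom:
  assumes N: "finite N" and S: "S \<subset> N" "2 \<le> card S"
  shows "dp.acyclic {y \<in> qset N. atom N S \<lless> y \<and> decs y \<noteq> S}"
proof -
  let ?U = "{y \<in> qset N. atom N S \<lless> y \<and> decs y \<noteq> S}"
  let ?f = "\<lambda>y. grow N S (off S y)"
  let ?m = "grow N S (singles (N - S))"
  have Sn: "S \<noteq> {}" "S \<subseteq> N" "\<exists>s s'. s \<in> S \<and> s' \<in> S \<and> s \<noteq> s'"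
    using S card_le_Suc0_iff_eq[of S] finite_subset[OF psubset_imp_subset[OF S(1)] N] by fastforce+
  have U: "y \<in> dparts N" "dpart y" "atom N S \<preceq> y" "dpart (off S y)" "supp (off S y) \<subseteq> N - S" "y \<noteq> singles N" if "y \<in> ?U" for y
    using that supp_off[of S y] by (auto simp: qset_def dparts_def scoarser_def intro: dpart_off)
  have fD: "?f y \<in> dparts N" if "y \<in> ?U" for y
    using grow_in_dparts[OF U(4)[OF that] Sn(1,2) U(5)[OF that]] .
  have fle: "?f y \<preceq> y" if "y \<in> ?U" for y
    using grow_off_coarser U(1,3)[OF that] by blast
  have inU: "grow N S x \<in> ?U" if x: "dpart x" "supp x \<subseteq> N - S" "x \<noteq> {}" "grow N S x \<noteq> singles N" for x
  proof -
    have d: "grow N S x \<in> dparts N" using grow_in_dparts[OF x(1) Sn(1,2) x(2)] .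
    have "decs x \<noteq> {}" using x(1,3) block_dec[OF x(1)] unfolding decs_def by blast
    then have ne: "decs (grow N S x) \<noteq> S"
      using decs_subset_supp[OF x(1)] x(2) unfolding decs_grow by blast
    have "atom N S \<preceq> grow N S x"
      unfolding atom_eq_grow using grow_coarser_iff[OF Sn(1,2) _ _ x(1,2), of "{}"] by simp
    moreover have "atom N S \<noteq> grow N S x" using ne by (metis decs_atom)
    ultimately show ?thesis
      using d ne x(4) atom_in_dparts[OF Sn(1,2)] by (simp add: qset_def dparts_def scoarser_def)
  qed
  have off_ne: "off S y \<noteq> {}" if "y \<in> ?U" for y
  proof
    assume "off S y = {}"
    then have "decs y \<subseteq> S" using decs_off[OF U(3,1)[OF that]] by auto
    moreover have "S \<subseteq> decs y" using coarser_decs[OF U(3)[OF that]] atom_in_dparts[OF Sn(1,2)] by (auto simp: dparts_def)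
    ultimately show False using that by blast
  qed
  have m: "?m \<in> ?U"
  proof (rule inU)
    show "singles (N - S) \<noteq> {}" using S(1) singles_inj[of "N - S" "{}"] by (auto simp: singles_def)
    \<comment> \<open>Here the size of \<open>S\<close> enters. For a one-point \<open>S\<close> the
      apex \<open>?m\<close> would be the removed top element, and indeed the atoms decorated by one
      point are those that carry homology.\<close>
    have "(S, S) \<in> ?m" using Sn(2) by (auto simp: in_grow)
    moreover have "(S, S) \<notin> singles N" using Sn(3) by (auto simp: in_singles)
    ultimately show "?m \<noteq> singles N" by metis
  qed auto
  have fU: "?f y \<in> ?U" if y: "y \<in> ?U" for y
  proof (rule inU[OF U(4,5)[OF y] off_ne[OF y]])
    show "?f y \<noteq> singles N"
    proof
      assume "?f y = singles N"
      then have "singles N \<preceq> y" using fle[OF y] by simp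
      moreover have "y \<preceq> singles N" using coarser_singles[of y N] U(1)[OF y] by (auto simp: dparts_def)
      ultimately show False using coarser_antisym U(2,6)[OF y] dpart_singles by blast
    qed
  qed
  have fm: "?f y \<preceq> ?m" if y: "y \<in> ?U" for y
    using grow_coarser_iff[OF Sn(1,2) U(4,5)[OF y], of "singles (N - S)"] U(4,5)[OF y]
    by (simp add: coarser_singles)
  have ff: "?f (?f y) = ?f y" if "y \<in> ?U" for y
    using off_grow[OF Sn(1,2) U(4,5)[OF that]] by simp
  have fmm: "?f ?m = ?m" using off_grow[OF Sn(1,2), of "singles (N - S)"] by simp
  show ?thesis
  proof (rule dp.acyclic_closure[of _ ?f])
    show "finite ?U" using finite_dparts[OF N] by (auto simp: qset_def)
    show "dp.acyclic (?f ` ?U)"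
    proof (rule dp.acyclic_cone[of ?m])
      show "?m \<in> ?f ` ?U" using m fmm by force
      fix x assume "x \<in> ?f ` ?U"
      then obtain y where y: "y \<in> ?U" "x = ?f y" by blast
      show "x = ?m \<or> x \<lless> ?m \<or> ?m \<lless> x"
        using fm[OF y(1)] fD[OF y(1)] U(2)[OF m] unfolding y(2) scoarser_def dparts_def by blast
    qed
  next
    fix x y assume x: "x \<in> ?U" and y: "y \<in> ?U" and xy: "x \<lless> y"
    have "off S x \<preceq> off S y" by (rule off_mono) (use xy in \<open>auto simp: scoarser_def\<close>)
    then have "?f x \<preceq> ?f y" using grow_coarser_iff[OF Sn(1,2) U(4,5)[OF x] U(4,5)[OF y]] by simp
    then show "?f x = ?f y \<or> ?f x \<lless> ?f y" using fD[OF x] fD[OF y] by (auto simp: scoarser_def dparts_def)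
  next
    fix x assume x: "x \<in> ?U"
    show "?f x = x \<or> ?f x \<lless> x" using fle[OF x] fD[OF x] U(2)[OF x] by (auto simp: scoarser_def dparts_def)
  qed (use fU ff in auto)
qed

text \<open>The sets \<open>S\<close> are added from \<open>N\<close> downwards. The partitions of
  total decoration \<open>S\<close> retract to their least element \<open>atom N S\<close>, whose
  link is acyclic by \<open>acyclic_above_atom\<close>; the start is a cone with apex
  \<open>atom N N\<close>.\<close>

lemma acyclic_large_decs:
  assumes N: "finite N" "2 \<le> card N"
  shows "dp.acyclic {x \<in> qset N. 2 \<le> card (decs x)}"
proof -
  let ?D = "{S. S \<subseteq> N \<and> 2 \<le> card S}"
  let ?V = "\<lambda>E. {x \<in> qset N. decs x \<in> E}"
  interpret ss: strict_poset K "\<lambda>S S' :: 'a set. S \<subset> S'" by unfold_locales auto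
  have Nne: "N \<noteq> {}" using N by auto
  have single: "atom N S \<in> qset N" if "S \<in> ?D" for S
  proof -
    have S: "S \<noteq> {}" "S \<subseteq> N" using that by auto
    have "N \<noteq> {a}" for a using N by auto
    then have "(N, S) \<notin> singles N" by (auto simp: in_singles)
    then show ?thesis using atom_in_dparts[OF S] by (auto simp: qset_def atom_def)
  qed
  have "finite ?D" using N(1) by simp
  \<comment> \<open>The empty set, with which the induction starts, is not acyclic; hence the
    alternative.\<close>
  then have "?D = {} \<or> dp.acyclic (?V ?D)"
  proof (induction rule: ss.finite_upset_induct)
    case empty
    then show ?case by simp
  next
    case (insert E S)
    have SN: "S \<subseteq> N" "2 \<le> card S" "S \<noteq> {}" using insert(2) by auto
    have below: "atom N S = x \<or> atom N S \<lless> x" if "x \<in> qset N" "decs x = S" for x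
      using atom_coarser_decs[of x N] that atom_in_dparts[OF SN(3,1)] by (auto simp: qset_def dparts_def scoarser_def)
    show ?case
    proof (cases "S = N")
      case True
      have "E = {}" using insert True by blast
      moreover have "dp.acyclic (?V {N})"
        by (rule dp.acyclic_cone[of "atom N S"]) (use True below single[OF insert(2)] in auto)
      ultimately show ?thesis using True by simp
    next
      case False
      then have "N \<in> E" using insert(4) SN N by blast
      then have ac: "dp.acyclic (?V E)" using insert.IH by blast
      have link: "dp.link (?V E) (atom N S) = {y \<in> qset N. atom N S \<lless> y \<and> decs y \<noteq> S}"
      proof (intro equalityI subsetI)
        fix y assume "y \<in> dp.link (?V E) (atom N S)"
        then show "y \<in> {y \<in> qset N. atom N S \<lless> y \<and> decs y \<noteq> S}"
          using below_atom[OF N(1) Nne] insert(3) by (auto simp: dp.link_def qset_def)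
      next
        fix y assume y: "y \<in> {y \<in> qset N. atom N S \<lless> y \<and> decs y \<noteq> S}"
        then have "S \<subset> decs y"
          using coarser_decs[of "atom N S" y] by (auto simp: scoarser_def)
        moreover have "decs y \<subseteq> N" using decs_subset_supp[of y] y by (auto simp: qset_def dparts_def)
        moreover then have "card S \<le> card (decs y)"
          using calculation N(1) by (meson card_mono finite_subset psubset_imp_subset)
        ultimately have "decs y \<in> E" using insert(4) SN by auto
        then show "y \<in> dp.link (?V E) (atom N S)" using y by (auto simp: dp.link_def)
      qed
      have "dp.acyclic (Set.insert (atom N S) (?V E))"
      proof (rule dp.acyclic_insert[OF _ ac])
        show "atom N S \<notin> ?V E" using insert(3) by simp
        show "dp.acyclic (dp.link (?V E) (atom N S))"
          unfolding link by (rule acyclic_above_atom[OF N(1)]) (use False SN in auto)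
      qed
      moreover let ?f = "\<lambda>x. if decs x = S then atom N S else x"
      have "?f ` ?V (Set.insert S E) = Set.insert (atom N S) (?V E)"
        using single[OF insert(2)] insert(3) by (auto simp: image_iff intro!: exI[of _ "atom N S"])
      ultimately have ac': "dp.acyclic (?f ` ?V (Set.insert S E))" by simp
      have "dp.acyclic (?V (Set.insert S E))"
      proof (rule dp.acyclic_closure[OF _ _ _ _ _ ac'])
        show "finite (?V (Set.insert S E))" using finite_dparts[OF N(1)] by (auto simp: qset_def)
        show "?f x \<in> ?V (Set.insert S E)" if "x \<in> ?V (Set.insert S E)" for x
          using that single[OF insert(2)] by auto
        show "?f (?f x) = ?f x" for x by simp
        show "?f x = x \<or> ?f x \<lless> x" if "x \<in> ?V (Set.insert S E)" for x
          using that below[of x] by auto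
        fix x y assume x: "x \<in> ?V (Set.insert S E)" and y: "y \<in> ?V (Set.insert S E)" and xy: "x \<lless> y"
        have "decs x \<subseteq> decs y" using coarser_decs[of x y] xy by (auto simp: scoarser_def)
        then have "decs x = S" if "decs y = S"
          using x that insert(5) by auto
        note xS = this
        show "?f x = ?f y \<or> ?f x \<lless> ?f y"
        proof (cases "decs x = S")
          case True
          then have "atom N S \<lless> y" using below[of x] x xy dp.trans[of "atom N S" x y] by auto
          then show ?thesis using True by simp
        next
          case False
          then show ?thesis using xS xy by auto
        qed
      qed
      then show ?thesis by simp
    qed
  qed
  moreover have "N \<in> ?D" using N by simp
  moreover have "?V ?D = {x \<in> qset N. 2 \<le> card (decs x)}"
    using decs_subset_supp by (fastforce simp: qset_def dparts_def)
  ultimately show ?thesis by auto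
qed

text \<open>A partition whose total decoration is one point \<open>s\<close> is
  \<open>atom N {s}\<close>. These atoms are pairwise incomparable, and everything strictly above
  them has a larger total decoration. So the link of each atom lies in the acyclic part, does not
  depend on the atoms glued before, and is a copy of \<open>rset (N - {s})\<close>.\<close>

lemma qset_step:
  assumes N: "finite N" "2 \<le> card N"
    and R: "\<And>s. s \<in> N \<Longrightarrow> dp.spherical (rset (N - {s})) (card N - 2) (ltrees s (N - {s})) rchain"
  shows "dp.spherical (qset N) (card N - 1) (trees N) qchain"
proof -
  let ?V = "{x \<in> qset N. 2 \<le> card (decs x)}"
  have Nne: "N \<noteq> {}" using N by auto
  have n: "card N - 1 = Suc (card N - 2)" using N(2) by simp
  have at: "atom N {s} \<in> qset N" "atom N {s} \<in> dparts N" "dpart (atom N {s})" if "s \<in> N" for s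
  proof -
    have "N \<noteq> {a}" for a using N by auto
    then have "(N, {s}) \<notin> singles N" by (auto simp: in_singles)
    then show "atom N {s} \<in> qset N" "atom N {s} \<in> dparts N" "dpart (atom N {s})"
      using atom_in_dparts[of "{s}" N] that by (auto simp: qset_def atom_def dparts_def)
  qed
  have dim: "m \<le> Suc (card N - 2)" if "xs \<in> dp.simplices (qset N) m" for xs m
    using that rset_simplices_length[OF N(1), of xs m] qset_subset_rset[OF Nne] n
    by (auto simp: dp.simplices_def)
  have grow: "(\<lambda>x. grow N {s} x) ` rset (N - {s}) = {y \<in> qset N. atom N {s} \<lless> y}" if s: "s \<in> N" for s
  proof (intro equalityI subsetI)
    fix y assume "y \<in> (\<lambda>x. grow N {s} x) ` rset (N - {s})"
    then obtain x where x: "dpart x" "supp x \<subseteq> N - {s}" "x \<noteq> {}" "x \<noteq> singles (N - {s})" "y = grow N {s} x"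
      by (auto simp: rset_def)
    have y: "y \<in> dparts N" using grow_in_dparts[OF x(1)] x s by auto
    note gs = grow_singles[OF s] and s' = insert_not_empty[of s "{}"]
    have sN: "{s} \<subseteq> N" using s by simp
    have "y \<noteq> singles N"
    proof
      assume "y = singles N"
      then have "grow N {s} x = grow N {s} (singles (N - {s}))" using x(5) gs by simp
      then have "x = singles (N - {s})" by (rule grow_inj[OF s' sN x(1,2), rotated -1]) simp_all
      then show False using x(4) by simp
    qed
    moreover have "atom N {s} \<preceq> y"
      unfolding atom_eq_grow x(5) using grow_coarser_iff[of "{s}" N "{}" x] x s by simp
    moreover have "atom N {s} \<noteq> y"
    proof
      assume "atom N {s} = y"
      then have "grow N {s} x = grow N {s} {}" using x(5) by (simp add: atom_eq_grow)
      then have "x = {}" by (rule grow_inj[OF s' sN x(1,2), rotated -1]) simp_all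
      then show False using x(3) by simp
    qed
    ultimately show "y \<in> {y \<in> qset N. atom N {s} \<lless> y}"
      using y at[OF s] by (simp add: qset_def scoarser_def dparts_def)
  next
    fix y assume y: "y \<in> {y \<in> qset N. atom N {s} \<lless> y}"
    then have y': "y \<in> dparts N" "dpart y" "atom N {s} \<preceq> y" "y \<noteq> singles N" "y \<noteq> atom N {s}"
      by (auto simp: qset_def scoarser_def)
    have eq: "grow N {s} (off {s} y) = y" by (rule grow_off_singleton[OF y'(3,1) s])
    have "off {s} y \<noteq> singles (N - {s})" "off {s} y \<noteq> {}"
      using eq y'(4,5) grow_singles[OF s] by (auto simp: atom_eq_grow)
    then have "off {s} y \<in> rset (N - {s})"
      using supp_off[of "{s}" y] y' dpart_off by (auto simp: rset_def dparts_def)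
    then show "y \<in> (\<lambda>x. grow N {s} x) ` rset (N - {s})" using eq by force
  qed
  have L: "dp.spherical {y \<in> qset N. atom N {s} \<lless> y} (card N - 2) (ltrees s (N - {s})) (\<lambda>t. map (grow N {s}) (rchain t))"
    if s: "s \<in> N" for s
  proof -
    have "inj_on (grow N {s}) (rset (N - {s}))"
      by (rule inj_onI, rule grow_inj[of "{s}" N]) (use s in \<open>auto simp: rset_def\<close>)
    moreover have "grow N {s} x \<lless> grow N {s} y \<longleftrightarrow> x \<lless> y" if "x \<in> rset (N - {s})" "y \<in> rset (N - {s})" for x y
    proof -
      have x: "dpart x" "supp x \<subseteq> N - {s}" and y: "dpart y" "supp y \<subseteq> N - {s}" using that by (auto simp: rset_def)
      then have "dpart (grow N {s} x)" "dpart (grow N {s} y)"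
        using grow_in_dparts[of x "{s}" N] grow_in_dparts[of y "{s}" N] s by (auto simp: dparts_def)
      then show ?thesis
        using grow_coarser_iff[of "{s}" N x y] grow_inj[of "{s}" N x y] x y s by (auto simp: scoarser_def)
    qed
    ultimately show ?thesis
      using spherical_image[OF _ _ R[OF s], of "grow N {s}"] grow[OF s] by simp
  qed
  have "dp.spherical (?V \<union> (\<lambda>s. atom N {s}) ` M) (Suc (card N - 2)) (\<Union>s\<in>M. ltrees s (N - {s})) qchain"
    if "M \<subseteq> N" for M
  proof -
    have "finite M" using that N finite_subset by blast
    then show ?thesis using that
    proof (induction M rule: finite_induct)
      case empty
      have "dp.spherical ?V (Suc (card N - 2)) {} qchain"
        by (rule dp.spherical_acyclic[OF acyclic_large_decs[OF N]])
          (auto simp: dp.simplices_def intro!: dim)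
      then show ?case by simp
    next
      case (insert s M)
      let ?X = "?V \<union> (\<lambda>s. atom N {s}) ` M"
      have s: "s \<in> N" "s \<notin> M" using insert by auto
      have "atom N {s} \<noteq> atom N {s'}" if "s' \<in> M" for s'
        using s(2) that by (auto simp: atom_def)
      then have new: "atom N {s} \<notin> ?X" by auto
      have link: "dp.link ?X (atom N {s}) = {y \<in> qset N. atom N {s} \<lless> y}"
      proof (intro equalityI subsetI)
        fix y assume y: "y \<in> dp.link ?X (atom N {s})"
        then have "y \<in> qset N" using at insert by (auto simp: dp.link_def)
        then have "y \<in> dparts N" by (simp add: qset_def)
        with y \<open>y \<in> qset N\<close> show "y \<in> {y \<in> qset N. atom N {s} \<lless> y}"
          using below_atom[OF N(1) Nne] by (auto simp: dp.link_def)
      next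
        fix y assume y: "y \<in> {y \<in> qset N. atom N {s} \<lless> y}"
        then have d: "y \<in> dparts N" "dpart y" "finite (decs y)" "s \<in> decs y"
          using coarser_decs[of "atom N {s}" y] decs_subset_supp[of y] N(1) finite_subset
          by (auto simp: qset_def dparts_def scoarser_def)
        have "decs y \<noteq> {s}"
        proof
          assume "decs y = {s}"
          from decs_singleton[OF d(1) this] y dp.irrefl[of y] show False by simp
        qed
        then have "\<not> card (decs y) \<le> Suc 0" using card_le_Suc0_iff_eq[OF d(3)] d(4) by blast
        then show "y \<in> dp.link ?X (atom N {s})" using y by (auto simp: dp.link_def)
      qed
      have "dp.spherical (Set.insert (atom N {s}) ?X) (Suc (card N - 2))
          ((\<Union>s\<in>M. ltrees s (N - {s})) \<union> ltrees s (N - {s})) qchain"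
      proof (rule dp.spherical_insert[OF new])
        show "dp.spherical ?X (Suc (card N - 2)) (\<Union>s\<in>M. ltrees s (N - {s})) qchain" using insert by simp
        show Ls: "dp.spherical (dp.link ?X (atom N {s})) (card N - 2) (ltrees s (N - {s})) (\<lambda>t. map (grow N {s}) (rchain t))"
          unfolding link by (rule L[OF s(1)])
        show "(\<Union>s\<in>M. ltrees s (N - {s})) \<inter> ltrees s (N - {s}) = {}"
          using s by (auto simp: ltrees_def)
        fix t assume t: "t \<in> ltrees s (N - {s})"
        have t': "set (leaves t) = N" "hd (leaves t) = s" using t s by (auto simp: ltrees_def)
        obtain u v where "t = Node u v"
        proof (cases t)
          case (Tip a)
          then show ?thesis using t' N by auto
        qed
        \<comment> \<open>The chain of a tree begins with the atom of its first leaf, which is the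
          point being glued in.\<close>
        then have "qchain t = [] @ atom N {s} # map (grow N {s}) (rchain t)"
          using t' by (simp add: qchain_def qlift_def atom_eq_grow del: rchain.simps)
        moreover have "\<forall>y\<in>set (map (grow N {s}) (rchain t)). atom N {s} \<lless> y"
          using dp.sphericalD(4)[OF Ls t] unfolding link by (auto simp: dp.simplices_def)
        ultimately show "\<exists>p q. map (grow N {s}) (rchain t) = p @ q \<and> qchain t = p @ atom N {s} # q
            \<and> (\<forall>y\<in>set p. y \<lless> atom N {s}) \<and> (\<forall>y\<in>set q. atom N {s} \<lless> y)" by force
      qed
      then show ?case by (simp add: Un_commute)
    qed
  qed
  from this[of N] have "dp.spherical (?V \<union> (\<lambda>s. atom N {s}) ` N) (card N - 1) (trees N) qchain"
    unfolding n trees_Union by simp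
  moreover have "?V \<union> (\<lambda>s. atom N {s}) ` N = qset N"
  proof -
    have "\<exists>s\<in>N. x = atom N {s}" if x: "x \<in> qset N" "\<not> 2 \<le> card (decs x)" for x
    proof -
      have d: "x \<in> dparts N" "dpart x" "decs x \<subseteq> N" "x \<noteq> {}"
        using x(1) decs_subset_supp[of x] Nne by (auto simp: qset_def dparts_def)
      then have f: "finite (decs x)" using N finite_subset by blast
      obtain s where s: "s \<in> decs x" using d(2,4) block_dec[of x] unfolding decs_def by blast
      then have "decs x = {s}" using x(2) card_le_Suc0_iff_eq[OF f] by auto
      then show ?thesis using decs_singleton[OF d(1)] s d(3) by blast
    qed
    then show ?thesis using at by auto
  qed
  ultimately show ?thesis by simp
qed

end

lemma off_Un: "off S (x \<union> y) = off S x \<union> off S y"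
  by (auto simp: off_def)

lemma off_disjoint:
  assumes "dpart x" "supp x \<inter> S = {}"
  shows "off S x = x"
proof -
  have "fst b \<inter> S = {}" if "b \<in> x" for b using block_dec[OF assms(1) that] assms(2) by blast
  then show ?thesis by (auto simp: off_def)
qed

lemma off_inside:
  assumes "dpart x" "supp x \<subseteq> S"
  shows "off S x = {}"
proof -
  have "fst b \<inter> S \<noteq> {}" if b: "b \<in> x" for b
  proof -
    obtain a where "a \<in> fst b" using block_nonempty[OF assms(1) b] .
    then show ?thesis using block_dec[OF assms(1) b] assms(2) by blast
  qed
  then show ?thesis by (auto simp: off_def)
qed

lemma off_singles: "off S (singles T) = singles (T - S)"
  by (auto simp: off_def singles_def)

context
  fixes K :: "'k::field itself"
begin

interpretation dp: strict_poset K scoarser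
  by (rule strict_poset_scoarser)

lemma rset_below_singles: "T' \<subset> T \<Longrightarrow> {y \<in> rset T. y \<lless> singles T'} = rset T'"
proof (intro equalityI subsetI)
  fix y assume "y \<in> {y \<in> rset T. y \<lless> singles T'}"
  then show "y \<in> rset T'" using coarser_singles[of y T'] by (auto simp: rset_def scoarser_def)
next
  fix y assume T: "T' \<subset> T" and y: "y \<in> rset T'"
  then have "y \<noteq> singles T" by (auto simp: rset_def)
  then show "y \<in> {y \<in> rset T. y \<lless> singles T'}" using y T rset_scoarser[OF y] by (auto simp: rset_def)
qed

text \<open>Above \<open>singles T'\<close> the points of \<open>T'\<close> can only be singleton
  blocks, which leaves a partition of \<open>T - T'\<close>.\<close>

lemma qset_above_singles:
  assumes T': "T' \<subset> T"
  shows "{y \<in> qset T. singles T' \<lless> y} = (\<lambda>y. y \<union> singles T') ` qset (T - T')"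
proof (intro equalityI subsetI)
  fix y assume y: "y \<in> {y \<in> qset T. singles T' \<lless> y}"
  then have d: "dpart y" "supp y = T" "singles T' \<preceq> y" "y \<noteq> singles T"
    by (auto simp: qset_def dparts_def scoarser_def)
  have eq: "off T' y \<union> singles T' = y" by (rule off_singles_Un[OF d(3,1)])
  have "supp (off T' y) = T - T'" using off_supp[OF d(3,1)] d(2) by simp
  moreover have "off T' y \<noteq> singles (T - T')"
  proof
    assume "off T' y = singles (T - T')"
    then have "y = singles (T - T') \<union> singles T'" using eq by simp
    also have "\<dots> = singles T" using T' by (auto simp: singles_def)
    finally show False using d(4) by simp
  qed
  ultimately have "off T' y \<in> qset (T - T')" using dpart_off[OF d(1)] by (simp add: qset_def dparts_def)
  then show "y \<in> (\<lambda>y. y \<union> singles T') ` qset (T - T')" by (rule image_eqI[where x = "off T' y", rotated]) (simp add: eq)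
next
  fix z assume "z \<in> (\<lambda>y. y \<union> singles T') ` qset (T - T')"
  then obtain y where y: "dpart y" "supp y = T - T'" "y \<noteq> singles (T - T')" "z = y \<union> singles T'"
    by (auto simp: qset_def dparts_def)
  have z: "dpart z" "supp z = T" unfolding y(4) using y(1,2) T' by (auto intro!: dpart_Un)
  have eq: "y = off T' z"
    unfolding y(4) off_Un using off_disjoint[OF y(1), of T'] off_inside[of "singles T'" T'] y(2) by auto
  have "z \<noteq> singles T"
  proof
    assume "z = singles T"
    then have "y = off T' (singles T)" using eq by simp
    then show False using y(3) by (simp add: off_singles)
  qed
  moreover have "singles T' \<preceq> z"
    using coarser_Un_iff[of "{}" y "T - T'" "singles T'" "singles T'" T'] y by auto
  moreover have "singles T' \<noteq> z" using z(2) T' by auto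
  ultimately show "z \<in> {y \<in> qset T. singles T' \<lless> y}" using z by (simp add: qset_def dparts_def scoarser_def)
qed

lemma spherical_above_singles:
  assumes T': "T' \<subset> T" and S: "dp.spherical (qset (T - T')) n I e"
  shows "dp.spherical {y \<in> qset T. singles T' \<lless> y} n I (\<lambda>i. map (\<lambda>y. y \<union> singles T') (e i))"
  unfolding qset_above_singles[OF T']
proof (rule spherical_image[OF _ _ S])
  have iff: "x \<union> singles T' \<preceq> y \<union> singles T' \<longleftrightarrow> x \<preceq> y" if "x \<in> qset (T - T')" "y \<in> qset (T - T')" for x y
    using coarser_Un_iff[of x y "T - T'" "singles T'" "singles T'" T'] that by (auto simp: qset_def dparts_def)
  have inj: "x = y" if "x \<in> qset (T - T')" "y \<in> qset (T - T')" "x \<union> singles T' = y \<union> singles T'" for x y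
  proof -
    have "dpart (y \<union> singles T')" using that(2) by (auto simp: qset_def dparts_def intro!: dpart_Un)
    then have "x \<preceq> y" "y \<preceq> x" using iff that coarser_refl by metis+
    then show ?thesis using coarser_antisym that(1,2) by (auto simp: qset_def dparts_def)
  qed
  then show "inj_on (\<lambda>y. y \<union> singles T') (qset (T - T'))" by (auto intro!: inj_onI)
  fix x y assume xy: "x \<in> qset (T - T')" "y \<in> qset (T - T')"
  have "dpart (x \<union> singles T')" "dpart (y \<union> singles T')" "dpart x" "dpart y"
    using xy by (auto simp: qset_def dparts_def intro!: dpart_Un)
  then show "x \<union> singles T' \<lless> y \<union> singles T' \<longleftrightarrow> x \<lless> y"
    using iff[OF xy] inj[OF xy] by (auto simp: scoarser_def)
qed

text \<open>
  A point \<open>w\<close> other than a partition into singletons: the part of the link above \<open>w\<close> contracts to the partitions that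
  contain all blocks of \<open>w\<close>.
\<close>

lemma acyclic_link:
  assumes T: "finite T" and w: "w \<in> rset T" "supp w \<noteq> T" "w \<noteq> singles (supp w)"
  shows "dp.acyclic ({y \<in> rset T. y \<lless> w} \<union> {y \<in> qset T. w \<lless> y})"
proof -
  let ?A = "{y \<in> rset T. y \<lless> w}" and ?B = "{y \<in> qset T. w \<lless> y}"
  let ?f = "\<lambda>y. if y \<in> ?A then y else w \<union> off (supp w) y"
  let ?m = "w \<union> singles (T - supp w)"
  have dw: "dpart w" "supp w \<subset> T" using w by (auto simp: rset_def)
  have B: "dpart y" "supp y = T" "w \<preceq> y" "y \<notin> ?A" "dpart (off (supp w) y)" "supp (off (supp w) y) = T - supp w"
    if "y \<in> ?B" for y
  proof -
    show *: "dpart y" "supp y = T" "w \<preceq> y" using that by (auto simp: qset_def dparts_def scoarser_def)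
    show "y \<notin> ?A" using that dp.asym by blast
    show "dpart (off (supp w) y)" using dpart_off[OF *(1)] .
    show "supp (off (supp w) y) = T - supp w" using off_supp[OF *(3,1)] *(2) by simp
  qed
  have inB: "w \<union> x \<in> ?B" if x: "dpart x" "supp x = T - supp w" for x
  proof -
    have d: "dpart (w \<union> x)" "supp (w \<union> x) = T" using dpart_Un[OF dw(1) x(1)] x dw by auto
    \<comment> \<open>This fails for a partition \<open>w\<close> into singletons: with all points
      off \<open>supp w\<close> split as well, the removed top element arises.\<close>
    have "w \<union> x \<noteq> singles T"
    proof
      assume "w \<union> x = singles T"
      then have "off (supp x) (w \<union> x) = off (supp x) (singles T)" by simp
      moreover have "off (supp x) (w \<union> x) = w"
        unfolding off_Un using off_disjoint[OF dw(1), of "supp x"] off_inside[OF x(1)] x(2) by auto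
      moreover have "T - supp x = supp w" using x(2) dw(2) by auto
      then have "off (supp x) (singles T) = singles (supp w)" by (simp add: off_singles)
      ultimately show False using w(3) by simp
    qed
    moreover have "w \<preceq> w \<union> x"
      using coarser_Un_iff[of w w "supp w" "{}" x "supp x"] x dw by auto
    moreover have "w \<noteq> w \<union> x" using d(2) w(2) by metis
    ultimately show ?thesis using d dw(1) by (simp add: qset_def dparts_def scoarser_def)
  qed
  have fB: "w \<union> off (supp w) y \<in> ?B" if "y \<in> ?B" for y using inB[OF B(5,6)[OF that]] .
  have m: "?m \<in> ?B" by (rule inB) auto
  have fm: "w \<union> off (supp w) y \<preceq> ?m" if y: "y \<in> ?B" for y
    using coarser_Un_iff[of w w "supp w" "off (supp w) y" "singles (T - supp w)" "T - supp w"] B(5,6)[OF y] dw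
    by (simp add: coarser_singles)
  show ?thesis
  proof (rule dp.acyclic_closure[of _ ?f])
    have "?A \<union> ?B \<subseteq> {x. dpart x \<and> supp x \<subseteq> T}" by (auto simp: rset_def qset_def dparts_def)
    then show "finite (?A \<union> ?B)" using finite_dparts_subset[OF T] finite_subset by blast
    show "dp.acyclic (?f ` (?A \<union> ?B))"
    proof (rule dp.acyclic_cone[of ?m])
      have o: "off (supp w) ?m = singles (T - supp w)"
        using off_inside[OF dw(1) order_refl] by (simp add: off_Un off_singles)
      have fmm: "?f ?m = ?m" by (simp only: o if_cancel)
      show "?m \<in> ?f ` (?A \<union> ?B)" by (rule image_eqI[of _ _ ?m]) (use fmm m in auto)
      fix x assume "x \<in> ?f ` (?A \<union> ?B)"
      then consider "x \<in> ?A" | y where "y \<in> ?B" "x = w \<union> off (supp w) y" by (auto split: if_splits)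
      then show "x = ?m \<or> x \<lless> ?m \<or> ?m \<lless> x"
      proof cases
        case 1
        then show ?thesis using m dp.trans[of x w ?m] by blast
      next
        case 2
        then show ?thesis
          using fm[OF 2(1)] B(1)[OF m] B(1)[OF fB[OF 2(1)]] by (simp add: scoarser_def)
      qed
    qed
    show "?f x \<in> ?A \<union> ?B" if "x \<in> ?A \<union> ?B" for x
    proof (cases "x \<in> ?A")
      case False
      then have x: "x \<in> ?B" using that by blast
      show ?thesis unfolding if_not_P[OF False] using fB[OF x] by (rule UnI2)
    qed simp
    show "?f (?f x) = ?f x" if "x \<in> ?A \<union> ?B" for x
    proof (cases "x \<in> ?A")
      case False
      then have x: "x \<in> ?B" using that by blast
      show ?thesis
        unfolding if_not_P[OF False] if_not_P[OF B(4)[OF fB[OF x]]] off_Un_off[OF dw(1)] ..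
    qed simp
    show "?f x = x \<or> ?f x \<lless> x" if "x \<in> ?A \<union> ?B" for x
    proof (cases "x \<in> ?A")
      case False
      then have x: "x \<in> ?B" using that by blast
      show ?thesis
        using False Un_off_coarser[OF B(3,1)[OF x]] B(1)[OF fB[OF x]] B(1)[OF x] by (simp add: scoarser_def)
    qed simp
    fix x y assume x: "x \<in> ?A \<union> ?B" and y: "y \<in> ?A \<union> ?B" and xy: "x \<lless> y"
    show "?f x = ?f y \<or> ?f x \<lless> ?f y"
    proof (cases "y \<in> ?A")
      case True
      then have "x \<in> ?A" using x xy B(4)[of x] dp.trans[of x y w] dp.trans[of w x w] dp.irrefl by blast
      then show ?thesis using xy unfolding if_P[OF True] by simp
    next
      case False
      then have yB: "y \<in> ?B" using y by blast
      show ?thesis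
      proof (cases "x \<in> ?A")
        case True
        then have "x \<lless> w \<union> off (supp w) y" using fB[OF yB] dp.trans[of x w] by blast
        then show ?thesis unfolding if_P[OF True] if_not_P[OF False] by (rule disjI2)
      next
        case xA: False
        then have xB: "x \<in> ?B" using x by blast
        have "off (supp w) x \<preceq> off (supp w) y" by (rule off_mono) (use xy in \<open>auto simp: scoarser_def\<close>)
        then have "w \<union> off (supp w) x \<preceq> w \<union> off (supp w) y"
          using coarser_Un_iff[of w w "supp w" "off (supp w) x" "off (supp w) y" "T - supp w"]
            B(5,6)[OF xB] B(5,6)[OF yB] dw by simp
        then show ?thesis
          unfolding if_not_P[OF xA] if_not_P[OF False]
          using B(1)[OF fB[OF xB]] B(1)[OF fB[OF yB]] by (simp add: scoarser_def)
      qed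
    qed
  qed
qed

text \<open>Starting with \<open>qset T\<close>, the partitions \<open>w\<close> of smaller support
  are added from the bottom upwards. The link of \<open>w\<close> is then the join of everything in
  \<open>rset T\<close> below \<open>w\<close> with the part of \<open>qset T\<close> above it. It
  is acyclic unless \<open>w\<close> is some \<open>singles T'\<close>, and then it is the join of
  \<open>rset T'\<close> with a copy of \<open>qset (T - T')\<close>.\<close>

lemma rset_step:
  assumes T: "finite T" "T \<noteq> {}" "s \<notin> T"
    and R: "\<And>T'. T' \<subset> T \<Longrightarrow> T' \<noteq> {} \<Longrightarrow> dp.spherical (rset T') (card T' - 1) (ltrees s T') rchain"
    and Q: "\<And>T'. T' \<subseteq> T \<Longrightarrow> T' \<noteq> {} \<Longrightarrow> dp.spherical (qset T') (card T' - 1) (trees T') qchain"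
  shows "dp.spherical (rset T) (card T - 1) (ltrees s T) rchain"
proof -
  let ?W = "{x \<in> rset T. supp x \<noteq> T}"
  define J where "J T' = {Node u v | u v. u \<in> ltrees s T' \<and> v \<in> trees (T - T')}" for T'
  define I where "I E = (\<Union>T'\<in>{T'. T' \<subset> T \<and> (T' = {} \<or> singles T' \<in> E)}. J T')" for E
  \<comment> \<open>Reversing the order turns the induction from the top downwards into one from the
    bottom upwards.\<close>
  interpret op: strict_poset K "\<lambda>x y :: 'a dpart. y \<lless> x"
    by unfold_locales (use dp.irrefl dp.trans in auto)
  have sT: "s \<notin> T'" if "T' \<subset> T" for T' using T that by blast
  have qT: "qset T = {x \<in> rset T. supp x = T}" using T(2) by (auto simp: qset_def rset_def dparts_def)
  have "finite ?W" using finite_rset[OF T(1)] by simp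
  then have "dp.spherical (qset T \<union> ?W) (card T - 1) (I ?W) rchain"
  proof (induction rule: op.finite_upset_induct)
    case empty
    \<comment> \<open>The trees for \<open>T' = {}\<close> are the \<open>Node (Tip s) v\<close>,
      and \<open>rchain\<close> of such a tree is \<open>qchain v\<close>.\<close>
    have bij: "bij_betw (\<lambda>t. case t of Node u v \<Rightarrow> v | Tip a \<Rightarrow> Tip a) (J {}) (trees T)"
      by (rule bij_betw_byWitness[of _ "Node (Tip s)"]) (auto simp: J_def ltrees_empty)
    have "I {} = J {}" using T(2) by (auto simp: I_def)
    moreover have "dp.spherical (qset T) (card T - 1) (J {}) rchain"
    proof (rule dp.spherical_reindex[OF Q[OF order_refl T(2)] bij])
      fix t assume "t \<in> J {}"
      then obtain v where "t = Node (Tip s) v" by (auto simp: J_def ltrees_empty)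
      then show "rchain t = qchain (case t of Node u v \<Rightarrow> v | Tip a \<Rightarrow> Tip a)"
        by (simp add: qchain_def rest_def singles_def)
    qed
    ultimately show ?case by simp
  next
    case (insert E w)
    let ?X = "qset T \<union> E"
    have w: "w \<in> rset T" "supp w \<noteq> T" "dpart w" "w \<noteq> {}" "supp w \<subset> T" using insert(2) by (auto simp: rset_def)
    have sw: "supp w \<noteq> {}" using dpart_supp_empty[OF w(3)] w(4) by simp
    have new: "w \<notin> ?X" using insert(3) w(2) by (auto simp: qT)
    have cw: "0 < card (supp w)" "card (supp w) < card T"
      using sw w(5) T(1) finite_subset[of "supp w" T] psubset_card_mono[of T "supp w"] by (auto simp: card_gt_0_iff)
    define n where "n = card T - 2"
    have n: "card T - 1 = Suc n" using cw by (simp add: n_def)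
    have link: "dp.link ?X w = {y \<in> rset T. y \<lless> w} \<union> {y \<in> qset T. w \<lless> y}"
    proof (intro equalityI subsetI)
      fix y assume "y \<in> dp.link ?X w"
      then have "y \<in> ?X" "y \<lless> w \<or> w \<lless> y" by (auto simp: dp.link_def)
      then show "y \<in> {y \<in> rset T. y \<lless> w} \<union> {y \<in> qset T. w \<lless> y}" using insert(1,5) qT by blast
    next
      fix y assume "y \<in> {y \<in> rset T. y \<lless> w} \<union> {y \<in> qset T. w \<lless> y}"
      then show "y \<in> dp.link ?X w"
      proof
        assume y: "y \<in> {y \<in> rset T. y \<lless> w}"
        then have "supp y \<subseteq> supp w" using coarser_supp[of y w] by (auto simp: scoarser_def)
        then have "y \<in> ?W" using y w(5) by auto
        then show ?thesis using insert(4) y by (auto simp: dp.link_def)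
      qed (simp add: dp.link_def)
    qed
    have IH: "dp.spherical ?X (Suc n) (I E) rchain" using insert.IH unfolding n .
    show ?case
    proof (cases "w = singles (supp w)")
      case False
      \<comment> \<open>A chain of the link becomes a chain of \<open>rset T\<close> longer by one
        when \<open>w\<close> is inserted.\<close>
      have dim: "m \<le> n" if xs: "xs \<in> dp.simplices (dp.link ?X w) m" for xs m
      proof -
        obtain p q where "p @ w # q \<in> dp.simplices (Set.insert w ?X) (Suc m)"
          using dp.simplices_link_split[OF xs] by metis
        moreover have "Set.insert w ?X \<subseteq> rset T" using w(1) insert(1) qT by auto
        ultimately have "p @ w # q \<in> dp.simplices (rset T) (Suc m)" by (auto simp: dp.simplices_def)
        then show ?thesis using rset_simplices_length[OF T(1)] n by fastforce
      qed
      have "dp.spherical (dp.link ?X w) n {} rchain"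
        by (rule dp.spherical_acyclic[OF _ dim]) (simp add: link acyclic_link[OF T(1) w(1,2) False])
      then have "dp.spherical (Set.insert w ?X) (Suc n) (I E \<union> {}) rchain"
        using IH new by (intro dp.spherical_insert) auto
      moreover have "I (Set.insert w E) = I E" using False by (auto simp: I_def)
      ultimately show ?thesis unfolding n by simp
    next
      case True
      define T' where "T' = supp w"
      have T': "T' \<subset> T" "T' \<noteq> {}" "w = singles T'" using w(5) sw True by (simp_all add: T'_def)
      have TT: "T - T' \<noteq> {}" using T' by blast
      let ?A = "{y \<in> rset T. y \<lless> w}" and ?B = "{y \<in> qset T. w \<lless> y}"
      have A: "dp.spherical ?A (card T' - 1) (ltrees s T') rchain"
        unfolding T'(3) rset_below_singles[OF T'(1)] by (rule R[OF T'(1,2)])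
      have B: "dp.spherical ?B (card (T - T') - 1) (trees (T - T')) (\<lambda>v. map (\<lambda>y. y \<union> singles T') (qchain v))"
        unfolding T'(3) by (rule spherical_above_singles[OF T'(1) Q[OF _ TT]]) blast
      have "dp.spherical (?A \<union> ?B) ((card T' - 1) + (card (T - T') - 1)) (ltrees s T' \<times> trees (T - T'))
          (\<lambda>(u, v). rchain u @ map (\<lambda>y. y \<union> singles T') (qchain v))"
        by (rule dp.spherical_join[OF _ A B]) (auto intro: dp.trans)
      moreover have "(card T' - 1) + (card (T - T') - 1) = n"
      proof -
        have fT: "finite T'" using T'(1) T(1) finite_subset by blast
        have "card (T - T') = card T - card T'" using T'(1) fT by (intro card_Diff_subset) auto
        then show ?thesis using cw unfolding T'_def[symmetric] n_def by simp
      qed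
      ultimately have AB: "dp.spherical (dp.link ?X w) n (ltrees s T' \<times> trees (T - T'))
          (\<lambda>(u, v). rchain u @ map (\<lambda>y. y \<union> singles T') (qchain v))"
        by (simp add: link)
      let ?g = "\<lambda>t. case t of Node u v \<Rightarrow> (u, v) | Tip a \<Rightarrow> (Tip a, Tip a)"
      let ?e = "\<lambda>t. case t of Node u v \<Rightarrow> rchain u @ map (\<lambda>y. y \<union> singles T') (qchain v) | Tip a \<Rightarrow> []"
      have bij: "bij_betw ?g (J T') (ltrees s T' \<times> trees (T - T'))"
        by (rule bij_betw_byWitness[of _ "\<lambda>(u, v). Node u v"]) (auto simp: J_def)
      have L: "dp.spherical (dp.link ?X w) n (J T') ?e"
        by (rule dp.spherical_reindex[OF AB bij]) (auto simp: J_def)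
      have "dp.spherical (Set.insert w ?X) (Suc n) (I E \<union> J T') rchain"
      proof (rule dp.spherical_insert[OF new _ L])
        show "dp.spherical ?X (Suc n) (I E) rchain" by (rule IH)
        have "T'' = T'" if "T'' \<subset> T" "u \<in> ltrees s T''" "u \<in> ltrees s T'" for u T''
          using ltrees_rest[OF that(2) sT[OF that(1)]] ltrees_rest[OF that(3) sT[OF T'(1)]] by simp
        moreover have "singles T' \<notin> E" using insert(3) T'(3) by simp
        ultimately show "I E \<inter> J T' = {}" using T'(2) unfolding I_def J_def by blast
        fix t assume "t \<in> J T'"
        then obtain u v where t: "t = Node u v" "u \<in> ltrees s T'" "v \<in> trees (T - T')" by (auto simp: J_def)
        have r: "rest u = T'" by (rule ltrees_rest[OF t(2) sT[OF T'(1)]])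
        have "u \<noteq> Tip a" for a using t(2) T'(2) sT[OF T'(1)] by (auto simp: ltrees_def)
        then obtain u1 u2 where "u = Node u1 u2" by (cases u) auto
        \<comment> \<open>The definition of \<open>rchain\<close> is made for this: \<open>w\<close>
          sits between a chain of \<open>rset T'\<close> and the lifted chain of
          \<open>v\<close>.\<close>
        then have "rchain t = rchain u @ w # map (\<lambda>y. y \<union> singles T') (qchain v)"
          using r by (simp add: t(1) qchain_def T'(3) del: rchain.simps(2)) (simp add: r)
        moreover have "\<forall>y\<in>set (rchain u). y \<lless> w"
          using dp.sphericalD(4)[OF A t(2)] by (auto simp: dp.simplices_def)
        moreover have "\<forall>y\<in>set (map (\<lambda>y. y \<union> singles T') (qchain v)). w \<lless> y"
          using dp.sphericalD(4)[OF B t(3)] by (auto simp: dp.simplices_def)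
        ultimately show "\<exists>p q. ?e t = p @ q \<and> rchain t = p @ w # q \<and> (\<forall>y\<in>set p. y \<lless> w) \<and> (\<forall>y\<in>set q. w \<lless> y)"
          unfolding t(1) planar_tree.case by blast
      qed
      moreover have "I (Set.insert w E) = I E \<union> J T'"
        using T' by (auto simp: I_def singles_inj)
      ultimately show ?thesis unfolding n by simp
    qed
  qed
  moreover have "qset T \<union> ?W = rset T" by (auto simp: qT)
  moreover have "I ?W = ltrees s T"
  proof -
    have "singles T' \<in> ?W" if "T' \<subset> T" "T' \<noteq> {}" for T'
    proof -
      have "singles T' \<noteq> singles T" using that by (simp add: singles_inj psubset_imp_subset)
      moreover have "singles T' \<noteq> {}" using that by (simp add: singles_def)
      ultimately show ?thesis using that by (auto simp: rset_def)
    qed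
    then have "I ?W = (\<Union>T'\<in>{T'. T' \<subset> T}. J T')" unfolding I_def by blast
    also have "\<dots> = ltrees s T"
    proof (intro equalityI subsetI)
      fix t assume "t \<in> (\<Union>T'\<in>{T'. T' \<subset> T}. J T')"
      then obtain T' u v where "T' \<subset> T" "u \<in> ltrees s T'" "v \<in> trees (T - T')" "t = Node u v" unfolding J_def by blast
      then show "t \<in> ltrees s T" using Node_ltrees[OF T(3), of u v] by blast
    next
      fix t assume t: "t \<in> ltrees s T"
      show "t \<in> (\<Union>T'\<in>{T'. T' \<subset> T}. J T')"
      proof (cases t)
        case (Tip a)
        have "set (leaves t) = insert s T" "hd (leaves t) = s" using t unfolding ltrees_def by simp_all
        then have "insert s T = {s}" unfolding Tip leaves.simps by simp
        then have "T \<subseteq> {s}" by (metis subset_insertI)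
        then have "T = {}" using T(3) by (auto simp: subset_singleton_iff)
        then show ?thesis using T(2) by simp
      next
        case (Node u v)
        from t[unfolded Node Node_ltrees[OF T(3)]] obtain T'
          where T': "T' \<subset> T" "u \<in> ltrees s T'" "v \<in> trees (T - T')" by metis
        then have "t \<in> J T'" unfolding J_def Node by blast
        with T'(1) show ?thesis by (intro UN_I[of T']) simp_all
      qed
    qed
    finally show ?thesis .
  qed
  ultimately show ?thesis by simp
qed

text \<open>One induction for both families: \<open>qset N\<close> uses \<open>rset\<close> on one
  point less, while \<open>rset N\<close> uses \<open>qset\<close> on all nonempty subsets of
  \<open>N\<close>, including \<open>N\<close> itself. Hence \<open>qset\<close> comes first in each
  step.\<close>

theorem spherical_decorated_partitions:
  assumes "finite N" "N \<noteq> {}"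
  shows "dp.spherical (qset N) (card N - 1) (trees N) qchain"
    and "s \<notin> N \<Longrightarrow> dp.spherical (rset N) (card N - 1) (ltrees s N) rchain"
proof -
  have "dp.spherical (qset N) (card N - 1) (trees N) qchain
      \<and> (\<forall>s. s \<notin> N \<longrightarrow> dp.spherical (rset N) (card N - 1) (ltrees s N) rchain)"
    using assms
  proof (induction "card N" arbitrary: N rule: less_induct)
    case less
    have smaller: "card M < card N" "finite M" if "M \<subset> N" for M
      using that less.prems(1) psubset_card_mono finite_subset by blast+
    have Q: "dp.spherical (qset N) (card N - 1) (trees N) qchain"
    \<comment> \<open>For one point the poset is empty; its only coordinate is at the empty chain,
      attached to the tree with one leaf.\<close>
    proof (cases "card N = 1")
      case True
      then obtain a where N: "N = {a}" by (auto simp: card_1_singleton_iff)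
      have "qset N = {}"
      proof -
        have "card x \<in> {1..<card N}" if "x \<in> qset N" for x
          using rset_card[OF less.prems(1)] qset_subset_rset[OF less.prems(2)] that by blast
        then show ?thesis using True by auto
      qed
      moreover have "trees N = {Tip a}"
        by (simp add: trees_Union N ltrees_empty)
      ultimately show ?thesis
        using dp.spherical_empty[of qchain "Tip a"] N by (simp add: qchain_Tip)
    next
      case False
      then have c: "2 \<le> card N" using less.prems by (metis One_nat_def card_0_eq less_2_cases not_le)
      show ?thesis
      proof (rule qset_step[OF less.prems(1) c])
        fix s assume s: "s \<in> N"
        have "N - {s} \<subset> N" using s by blast
        moreover have "N - {s} \<noteq> {}" using c s by (metis card.empty card_Suc_Diff1 card.infinite less.prems(1) not_less_eq_eq numeral_2_eq_2 order_refl)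
        ultimately have "dp.spherical (rset (N - {s})) (card (N - {s}) - 1) (ltrees s (N - {s})) rchain"
          using less.hyps[of "N - {s}"] smaller[of "N - {s}"] by blast
        then show "dp.spherical (rset (N - {s})) (card N - 2) (ltrees s (N - {s})) rchain"
          using s less.prems(1) by (simp add: numeral_2_eq_2)
      qed
    qed
    moreover have "dp.spherical (rset N) (card N - 1) (ltrees s N) rchain" if "s \<notin> N" for s
    proof (rule rset_step[OF less.prems that])
      fix T' assume "T' \<subset> N" "T' \<noteq> {}"
      then show "dp.spherical (rset T') (card T' - 1) (ltrees s T') rchain"
        using less.hyps[of T'] smaller[of T'] that by blast
    next
      fix T' assume T': "T' \<subseteq> N" "T' \<noteq> {}"
      show "dp.spherical (qset T') (card T' - 1) (trees T') qchain"
      proof (cases "T' = N")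
        case False
        then show ?thesis using less.hyps[of T'] smaller[of T'] T' by blast
      qed (use Q in simp)
    qed
    ultimately show ?case by blast
  qed
  then show "dp.spherical (qset N) (card N - 1) (trees N) qchain"
    "s \<notin> N \<Longrightarrow> dp.spherical (rset N) (card N - 1) (ltrees s N) rchain" by blast+
qed

end

section \<open>Return to the given posets and the Cohen-Macaulay property\<close>

section \<open>Decoding\<close>

definition encode :: "'a decorated_partition \<Rightarrow> 'a dpart" where
  "encode = (\<lambda>(\<pi>, p). (\<lambda>B. (B, p B)) ` \<pi>)"

text \<open>The empty set decodes to the adjoined least element. For empty \<open>N\<close> it would
  have to be the empty partition as well, which is why decoding is compared with the given poset
  under \<open>N \<noteq> {}\<close>.\<close>

definition decode :: "'a dpart \<Rightarrow> 'a decorated_partition option" where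
  "decode x = (if x = {} then None
     else Some (fst ` x, restrict (\<lambda>B. THE S. (B, S) \<in> x) (fst ` x)))"

definition dparts0 :: "'a set \<Rightarrow> 'a dpart set" where
  "dparts0 N = insert {} (dparts N)"

lemma partition_on_unique:
  "partition_on N \<pi> \<Longrightarrow> a \<in> B \<Longrightarrow> a \<in> C \<Longrightarrow> B \<in> \<pi> \<Longrightarrow> C \<in> \<pi> \<Longrightarrow> B = C"
  by (auto simp: partition_on_def disjoint_def)

lemma Pi_CTAD:
  assumes "(\<pi>, p) \<in> Pi_CTA N"
  shows "partition_on N \<pi>" "\<And>B. B \<in> \<pi> \<Longrightarrow> p B \<noteq> {} \<and> p B \<subseteq> B" "p \<in> extensional \<pi>"
  using assms by (auto simp: Pi_CTA_def ComTriAss_def PiE_def Pi_def)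

lemma in_encode: "(B, S) \<in> encode (\<pi>, p) \<longleftrightarrow> B \<in> \<pi> \<and> S = p B"
  by (auto simp: encode_def)

lemma encode_in_dparts:
  assumes "(\<pi>, p) \<in> Pi_CTA N"
  shows "encode (\<pi>, p) \<in> dparts N"
proof -
  note D = Pi_CTAD[OF assms]
  have "dpart (encode (\<pi>, p))"
  proof (rule dpartI)
    fix B S assume "(B, S) \<in> encode (\<pi>, p)"
    then show "S \<noteq> {} \<and> S \<subseteq> B" using D(2) by (simp add: in_encode)
  next
    fix B S C R a assume "(B, S) \<in> encode (\<pi>, p)" "(C, R) \<in> encode (\<pi>, p)" "a \<in> B" "a \<in> C"
    then show "B = C \<and> S = R" using partition_on_unique[OF D(1), of a B C] by (simp add: in_encode)
  qed
  moreover have "supp (encode (\<pi>, p)) = N"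
    using partition_onD1[OF D(1)] by (auto simp: supp_def encode_def image_image)
  ultimately show ?thesis by (simp add: dparts_def)
qed

lemma decode_eq:
  assumes x: "dpart x" "x \<noteq> {}"
  shows "decode x = Some (fst ` x, restrict (\<lambda>B. THE S. (B, S) \<in> x) (fst ` x))"
  by (simp add: decode_def x)

lemma the_dec:
  assumes "dpart x" "(B, S) \<in> x"
  shows "(THE S. (B, S) \<in> x) = S"
proof (rule the_equality)
  show "(B, S) \<in> x" by (rule assms(2))
  fix R assume "(B, R) \<in> x"
  moreover obtain a where "a \<in> B" using dpartD(3)[OF assms] by blast
  ultimately show "R = S" using dpart_unique[OF assms(1) _ assms(2)] by blast
qed

lemma decode_Some_in:
  assumes x: "x \<in> dparts N" "x \<noteq> {}"
  shows "\<exists>\<pi> p. decode x = Some (\<pi>, p) \<and> (\<pi>, p) \<in> Pi_CTA N \<and> encode (\<pi>, p) = x"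
proof -
  have d: "dpart x" "supp x = N" using x by (auto simp: dparts_def)
  let ?p = "restrict (\<lambda>B. THE S. (B, S) \<in> x) (fst ` x)"
  have p: "?p B = S" if "(B, S) \<in> x" for B S
    using the_dec[OF d(1) that] that by (force simp: restrict_def)
  have "partition_on N (fst ` x)"
  proof (rule partition_onI)
    show "\<Union> (fst ` x) = N" using d(2) by (simp add: supp_def)
    fix B C assume "B \<in> fst ` x" "C \<in> fst ` x" "B \<noteq> C"
    then obtain S R where SR: "(B, S) \<in> x" "(C, R) \<in> x" by force
    have "\<not> (a \<in> B \<and> a \<in> C)" for a using dpart_unique[OF d(1) SR, of a] \<open>B \<noteq> C\<close> by metis
    then show "disjnt B C" unfolding disjnt_iff by metis
  qed (use dpartD(3)[OF d(1)] in force)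
  moreover have "?p \<in> (\<Pi>\<^sub>E B\<in>fst ` x. ComTriAss B)"
  proof (rule PiE_I)
    fix B assume "B \<in> fst ` x"
    then obtain S where S: "(B, S) \<in> x" by force
    show "?p B \<in> ComTriAss B" using p[OF S] dpartD(1,2)[OF d(1) S] by (simp add: ComTriAss_def)
  qed (simp add: restrict_def)
  ultimately have "(fst ` x, ?p) \<in> Pi_CTA N" by (simp add: Pi_CTA_def)
  moreover have "encode (fst ` x, ?p) = x"
  proof (intro equalityI subrelI)
    fix B S assume "(B, S) \<in> encode (fst ` x, ?p)"
    then have BS: "B \<in> fst ` x" "S = ?p B" by (simp_all only: in_encode)
    then obtain R where "(B, R) \<in> x" by force
    then show "(B, S) \<in> x" using p[of B R] BS(2) by simp
  next
    fix B S assume S: "(B, S) \<in> x"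
    then have "B \<in> fst ` x" by force
    then show "(B, S) \<in> encode (fst ` x, ?p)" using p[OF S] unfolding in_encode by simp
  qed
  ultimately show ?thesis using decode_eq[OF d(1) x(2)] by blast
qed

lemma decode_encode:
  assumes a: "(\<pi>, p) \<in> Pi_CTA N" and N: "N \<noteq> {}"
  shows "decode (encode (\<pi>, p)) = Some (\<pi>, p)"
proof -
  have e: "encode (\<pi>, p) \<in> dparts N" by (rule encode_in_dparts[OF a])
  then have "encode (\<pi>, p) \<noteq> {}" using N by (auto simp: dparts_def)
  then obtain \<pi>' p' where *: "decode (encode (\<pi>, p)) = Some (\<pi>', p')" "(\<pi>', p') \<in> Pi_CTA N" "encode (\<pi>', p') = encode (\<pi>, p)"
    using decode_Some_in[OF e] by blast
  have "fst ` encode (\<pi>', p') = fst ` encode (\<pi>, p)" by (simp add: *(3))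
  then have \<pi>: "\<pi>' = \<pi>" by (simp add: encode_def image_image)
  have "p' = p"
  proof (rule extensionalityI[of _ \<pi>])
    show "p' \<in> extensional \<pi>" "p \<in> extensional \<pi>" using Pi_CTAD(3)[OF a] Pi_CTAD(3)[OF *(2)] \<pi> by auto
    fix B assume "B \<in> \<pi>"
    then have "(B, p' B) \<in> encode (\<pi>, p)" unfolding *(3)[symmetric] in_encode \<pi> by simp
    then show "p' B = p B" by (simp add: in_encode)
  qed
  then show ?thesis using * \<pi> by simp
qed

lemma decode_image:
  assumes "N \<noteq> {}"
  shows "decode ` dparts0 N = Pi_CTA_plus N"
proof (intro equalityI subsetI)
  fix u assume "u \<in> decode ` dparts0 N"
  then obtain x where x: "u = decode x" "x = {} \<or> x \<in> dparts N" by (auto simp: dparts0_def)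
  then show "u \<in> Pi_CTA_plus N"
    using decode_Some_in[of x N] by (cases "x = {}") (auto simp: Pi_CTA_plus_def decode_def)
next
  fix u assume "u \<in> Pi_CTA_plus N"
  then consider "u = None" | \<pi> p where "u = Some (\<pi>, p)" "(\<pi>, p) \<in> Pi_CTA N" by (auto simp: Pi_CTA_plus_def)
  then show "u \<in> decode ` dparts0 N"
  proof cases
    case 1
    then show ?thesis by (intro image_eqI[of _ _ "{}"]) (auto simp: decode_def dparts0_def)
  next
    case 2
    then show ?thesis using decode_encode[OF 2(2) assms] encode_in_dparts[OF 2(2)]
      by (intro image_eqI[of _ _ "encode (\<pi>, p)"]) (auto simp: dparts0_def)
  qed
qed

lemma decode_None_iff: "decode x = None \<longleftrightarrow> x = {}"
  by (simp add: decode_def)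

lemma decode_inj: "inj_on decode (dparts0 N)"
proof (rule inj_onI)
  fix x y assume x: "x \<in> dparts0 N" and y: "y \<in> dparts0 N" and eq: "decode x = decode y"
  show "x = y"
  proof (cases "x = {}")
    case True
    then show ?thesis using eq decode_None_iff by metis
  next
    case False
    then have "y \<noteq> {}" using eq decode_None_iff by metis
    then show ?thesis
      using decode_Some_in[of x N] decode_Some_in[of y N] x y eq False by (auto simp: dparts0_def)
  qed
qed

text \<open>From left to right, disjointness of the blocks makes \<open>q C \<inter> D\<close> equal
  to \<open>p D\<close> or empty, according to whether \<open>r\<close> contains \<open>D\<close>.
  From right to left, \<open>r\<close> consists of the blocks inside \<open>C\<close> that
  \<open>q C\<close> meets.\<close>

lemma Pi_CTA_order_iff:
  assumes a: "(\<sigma>, q) \<in> Pi_CTA N" and b: "(\<pi>, p) \<in> Pi_CTA N"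
  shows "((\<sigma>, q), (\<pi>, p)) \<in> Pi_CTA_order N \<longleftrightarrow> encode (\<sigma>, q) \<preceq> encode (\<pi>, p)"
proof -
  note A = Pi_CTAD[OF a] and B = Pi_CTAD[OF b]
  have supp: "supp (encode (\<sigma>, q)) = N" "supp (encode (\<pi>, p)) = N"
    using encode_in_dparts[OF a] encode_in_dparts[OF b] by (auto simp: dparts_def)
  have dis: "a \<in> C \<Longrightarrow> a \<in> C' \<Longrightarrow> C \<in> \<pi> \<Longrightarrow> C' \<in> \<pi> \<Longrightarrow> C = C'" for a C C'
    by (rule partition_on_unique[OF B(1)])
  have disA: "a \<in> C \<Longrightarrow> a \<in> C' \<Longrightarrow> C \<in> \<sigma> \<Longrightarrow> C' \<in> \<sigma> \<Longrightarrow> C = C'" for a C C'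
    by (rule partition_on_unique[OF A(1)])
  have sub: "C \<subseteq> N" "C \<noteq> {}" if "C \<in> \<pi>" for C
    using that partition_onD1[OF B(1)] partition_onD3[OF B(1)] by auto
  show ?thesis
  proof
    assume L: "((\<sigma>, q), (\<pi>, p)) \<in> Pi_CTA_order N"
    then have ref: "refines N \<pi> \<sigma>" and r: "\<And>C. C \<in> \<sigma> \<Longrightarrow> \<exists>r\<in>ComTriAss {B \<in> \<pi>. B \<subseteq> C}. q C = ComTriAss_comp r p"
      by (auto simp: Pi_CTA_order_def)
    show "encode (\<sigma>, q) \<preceq> encode (\<pi>, p)"
      unfolding coarser_def
    proof (intro conjI allI impI disjI2)
      show "supp (encode (\<sigma>, q)) \<subseteq> supp (encode (\<pi>, p))" by (simp add: supp)
      fix D S assume "(D, S) \<in> encode (\<pi>, p)"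
      then have D: "D \<in> \<pi>" "S = p D" by (auto simp: in_encode)
      then obtain C where C: "C \<in> \<sigma>" "D \<subseteq> C" using ref by (auto simp: refines_def)
      obtain r where r: "r \<subseteq> {B \<in> \<pi>. B \<subseteq> C}" "q C = (\<Union>B\<in>r. p B)"
        using r[OF C(1)] by (auto simp: ComTriAss_def ComTriAss_comp_def)
      have "q C \<inter> D = (if D \<in> r then p D else {})"
      proof -
        have "p B' \<inter> D = {}" if "B' \<in> r" "B' \<noteq> D" for B'
          using B(2)[of B'] r(1) that dis[of _ B' D] D(1) by blast
        moreover have "p D \<subseteq> D" using B(2)[OF D(1)] by simp
        ultimately show ?thesis unfolding r(2) by auto
      qed
      then show "\<exists>A Q. (A, Q) \<in> encode (\<sigma>, q) \<and> D \<subseteq> A \<and> (Q \<inter> D = {} \<or> Q \<inter> D = S)"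
        using C D by (intro exI[of _ C] exI[of _ "q C"]) (auto simp: in_encode)
    qed
  next
    assume R: "encode (\<sigma>, q) \<preceq> encode (\<pi>, p)"
    have ex: "\<exists>C\<in>\<sigma>. D \<subseteq> C \<and> (q C \<inter> D = {} \<or> q C \<inter> D = p D)" if D: "D \<in> \<pi>" for D
    proof -
      have "(D, p D) \<in> encode (\<pi>, p)" "D \<inter> supp (encode (\<sigma>, q)) \<noteq> {}"
        using D sub[OF D] supp by (auto simp: in_encode)
      then obtain C Q where C: "(C, Q) \<in> encode (\<sigma>, q)" "D \<subseteq> C" "Q \<inter> D = {} \<or> Q \<inter> D = p D"
        using coarserE[OF R] by metis
      then have "C \<in> \<sigma>" "Q = q C" by (simp_all add: in_encode)
      then show ?thesis using C by blast
    qed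
    then have "refines N \<pi> \<sigma>" using A(1) B(1) unfolding refines_def by blast
    moreover have "\<exists>r\<in>ComTriAss {B \<in> \<pi>. B \<subseteq> C}. q C = ComTriAss_comp r p" if C: "C \<in> \<sigma>" for C
    proof -
      let ?r = "{D \<in> \<pi>. D \<subseteq> C \<and> q C \<inter> D \<noteq> {}}"
      have in_r: "\<exists>D\<in>?r. a \<in> p D" if a: "a \<in> q C" for a
      proof -
        have aC: "a \<in> C" using A(2)[OF C] a by blast
        then have "a \<in> N" using partition_onD1[OF A(1)] C by blast
        then obtain D where D: "D \<in> \<pi>" "a \<in> D" using partition_onD1[OF B(1)] by blast
        then obtain C' where C': "C' \<in> \<sigma>" "D \<subseteq> C'" "q C' \<inter> D = {} \<or> q C' \<inter> D = p D" using ex by blast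
        have "C' = C" using disA[of a C' C] C'(1,2) D(2) aC C by blast
        then have "D \<subseteq> C" "q C \<inter> D = p D" using C' a D by auto
        then show ?thesis using D a by blast
      qed
      have "p D \<subseteq> q C" if D: "D \<in> ?r" for D
      proof -
        obtain C' where C': "C' \<in> \<sigma>" "D \<subseteq> C'" "q C' \<inter> D = {} \<or> q C' \<inter> D = p D" using ex D by blast
        obtain a where "a \<in> D" using sub(2)[of D] D by blast
        then have "C' = C" using disA[of a C' C] C' C D by blast
        then show ?thesis using C'(3) D by blast
      qed
      then have "(\<Union>B\<in>?r. p B) \<subseteq> q C" by (rule UN_least)
      moreover have "q C \<subseteq> (\<Union>B\<in>?r. p B)" using in_r by (simp only: subset_iff UN_iff) simp
      ultimately have "q C = ComTriAss_comp ?r p" by (simp only: ComTriAss_comp_def set_eq_subset)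
      moreover obtain a where "a \<in> q C" using A(2)[OF C] by blast
      then have "?r \<noteq> {}" using in_r[of a] by blast
      then have "?r \<in> ComTriAss {B \<in> \<pi>. B \<subseteq> C}" unfolding ComTriAss_def by blast
      ultimately show ?thesis by blast
    qed
    ultimately show "((\<sigma>, q), (\<pi>, p)) \<in> Pi_CTA_order N" using a b by (simp add: Pi_CTA_order_def)
  qed
qed

lemma decode_order_iff:
  assumes N: "N \<noteq> {}" and x: "x \<in> dparts0 N" and y: "y \<in> dparts0 N"
  shows "(decode x, decode y) \<in> Pi_CTA_plus_order N \<longleftrightarrow> x \<preceq> y"
proof (cases "x = {}")
  case True
  have "decode y \<in> Pi_CTA_plus N" using y decode_image[OF N] by blast
  then show ?thesis using True by (simp add: Pi_CTA_plus_order_def decode_def[of "{}"])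
next
  case x0: False
  then obtain \<sigma> q where \<sigma>: "decode x = Some (\<sigma>, q)" "(\<sigma>, q) \<in> Pi_CTA N" "encode (\<sigma>, q) = x"
    using decode_Some_in[of x N] x by (auto simp: dparts0_def)
  show ?thesis
  proof (cases "y = {}")
    case True
    have "supp x \<noteq> {}" using x x0 N by (auto simp: dparts0_def dparts_def)
    then have "\<not> x \<preceq> y" using True coarser_supp[of x y] by auto
    then show ?thesis using True \<sigma>(1) by (auto simp: Pi_CTA_plus_order_def decode_def[of "{}"])
  next
    case False
    then obtain \<pi> p where \<pi>: "decode y = Some (\<pi>, p)" "(\<pi>, p) \<in> Pi_CTA N" "encode (\<pi>, p) = y"
      using decode_Some_in[of y N] y by (auto simp: dparts0_def)
    have "(decode x, decode y) \<in> Pi_CTA_plus_order N \<longleftrightarrow> ((\<sigma>, q), (\<pi>, p)) \<in> Pi_CTA_order N"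
      unfolding Pi_CTA_plus_order_def \<sigma>(1) \<pi>(1) by auto
    then show ?thesis using Pi_CTA_order_iff[OF \<sigma>(2) \<pi>(2)] \<sigma>(3) \<pi>(3) by simp
  qed
qed

lemma Pi_CTA_plus_order_mem:
  assumes N: "N \<noteq> {}" and "(u, v) \<in> Pi_CTA_plus_order N"
  obtains x y where "x \<in> dparts0 N" "y \<in> dparts0 N" "u = decode x" "v = decode y" "x \<preceq> y"
proof -
  have "u \<in> Pi_CTA_plus N" "v \<in> Pi_CTA_plus N"
    using assms(2) by (auto simp: Pi_CTA_plus_order_def Pi_CTA_order_def Pi_CTA_plus_def)
  then obtain x y where "x \<in> dparts0 N" "y \<in> dparts0 N" "u = decode x" "v = decode y"
    unfolding decode_image[OF N, symmetric] by blast
  then show thesis using that decode_order_iff[OF N] assms(2) by metis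
qed

lemma dparts0_dpart: "x \<in> dparts0 N \<Longrightarrow> dpart x"
  by (auto simp: dparts0_def dparts_def)

lemma partial_order_Pi_CTA_plus:
  assumes N: "N \<noteq> {}"
  shows "partial_order_on (Pi_CTA_plus N) (Pi_CTA_plus_order N)"
proof -
  have "refl_on (Pi_CTA_plus N) (Pi_CTA_plus_order N)"
  proof (rule refl_onI)
    fix u assume "u \<in> Pi_CTA_plus N"
    then obtain x where x: "x \<in> dparts0 N" "u = decode x" unfolding decode_image[OF N, symmetric] by blast
    then show "(u, u) \<in> Pi_CTA_plus_order N"
      using decode_order_iff[OF N x(1) x(1)] dparts0_dpart[OF x(1)] by simp
  qed
  moreover have "Pi_CTA_plus_order N \<subseteq> Pi_CTA_plus N \<times> Pi_CTA_plus N"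
    by (auto simp: Pi_CTA_plus_order_def Pi_CTA_order_def Pi_CTA_plus_def)
  moreover have "trans (Pi_CTA_plus_order N)"
  proof (rule transI)
    fix u v w assume uv: "(u, v) \<in> Pi_CTA_plus_order N" and vw: "(v, w) \<in> Pi_CTA_plus_order N"
    obtain x y where x: "x \<in> dparts0 N" "y \<in> dparts0 N" "u = decode x" "v = decode y" "x \<preceq> y"
      using Pi_CTA_plus_order_mem[OF N uv] .
    obtain y' z where z: "y' \<in> dparts0 N" "z \<in> dparts0 N" "v = decode y'" "w = decode z" "y' \<preceq> z"
      using Pi_CTA_plus_order_mem[OF N vw] .
    have "y' = y" using inj_onD[OF decode_inj, of y' y] x z by auto
    then have "x \<preceq> z" using x z coarser_trans by blast
    then show "(u, w) \<in> Pi_CTA_plus_order N" using x z decode_order_iff[OF N] by simp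
  qed
  moreover have "antisym (Pi_CTA_plus_order N)"
  proof (rule antisymI)
    fix u v assume uv: "(u, v) \<in> Pi_CTA_plus_order N" and vu: "(v, u) \<in> Pi_CTA_plus_order N"
    obtain x y where x: "x \<in> dparts0 N" "y \<in> dparts0 N" "u = decode x" "v = decode y" "x \<preceq> y"
      using Pi_CTA_plus_order_mem[OF N uv] .
    have "y \<preceq> x" using vu x decode_order_iff[OF N] by simp
    then show "u = v" using x coarser_antisym dparts0_dpart by metis
  qed
  ultimately show ?thesis by (simp add: partial_order_on_def preorder_on_def)
qed

definition plus_less :: "'a set \<Rightarrow> 'a decorated_partition option \<Rightarrow> 'a decorated_partition option \<Rightarrow> bool" where
  "plus_less N u v \<longleftrightarrow> (u, v) \<in> Pi_CTA_plus_order N - Id"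

lemma plus_less_decode:
  assumes "N \<noteq> {}" "x \<in> dparts0 N" "y \<in> dparts0 N"
  shows "plus_less N (decode x) (decode y) \<longleftrightarrow> x \<lless> y"
  using decode_order_iff[OF assms] inj_on_eq_iff[OF decode_inj assms(2,3)] dparts0_dpart assms(2,3)
  by (auto simp: plus_less_def scoarser_def)

lemma decode_iso:
  assumes N: "N \<noteq> {}" and X: "X \<subseteq> dparts0 N"
  shows "strict_poset_iso scoarser (plus_less N) decode X"
proof -
  interpret A: strict_poset "K :: 'k::field itself" scoarser for K by (rule strict_poset_scoarser)
  have po: "trans (Pi_CTA_plus_order N)" "antisym (Pi_CTA_plus_order N)"
    using partial_order_Pi_CTA_plus[OF N] by (auto simp: partial_order_on_def preorder_on_def)
  show ?thesis
  proof
    show "\<not> plus_less N u u" for u by (simp add: plus_less_def)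
    show "plus_less N u v \<Longrightarrow> plus_less N v w \<Longrightarrow> plus_less N u w" for u v w
      using po by (auto simp: plus_less_def dest: transD antisymD)
    show "inj_on decode X" using decode_inj X inj_on_subset by blast
    show "x \<in> X \<Longrightarrow> y \<in> X \<Longrightarrow> plus_less N (decode x) (decode y) \<longleftrightarrow> x \<lless> y" for x y
      using plus_less_decode[OF N] X by blast
  qed
qed

section \<open>Reduced homology\<close>

lemma order_simplices_eq: "order_simplices X r (int n - 1) = strict_poset.simplices (\<lambda>u v. (u, v) \<in> r - Id) X n"
  if "strict_poset (\<lambda>u v. (u, v) \<in> r - Id)"
  using that by (auto simp: order_simplices_def strict_poset.simplices_def)

lemma order_simplices_neg: "d < -1 \<Longrightarrow> order_simplices X r d = {}"
  by (auto simp: order_simplices_def)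

lemma boundaries_closed:
  "0 \<in> boundaries X r d"
  "c \<in> boundaries X r d \<Longrightarrow> e \<in> boundaries X r d \<Longrightarrow> c + e \<in> boundaries X r d"
  "c \<in> boundaries X r d \<Longrightarrow> - c \<in> boundaries X r d"
proof -
  show "0 \<in> boundaries X r d" unfolding boundaries_def by (rule image_eqI[of _ _ 0]) (auto simp: free_space_def)
  show "c + e \<in> boundaries X r d" if "c \<in> boundaries X r d" "e \<in> boundaries X r d"
  proof -
    from that obtain u v where "c = boundary u" "e = boundary v"
      "Poly_Mapping.keys u \<subseteq> order_simplices X r (d + 1)" "Poly_Mapping.keys v \<subseteq> order_simplices X r (d + 1)"
      by (auto simp: boundaries_def free_space_def)
    then show ?thesis unfolding boundaries_def
      by (intro image_eqI[of _ _ "u + v"]) (auto simp: boundary_add free_space_def intro: subsetD[OF keys_add_subset])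
  qed
  show "- c \<in> boundaries X r d" if "c \<in> boundaries X r d"
  proof -
    from that obtain u where "c = boundary u" "Poly_Mapping.keys u \<subseteq> order_simplices X r (d + 1)"
      by (auto simp: boundaries_def free_space_def)
    then show ?thesis unfolding boundaries_def
      by (intro image_eqI[of _ _ "- u"]) (auto simp: boundary_uminus free_space_def)
  qed
qed

lemma carrier_reduced_homology:
  "carrier (reduced_homology X r d) = (\<lambda>c. (\<lambda>u. u + c) ` boundaries X r d) ` cycles X r d"
  by (auto simp: reduced_homology_def quotient_space_def A_RCOSETS_def' a_r_coset_def' free_space_def)

lemma reduced_homology_trivial:
  assumes "(cycles X r d :: ('b list \<Rightarrow>\<^sub>0 'k::field) set) \<subseteq> boundaries X r d"
  shows "carrier (reduced_homology X r d :: ('k::field, ('b list \<Rightarrow>\<^sub>0 'k) set) module) = {\<zero>\<^bsub>reduced_homology X r d\<^esub>}"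
proof -
  have "(\<lambda>u. u + c) ` boundaries X r d = boundaries X r d" if "c \<in> cycles X r d" for c :: "'b list \<Rightarrow>\<^sub>0 'k"
  proof -
    have c: "c \<in> boundaries X r d" using assms that by blast
    show ?thesis
    proof (intro equalityI subsetI)
      fix u :: "'b list \<Rightarrow>\<^sub>0 'k" assume "u \<in> boundaries X r d"
      then have "u + - c \<in> boundaries X r d" using boundaries_closed c by blast
      then show "u \<in> (\<lambda>u. u + c) ` boundaries X r d" by (rule image_eqI[rotated]) simp
    qed (use boundaries_closed(2) c in auto)
  qed
  moreover have "0 \<in> cycles X r d" by (simp add: cycles_def free_space_def)
  moreover have "\<zero>\<^bsub>reduced_homology X r d\<^esub> = (boundaries X r d :: ('b list \<Rightarrow>\<^sub>0 'k) set)"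
    by (simp add: reduced_homology_def quotient_space_def)
  ultimately show ?thesis unfolding carrier_reduced_homology by auto
qed

lemma cycles_subset_boundaries:
  assumes sp: "strict_poset (\<lambda>u v. (u, v) \<in> r - Id)"
    and b: "strict_poset.bounding TYPE('k::field) (\<lambda>u v. (u, v) \<in> r - Id) X n"
  shows "(cycles X r (int n - 1) :: ('b list \<Rightarrow>\<^sub>0 'k) set) \<subseteq> boundaries X r (int n - 1)"
proof
  interpret S: strict_poset "TYPE('k)" "\<lambda>u v. (u, v) \<in> r - Id" by (rule sp)
  have nxt: "order_simplices X r (int n - 1 + 1) = S.simplices X (Suc n)"
    using order_simplices_eq[OF sp, of X "Suc n"] by simp
  fix c :: "'b list \<Rightarrow>\<^sub>0 'k" assume "c \<in> cycles X r (int n - 1)"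
  then have "c \<in> S.chains X n" "boundary c = 0"
    unfolding cycles_def free_space_def S.chains_def order_simplices_eq[OF sp] by simp_all
  then obtain e where "e \<in> S.chains X (Suc n)" "boundary e = c" using b unfolding S.bounding_def by blast
  then show "c \<in> boundaries X r (int n - 1)"
    unfolding boundaries_def by (intro image_eqI[of _ _ e]) (simp_all only: nxt free_space_def S.chains_def partial_object.simps)
qed

text \<open>The rank is the number of blocks, with value 0 at \<open>None\<close>. The vanishing is
  known for intervals of encoded partitions by \<open>bounding_interval\<close> and is carried over
  by \<open>decode\<close>.\<close>

theorem cohen_macaulay_Pi_CTA_plus:
  fixes N :: "'a set"
  assumes N: "finite N" "N \<noteq> {}"
  shows "cohen_macaulay TYPE('k::field) (Pi_CTA_plus N) (Pi_CTA_plus_order N)"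
proof -
  let ?P = "Pi_CTA_plus N" and ?r = "Pi_CTA_plus_order N"
  let ?D = "dparts0 N"
  interpret I: strict_poset_iso "TYPE('k)" scoarser "plus_less N" decode ?D by (rule decode_iso[OF N(2) order_refl])
  have img: "?P = decode ` ?D" by (rule decode_image[OF N(2), symmetric])
  have less_eq: "plus_less N = (\<lambda>u v. (u, v) \<in> ?r - Id)" by (simp add: plus_less_def fun_eq_iff)
  have fin: "finite ?D" using finite_dparts[OF N(1)] by (simp add: dparts0_def)
  define rk where "rk u = card (inv_into ?D decode u)" for u
  have rk: "rk (decode x) = card x" if "x \<in> ?D" for x
    using inv_into_f_f[OF decode_inj that] by (simp add: rk_def)
  have top: "singles N \<in> ?D" "x \<preceq> singles N" if "x \<in> ?D" for x
    using that coarser_singles[of x N] by (auto simp: dparts0_def dparts_def)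
  have hb: "bounded_poset ?P ?r"
    unfolding bounded_poset_def img
  proof (intro conjI)
    have e: "{} \<in> ?D" by (simp add: dparts0_def)
    show "\<exists>b\<in>decode ` ?D. \<forall>x\<in>decode ` ?D. (b, x) \<in> ?r"
      by (rule bexI[of _ "decode {}"]) (use e decode_order_iff[OF N(2) e] in auto)
    have t: "singles N \<in> ?D" using top e by blast
    show "\<exists>t\<in>decode ` ?D. \<forall>x\<in>decode ` ?D. (x, t) \<in> ?r"
      by (rule bexI[of _ "decode (singles N)"]) (use t top(2) decode_order_iff[OF N(2) _ t] in auto)
  qed
  have hr: "rank_function ?P ?r rk"
    unfolding rank_function_def
  proof (intro conjI ballI impI)
    fix u assume u: "u \<in> ?P" and min: "\<forall>y\<in>?P. (y, u) \<notin> ?r - Id"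
    have "decode {} = u"
      using min u decode_order_iff[OF N(2), of "{}"] unfolding img by (auto simp: dparts0_def)
    then show "rk u = 0" using rk[of "{}"] by (auto simp: dparts0_def)
  next
    fix u v assume "u \<in> ?P" "v \<in> ?P" and uv: "(u, v) \<in> ?r - Id \<and> open_interval ?P ?r u v = {}"
    then obtain x y where x: "x \<in> ?D" "u = decode x" and y: "y \<in> ?D" "v = decode y" unfolding img by blast
    have "x \<lless> y" using uv plus_less_decode[OF N(2) x(1) y(1)] x y by (simp add: plus_less_def)
    then obtain c where c: "c \<in> ?D" "x = c \<or> x \<lless> c" "c \<lless> y" "card y = Suc (card c)"
      using graded_dparts[OF N(1), of x y] x y unfolding dparts0_def by blast
    have "\<not> x \<lless> c"
    proof
      assume "x \<lless> c"
      then have "plus_less N u (decode c)" "plus_less N (decode c) v"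
        using plus_less_decode[OF N(2) x(1) c(1)] plus_less_decode[OF N(2) c(1) y(1)] c(3) x(2) y(2) by simp_all
      then have "decode c \<in> open_interval ?P ?r u v"
        using c(1) by (simp add: open_interval_def img plus_less_def)
      then show False using uv by blast
    qed
    then show "rk v = Suc (rk u)" using c x y rk by simp
  qed
  have hh: "carrier (reduced_homology (open_interval ?P ?r u v) ?r d :: ('k, _ set) module)
      = {\<zero>\<^bsub>reduced_homology (open_interval ?P ?r u v) ?r d\<^esub>}"
    if uv: "u \<in> ?P" "v \<in> ?P" "(u, v) \<in> ?r - Id" and d: "d \<noteq> int (rk v) - int (rk u) - 2" for u v d
  proof (rule reduced_homology_trivial)
    show "(cycles (open_interval ?P ?r u v) ?r d :: (_ \<Rightarrow>\<^sub>0 'k) set) \<subseteq> boundaries (open_interval ?P ?r u v) ?r d"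
    proof (cases "d < -1")
      case True
      then have "(cycles (open_interval ?P ?r u v) ?r d :: (_ \<Rightarrow>\<^sub>0 'k) set) \<subseteq> {0}"
        by (auto simp: cycles_def free_space_def order_simplices_neg)
      then show ?thesis using boundaries_closed(1) by blast
    next
      case False
      \<comment> \<open>Chains of degree \<open>d\<close> have length \<open>n = d + 1\<close>; the
        exempted degree \<open>rk v - rk u - 2\<close> corresponds to
        \<open>Suc n = rk v - rk u\<close>.\<close>
      define n where "n = nat (d + 1)"
      have dn: "d = int n - 1" using False by (simp add: n_def)
      obtain x y where x: "x \<in> ?D" "u = decode x" and y: "y \<in> ?D" "v = decode y" using uv unfolding img by blast
      have xy: "x \<lless> y" using uv plus_less_decode[OF N(2) x(1) y(1)] x y by (simp add: plus_less_def)
      have card: "card a < card b" if "a \<in> ?D" "b \<in> ?D" "a \<lless> b" for a b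
        using card_less[OF that(3)] that(2) N(1) by (auto simp: dparts0_def dparts_def)
      have "Suc n \<noteq> card y - card x" using d rk x y dn card[OF x(1) y(1) xy] by auto
      then have bA: "I.A.bounding {z \<in> ?D. x \<lless> z \<and> z \<lless> y} n"
      proof (rule I.A.bounding_interval[where rk = card, rotated -1])
        show "\<exists>c\<in>?D. (x = c \<or> x \<lless> c) \<and> c \<lless> y \<and> card y = Suc (card c)"
          if "x \<in> ?D" "y \<in> ?D" "x \<lless> y" for x y
          using graded_dparts[OF N(1), of x y] that unfolding dparts0_def by blast
        show "\<exists>u\<in>?D. (t = u \<or> t \<lless> u) \<and> u \<lless> x \<and> u \<lless> y \<and> card x = Suc (card u)"
          if "x \<in> ?D" "y \<in> ?D" "z \<in> ?D" "t \<in> ?D" "x \<lless> z" "y \<lless> z" "x \<noteq> y" "card z = Suc (card x)"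
            "card z = Suc (card y)" "t = x \<or> t \<lless> x" "t = y \<or> t \<lless> y" for x y z t
          using semimodular_dparts[OF N(1), of x y z t] that unfolding dparts0_def by blast
      qed (use fin card x(1) y(1) xy in auto)
      interpret J: strict_poset_iso "TYPE('k)" scoarser "plus_less N" decode "{z \<in> ?D. x \<lless> z \<and> z \<lless> y}"
        by (rule decode_iso[OF N(2)]) blast
      have "I.B.bounding (decode ` {z \<in> ?D. x \<lless> z \<and> z \<lless> y}) n" by (rule J.bounding_iso[OF bA])
      also have "decode ` {z \<in> ?D. x \<lless> z \<and> z \<lless> y} = open_interval ?P ?r u v"
      proof -
        have "x \<lless> z \<longleftrightarrow> (u, decode z) \<in> ?r - Id" "z \<lless> y \<longleftrightarrow> (decode z, v) \<in> ?r - Id" if "z \<in> ?D" for z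
          using plus_less_decode[OF N(2) x(1) that] plus_less_decode[OF N(2) that y(1)] x y
          by (simp_all add: plus_less_def)
        then show ?thesis unfolding open_interval_def img by auto
      qed
      finally show ?thesis
        unfolding dn using cycles_subset_boundaries[of ?r] I.B.strict_poset_axioms
        unfolding less_eq by blast
    qed
  qed
  have "finite ?P" unfolding img using fin by simp
  then show ?thesis
    unfolding cohen_macaulay_def
    by (intro conjI exI[of _ rk] ballI allI impI partial_order_Pi_CTA_plus[OF N(2)] hb hr hh)
qed

section \<open>The isomorphism of species and its naturality\<close>

section \<open>Top cycles and their coordinates\<close>

definition top_cycles :: "'a set \<Rightarrow> ('a decorated_partition option list \<Rightarrow>\<^sub>0 'k::field) set" where
  "top_cycles N = cycles (proper_part (Pi_CTA_plus N) (Pi_CTA_plus_order N)) (Pi_CTA_plus_order N) (int (card N) - 2)"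

definition mchain :: "'a planar_tree \<Rightarrow> 'a decorated_partition option list" where
  "mchain t = map decode (qchain t)"

lemma proper_part_eq:
  assumes N: "N \<noteq> {}"
  shows "proper_part (Pi_CTA_plus N) (Pi_CTA_plus_order N) = decode ` qset N"
proof -
  have e: "{} \<in> dparts0 N" and t: "singles N \<in> dparts0 N" by (auto simp: dparts0_def dparts_def)
  have le: "x \<preceq> singles N" if "x \<in> dparts0 N" for x
    using that coarser_singles[of x N] by (auto simp: dparts0_def dparts_def)
  have *: "(\<exists>y\<in>dparts0 N. \<not> x \<preceq> y) \<longleftrightarrow> x \<noteq> {}" if x: "x \<in> dparts0 N" for x
  proof
    assume "x \<noteq> {}"
    then have "supp x \<noteq> {}" using dpart_supp_empty[OF dparts0_dpart[OF x]] by simp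
    then have "\<not> x \<preceq> {}" using coarser_supp[of x "{}"] by auto
    then show "\<exists>y\<in>dparts0 N. \<not> x \<preceq> y" using e by blast
  qed auto
  have **: "(\<exists>y\<in>dparts0 N. \<not> y \<preceq> x) \<longleftrightarrow> x \<noteq> singles N" if x: "x \<in> dparts0 N" for x
  proof
    assume "x \<noteq> singles N"
    then have "\<not> singles N \<preceq> x" using coarser_antisym[OF le[OF x]] dparts0_dpart[OF x] by auto
    then show "\<exists>y\<in>dparts0 N. \<not> y \<preceq> x" using t by blast
  qed (use le in auto)
  have "decode x \<in> proper_part (Pi_CTA_plus N) (Pi_CTA_plus_order N) \<longleftrightarrow> x \<in> qset N" if x: "x \<in> dparts0 N" for x
  proof -
    have "decode x \<in> proper_part (Pi_CTA_plus N) (Pi_CTA_plus_order N) \<longleftrightarrow>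
        (\<exists>y\<in>dparts0 N. \<not> x \<preceq> y) \<and> (\<exists>y\<in>dparts0 N. \<not> y \<preceq> x)"
      unfolding proper_part_def decode_image[OF N, symmetric] using decode_order_iff[OF N] x by auto
    also have "\<dots> \<longleftrightarrow> x \<in> qset N"
      unfolding *[OF x] **[OF x] using x N by (auto simp: dparts0_def qset_def dparts_def)
    finally show ?thesis .
  qed
  moreover have "qset N \<subseteq> dparts0 N" by (auto simp: qset_def dparts0_def)
  moreover have "proper_part (Pi_CTA_plus N) (Pi_CTA_plus_order N) \<subseteq> decode ` dparts0 N"
    by (auto simp: proper_part_def decode_image[OF N])
  ultimately show ?thesis by blast
qed

lemma trees_empty: "trees {} = {}"
  by (auto simp: trees_def enumerations_def)

text \<open>The result for \<open>qset N\<close> in terms of the given poset. The species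
  isomorphism also concerns the empty set: there the degree is -2, in which there are no simplices,
  and there are no trees either.\<close>

lemma top_cycles_coordinates:
  fixes N :: "'a set"
  assumes N: "finite N"
  shows "(boundaries (proper_part (Pi_CTA_plus N) (Pi_CTA_plus_order N)) (Pi_CTA_plus_order N) (int (card N) - 2)
      :: (_ \<Rightarrow>\<^sub>0 'k::field) set) = {0}" (is ?B)
    and "finite (trees N)"
    and "\<exists>z\<in>top_cycles N. \<forall>t\<in>trees N. Poly_Mapping.lookup z (mchain t) = (h t :: 'k)"
    and "z \<in> top_cycles N \<Longrightarrow> (\<And>t. t \<in> trees N \<Longrightarrow> Poly_Mapping.lookup z (mchain t) = (0 :: 'k)) \<Longrightarrow> z = 0"
    and "t \<in> trees N \<Longrightarrow> set (mchain t) \<subseteq> Pi_CTA_plus N"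
    and "t \<in> trees N \<Longrightarrow> set (qchain t) \<subseteq> dparts0 N"
proof -
  let ?X = "proper_part (Pi_CTA_plus N) (Pi_CTA_plus_order N)"
  let ?r = "Pi_CTA_plus_order N"
  have "?B \<and> finite (trees N) \<and> (\<exists>z\<in>top_cycles N. \<forall>t\<in>trees N. Poly_Mapping.lookup z (mchain t) = h t)
    \<and> (z \<in> top_cycles N \<longrightarrow> (\<forall>t\<in>trees N. Poly_Mapping.lookup z (mchain t) = 0) \<longrightarrow> z = 0)
    \<and> (t \<in> trees N \<longrightarrow> set (mchain t) \<subseteq> Pi_CTA_plus N) \<and> (t \<in> trees N \<longrightarrow> set (qchain t) \<subseteq> dparts0 N)"
  proof (cases "N = {}")
    case True
    have d: "order_simplices ?X ?r (-2) = {}" "order_simplices ?X ?r (-1) = {[]}"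
      by (auto simp: order_simplices_def)
    have "boundary c = 0" if "Poly_Mapping.keys c \<subseteq> {[]}" for c :: "'a decorated_partition option list \<Rightarrow>\<^sub>0 'k"
      unfolding boundary_linext by (rule linext_eq_zero) (use that in auto)
    moreover have "0 \<in> {c :: 'a decorated_partition option list \<Rightarrow>\<^sub>0 'k. Poly_Mapping.keys c \<subseteq> {[]}}" by simp
    ultimately have "boundary ` {c :: 'a decorated_partition option list \<Rightarrow>\<^sub>0 'k. Poly_Mapping.keys c \<subseteq> {[]}} = {0}"
      by (auto simp: image_iff intro!: exI[of _ 0])
    then have ?B using d True by (simp add: boundaries_def free_space_def)
    moreover have "(top_cycles N :: (_ \<Rightarrow>\<^sub>0 'k) set) = {0}"
      using d True by (auto simp: top_cycles_def cycles_def free_space_def)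
    ultimately show ?thesis using True by (simp add: trees_empty)
  next
    case False
    interpret I: strict_poset_iso "TYPE('k)" scoarser "plus_less N" decode "qset N"
      by (rule decode_iso[OF False]) (auto simp: qset_def dparts0_def)
    have lt: "plus_less N = (\<lambda>u v. (u, v) \<in> ?r - Id)" by (simp add: plus_less_def fun_eq_iff)
    have sp: "strict_poset (\<lambda>u v. (u, v) \<in> ?r - Id)" using I.B.strict_poset_axioms unfolding lt .
    define n where "n = card N - 1"
    have n: "int (card N) - 2 = int n - 1" using False N card_gt_0_iff[of N] by (simp add: n_def)
    have A: "I.A.spherical (qset N) n (trees N) qchain"
      unfolding n_def by (rule spherical_decorated_partitions(1)[OF N False])
    have S: "I.B.spherical ?X n (trees N) mchain"
      unfolding proper_part_eq[OF False] using I.spherical_iso[OF A] by (simp add: mchain_def[abs_def])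
    note D = I.B.sphericalD[OF S]
    have os: "order_simplices ?X ?r (int m - 1) = I.B.simplices ?X m" for m
      unfolding lt by (rule order_simplices_eq[OF sp])
    have cyc: "(top_cycles N :: (_ \<Rightarrow>\<^sub>0 'k) set) = {c \<in> I.B.chains ?X n. boundary c = 0}"
      unfolding top_cycles_def n cycles_def free_space_def I.B.chains_def os by simp
    have "I.B.simplices ?X (Suc n) = {}" using D(1) Suc_n_not_le_n by blast
    then have "order_simplices ?X ?r (int n - 1 + 1) = {}" using os[of "Suc n"] by simp
    then have ?B unfolding boundaries_def n free_space_def by auto
    moreover have "\<exists>z\<in>top_cycles N. \<forall>t\<in>trees N. Poly_Mapping.lookup z (mchain t) = h t"
      using D(5)[of h] unfolding cyc by blast
    moreover have "z = 0" if "z \<in> top_cycles N" "\<forall>t\<in>trees N. Poly_Mapping.lookup z (mchain t) = 0"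
      using D(6)[of z] that unfolding cyc by blast
    moreover have "set (qchain t) \<subseteq> dparts0 N" if "t \<in> trees N"
      using I.A.sphericalD(4)[OF A that] by (auto simp: I.A.simplices_def qset_def dparts0_def)
    moreover from this have "set (mchain t) \<subseteq> Pi_CTA_plus N" if "t \<in> trees N"
      using that unfolding mchain_def decode_image[OF False, symmetric] by auto
    ultimately show ?thesis using D(3) by blast
  qed
  then show ?B "finite (trees N)" "\<exists>z\<in>top_cycles N. \<forall>t\<in>trees N. Poly_Mapping.lookup z (mchain t) = h t"
    "z \<in> top_cycles N \<Longrightarrow> (\<And>t. t \<in> trees N \<Longrightarrow> Poly_Mapping.lookup z (mchain t) = 0) \<Longrightarrow> z = 0"
    "t \<in> trees N \<Longrightarrow> set (mchain t) \<subseteq> Pi_CTA_plus N" "t \<in> trees N \<Longrightarrow> set (qchain t) \<subseteq> dparts0 N"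
    by blast+
qed

lemma top_cycles_closed:
  "0 \<in> top_cycles N"
  "c \<in> top_cycles N \<Longrightarrow> e \<in> top_cycles N \<Longrightarrow> c + e \<in> top_cycles N"
  "c \<in> top_cycles N \<Longrightarrow> scale a c \<in> top_cycles N"
  unfolding top_cycles_def cycles_def free_space_def
  using keys_scale[of a c] by (auto simp: boundary_add boundary_scale intro: subsetD[OF keys_add_subset])

lemma keys_top_cycles: "z \<in> top_cycles N \<Longrightarrow> Poly_Mapping.keys z \<subseteq> lists (Pi_CTA_plus N)"
  by (fastforce simp: top_cycles_def cycles_def free_space_def order_simplices_def proper_part_def)

text \<open>There are no boundaries in the top degree, so that homology classes are singletons.\<close>

lemma homology_space:
  assumes "finite N"
  defines "H \<equiv> space (homology_species :: ('a, 'k::field, _) species) N"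
  shows "carrier H = (\<lambda>z. {z}) ` top_cycles N"
    and "{z} \<oplus>\<^bsub>H\<^esub> {z'} = {z + z'}" and "a \<odot>\<^bsub>H\<^esub> {z} = {scale a z}"
proof -
  let ?X = "proper_part (Pi_CTA_plus N) (Pi_CTA_plus_order N)"
  have H: "H = reduced_homology ?X (Pi_CTA_plus_order N) (int (card N) - 2)"
    by (simp add: H_def homology_species_def)
  note B = top_cycles_coordinates(1)[OF assms(1), where 'k = 'k]
  show "carrier H = (\<lambda>z. {z}) ` top_cycles N"
    unfolding H carrier_reduced_homology B top_cycles_def by auto
  show "{z} \<oplus>\<^bsub>H\<^esub> {z'} = {z + z'}" "a \<odot>\<^bsub>H\<^esub> {z} = {scale a z}"
    unfolding H reduced_homology_def quotient_space_def B
    by (auto simp: set_add_def' a_r_coset_def' free_space_def)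
qed

section \<open>The sign representation\<close>

lemma sgn_space_closed:
  "\<omega> \<in> carrier (sgn_space N) \<Longrightarrow> \<omega>' \<in> carrier (sgn_space N) \<Longrightarrow> \<omega> \<oplus>\<^bsub>sgn_space N\<^esub> \<omega>' \<in> carrier (sgn_space N)"
  "\<omega> \<in> carrier (sgn_space N) \<Longrightarrow> a \<odot>\<^bsub>sgn_space N\<^esub> \<omega> \<in> carrier (sgn_space N)"
  by (auto simp: sgn_space_def algebra_simps)

text \<open>Relative to some reference enumeration, the generator takes the sign of the unique
  permutation leading from it to \<open>xs\<close>, and so vanishes at no enumeration. The choice
  serves proofs only and does not enter the definition of the isomorphism.\<close>

lemma sgn_generator:
  assumes "finite N"
  obtains \<omega>0 where "\<omega>0 \<in> carrier (sgn_space N :: ('k::field, 'a list \<Rightarrow> 'k) module)"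
    "\<And>xs. xs \<in> enumerations N \<Longrightarrow> \<omega>0 xs \<noteq> 0"
    "\<And>\<omega>. \<omega> \<in> carrier (sgn_space N) \<Longrightarrow> \<exists>b. \<omega> = (\<lambda>xs. b * \<omega>0 xs)"
proof -
  obtain xs0 where xs0: "distinct xs0" "set xs0 = N" using finite_distinct_list[OF assms] by blast
  let ?P = "\<lambda>\<sigma>. \<sigma> permutes {..<length xs0}"
  have ex: "\<exists>\<sigma>. ?P \<sigma> \<and> permute_list \<sigma> xs0 = xs" if "xs \<in> enumerations N" for xs
  proof -
    have "mset xs = mset xs0" using that xs0 set_eq_iff_mset_eq_distinct[of xs xs0] by (simp add: enumerations_def)
    then show ?thesis using mset_eq_permutation by metis
  qed
  have uniq: "\<sigma> = \<tau>" if "?P \<sigma>" "?P \<tau>" "permute_list \<sigma> xs0 = permute_list \<tau> xs0" for \<sigma> \<tau>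
  proof
    fix i
    show "\<sigma> i = \<tau> i"
    proof (cases "i < length xs0")
      case True
      then have "xs0 ! \<sigma> i = xs0 ! \<tau> i"
        using that permute_list_nth[OF that(1) True] permute_list_nth[OF that(2) True] by simp
      moreover have "\<sigma> i < length xs0" "\<tau> i < length xs0"
        using that(1,2) True permutes_in_image[of _ "{..<length xs0}" i] by auto
      ultimately show ?thesis using xs0(1) nth_eq_iff_index_eq by blast
    next
      case False
      then show ?thesis using permutes_not_in[OF that(1), of i] permutes_not_in[OF that(2), of i] by simp
    qed
  qed
  have in_enum: "permute_list \<sigma> xs0 \<in> enumerations N" if "?P \<sigma>" for \<sigma>
    using that xs0 by (simp add: enumerations_def)
  define \<omega>0 :: "'a list \<Rightarrow> 'k" where
    "\<omega>0 xs = (if xs \<in> enumerations N then of_int (sign (THE \<sigma>. ?P \<sigma> \<and> permute_list \<sigma> xs0 = xs)) else 0)" for xs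
  have \<omega>0: "\<omega>0 (permute_list \<sigma> xs0) = of_int (sign \<sigma>)" if "?P \<sigma>" for \<sigma>
  proof -
    have "(THE \<tau>. ?P \<tau> \<and> permute_list \<tau> xs0 = permute_list \<sigma> xs0) = \<sigma>"
      by (rule the_equality) (use that uniq in auto)
    then show ?thesis using in_enum[OF that] by (simp add: \<omega>0_def)
  qed
  have comp: "of_int (sign (\<sigma> \<circ> \<tau>)) = (of_int (sign \<tau>) * of_int (sign \<sigma>) :: 'k)" if "?P \<sigma>" "?P \<tau>" for \<sigma> \<tau>
  proof -
    have "permutation \<sigma>" "permutation \<tau>" unfolding permutation_permutes using that by blast+
    from sign_compose[OF this] show ?thesis by (simp add: mult.commute)
  qed
  show thesis
  proof
    have "\<omega>0 (permute_list \<tau> xs) = of_int (sign \<tau>) * \<omega>0 xs"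
      if xs: "xs \<in> enumerations N" and \<tau>: "\<tau> permutes {..<length xs}" for xs \<tau>
    proof -
      obtain \<sigma> where \<sigma>: "?P \<sigma>" "permute_list \<sigma> xs0 = xs" using ex[OF xs] by blast
      then have \<tau>': "?P \<tau>" using \<tau> by auto
      have "permute_list \<tau> xs = permute_list (\<sigma> \<circ> \<tau>) xs0"
        using permute_list_compose[OF \<tau>', of \<sigma>] \<sigma>(2) by simp
      then show ?thesis
        using \<omega>0[OF permutes_compose[OF \<tau>' \<sigma>(1)]] \<omega>0[OF \<sigma>(1)] \<sigma>(2) comp[OF \<sigma>(1) \<tau>'] by simp
    qed
    then show "\<omega>0 \<in> carrier (sgn_space N)" by (auto simp: sgn_space_def \<omega>0_def)
    show "\<omega>0 xs \<noteq> 0" if xs: "xs \<in> enumerations N" for xs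
    proof -
      obtain \<sigma> where \<sigma>: "?P \<sigma>" "permute_list \<sigma> xs0 = xs" using ex[OF xs] by blast
      then show ?thesis using \<omega>0[OF \<sigma>(1)] by (auto simp: sign_def)
    qed
    fix \<omega> :: "'a list \<Rightarrow> 'k" assume w: "\<omega> \<in> carrier (sgn_space N)"
    have "\<omega> xs = \<omega> xs0 * \<omega>0 xs" for xs
    proof (cases "xs \<in> enumerations N")
      case True
      then obtain \<sigma> where \<sigma>: "?P \<sigma>" "permute_list \<sigma> xs0 = xs" using ex by blast
      have "xs0 \<in> enumerations N" using xs0 by (simp add: enumerations_def)
      then have "\<omega> (permute_list \<sigma> xs0) = of_int (sign \<sigma>) * \<omega> xs0" using w \<sigma>(1) by (simp add: sgn_space_def)
      then show ?thesis using \<omega>0[OF \<sigma>(1)] \<sigma>(2) by simp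
    next
      case False
      then show ?thesis using w by (simp add: sgn_space_def \<omega>0_def)
    qed
    then show "\<exists>b. \<omega> = (\<lambda>xs. b * \<omega>0 xs)" by blast
  qed
qed

section \<open>The isomorphism\<close>

text \<open>A coset is sent to the value at an arbitrary representative, which is well defined as
  \<open>L\<close> vanishes on \<open>U\<close>; the assumptions on kernel and image make the map
  bijective. The other conclusions describe it on cosets, as naturality requires.\<close>

lemma linear_iso_quotient:
  fixes L :: "('b \<Rightarrow>\<^sub>0 'k::field) \<Rightarrow> ('c \<Rightarrow>\<^sub>0 'k)"
  assumes U: "0 \<in> U" "\<And>u v. u \<in> U \<Longrightarrow> v \<in> U \<Longrightarrow> u + v \<in> U" "\<And>a u. u \<in> U \<Longrightarrow> scale a u \<in> U"
    and L: "\<And>x y. L (x + y) = L x + L y" "\<And>a x. L (scale a x) = scale a (L x)"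
    and LU: "\<And>u. u \<in> U \<Longrightarrow> L u = 0" and ker: "\<And>x. x \<in> carrier (free_space S) \<Longrightarrow> L x = 0 \<Longrightarrow> x \<in> U"
    and img: "L ` carrier (free_space S) = carrier (free_space S')"
  shows "linear_iso (quotient_space (free_space S) U) (free_space S') (\<lambda>C. L (SOME c. c \<in> C))"
    and "x \<in> (\<lambda>u. u + y) ` U \<Longrightarrow> L x = L y"
    and "L (SOME c. c \<in> (\<lambda>u. u + y) ` U) = L y"
    and "carrier (quotient_space (free_space S) U) = (\<lambda>x. (\<lambda>u. u + x) ` U) ` carrier (free_space S)"
proof -
  let ?c = "\<lambda>x. (\<lambda>u. u + x) ` U"
  let ?Q = "quotient_space (free_space S) U"
  show Lc: "L x = L y" if "x \<in> ?c y" for x y using that L(1) LU by auto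
  have self: "x \<in> ?c x" for x using U(1) by force
  show some: "L (SOME c. c \<in> ?c x) = L x" for x by (rule Lc, rule someI[where P = "\<lambda>c. c \<in> ?c x", OF self])
  have Um: "- u \<in> U" if "u \<in> U" for u using U(3)[OF that, of "-1"] by simp
  have Lm: "L (x - y) = L x - L y" for x y using L(1)[of x "scale (-1) y"] L(2)[of "-1" y] by simp
  show car: "carrier ?Q = ?c ` carrier (free_space S)"
    by (auto simp: quotient_space_def A_RCOSETS_def' a_r_coset_def' free_space_def)
  have eqI: "?c x = ?c y" if xy: "x - y \<in> U" for x y
  proof -
    have "?c x \<subseteq> ?c y" if "x - y \<in> U" for x y
    proof
      fix z assume "z \<in> ?c x"
      then obtain u where u: "u \<in> U" "z = u + x" by blast
      have "z = (u + (x - y)) + y" by (simp add: u)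
      then show "z \<in> ?c y" using U(2)[OF u(1) that] by blast
    qed
    from this[OF xy] this[of y x] Um[OF xy] show ?thesis by simp
  qed
  have add_eq: "A \<oplus>\<^bsub>?Q\<^esub> B = (\<Union>h\<in>A. \<Union>k\<in>B. {h + k})" for A B
    by (simp add: quotient_space_def set_add_def' free_space_def)
  have add: "?c x \<oplus>\<^bsub>?Q\<^esub> ?c y = ?c (x + y)" for x y
  proof
    show "?c x \<oplus>\<^bsub>?Q\<^esub> ?c y \<subseteq> ?c (x + y)"
    proof
      fix z assume "z \<in> ?c x \<oplus>\<^bsub>?Q\<^esub> ?c y"
      then obtain u v where uv: "u \<in> U" "v \<in> U" "z = (u + x) + (v + y)"
        unfolding add_eq by blast
      have "z = (u + v) + (x + y)" by (simp add: uv(3) algebra_simps)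
      then show "z \<in> ?c (x + y)" using U(2)[OF uv(1,2)] by blast
    qed
    show "?c (x + y) \<subseteq> ?c x \<oplus>\<^bsub>?Q\<^esub> ?c y"
    proof
      fix z assume "z \<in> ?c (x + y)"
      then obtain u where u: "u \<in> U" "z = u + (x + y)" by blast
      have "z = (u + x) + y" by (simp add: u(2) algebra_simps)
      then show "z \<in> ?c x \<oplus>\<^bsub>?Q\<^esub> ?c y"
        using u(1) self[of y] unfolding add_eq by blast
    qed
  qed
  have smult: "a \<odot>\<^bsub>?Q\<^esub> ?c x = ?c (scale a x)" for a x
  proof -
    have "a \<odot>\<^bsub>?Q\<^esub> ?c x = (\<Union>y\<in>?c x. ?c (scale a y))"
      by (auto simp: quotient_space_def a_r_coset_def' free_space_def)
    also have "\<dots> = (\<Union>y\<in>?c x. ?c (scale a x))"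
    proof (rule SUP_cong[OF refl], rule eqI)
      fix y assume "y \<in> ?c x"
      then obtain u where "u \<in> U" "y = u + x" by blast
      then show "scale a y - scale a x \<in> U" using U(3) by (simp add: scale_add_right)
    qed
    also have "\<dots> = ?c (scale a x)" using self by blast
    finally show ?thesis .
  qed
  show "linear_iso ?Q (free_space S') (\<lambda>C. L (SOME c. c \<in> C))"
    unfolding linear_iso_def
  proof (intro conjI ballI allI)
    show "bij_betw (\<lambda>C. L (SOME c. c \<in> C)) (carrier ?Q) (carrier (free_space S'))"
      unfolding bij_betw_def
    proof
      show "inj_on (\<lambda>C. L (SOME c. c \<in> C)) (carrier ?Q)"
      proof (rule inj_onI)
        fix C D assume "C \<in> carrier ?Q" "D \<in> carrier ?Q" and eq: "L (SOME c. c \<in> C) = L (SOME c. c \<in> D)"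
        then obtain x y where xy: "x \<in> carrier (free_space S)" "y \<in> carrier (free_space S)" "C = ?c x" "D = ?c y"
          unfolding car by blast
        then have "L (x - y) = 0" using eq some Lm by simp
        moreover have "x - y \<in> carrier (free_space S)" using xy by (simp add: free_space_def keys_diff_subset)
        ultimately have "x - y \<in> U" by (intro ker)
        then show "C = D" using xy eqI by simp
      qed
      show "(\<lambda>C. L (SOME c. c \<in> C)) ` carrier ?Q = carrier (free_space S')"
        unfolding car image_image some img ..
    qed
  next
    fix C D assume "C \<in> carrier ?Q" "D \<in> carrier ?Q"
    then obtain x y where xy: "C = ?c x" "D = ?c y" unfolding car by blast
    show "L (SOME c. c \<in> C \<oplus>\<^bsub>?Q\<^esub> D) = L (SOME c. c \<in> C) \<oplus>\<^bsub>free_space S'\<^esub> L (SOME c. c \<in> D)"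
      unfolding xy add some by (simp add: L free_space_def)
  next
    fix a C assume "C \<in> carrier ?Q"
    then obtain x where x: "C = ?c x" unfolding car by blast
    show "L (SOME c. c \<in> a \<odot>\<^bsub>?Q\<^esub> C) = a \<odot>\<^bsub>free_space S'\<^esub> L (SOME c. c \<in> C)"
      unfolding x smult some by (simp add: L free_space_def)
  qed
qed

text \<open>The coordinate of the tensor of \<open>z\<close> and \<open>\<omega>\<close> at
  \<open>t\<close>: the coefficient of \<open>z\<close> at the chain of \<open>t\<close>, times the
  value of \<open>\<omega>\<close> at the order in which \<open>t\<close> lists its leaves. The
  second factor takes the place of a choice of orientation. \<open>the_elem\<close> unpacks the
  homology class, a singleton.\<close>

definition tree_map ::
    "'a set \<Rightarrow> ('a decorated_partition option list \<Rightarrow>\<^sub>0 'k) set \<times> ('a list \<Rightarrow> 'k) \<Rightarrow> ('a planar_tree \<Rightarrow>\<^sub>0 'k::field)" where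
  "tree_map N = (\<lambda>(C, \<omega>). \<Sum>t\<in>trees N.
     Poly_Mapping.single t (Poly_Mapping.lookup (the_elem C) (mchain t) * \<omega> (leaves t)))"

lemma lookup_tree_map:
  assumes "finite N"
  shows "Poly_Mapping.lookup (tree_map N ({z}, \<omega>)) t
     = (if t \<in> trees N then Poly_Mapping.lookup z (mchain t) * \<omega> (leaves t) else 0)"
  using top_cycles_coordinates(2)[OF assms]
  by (simp add: tree_map_def lookup_sum lookup_single when_def)

context
  fixes N :: "'a set" and K :: "'k::field itself"
  assumes N: "finite N"
begin

private abbreviation "HN \<equiv> space (homology_species :: ('a, 'k, _) species) N"
private abbreviation "SN \<equiv> sgn_space N :: ('k, 'a list \<Rightarrow> 'k) module"
private abbreviation "rel \<equiv> tensor_relations HN SN"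

private lemmas H = homology_space[OF N, where 'k = 'k]

private lemma HE: "C \<in> carrier HN \<Longrightarrow> (\<And>z. z \<in> top_cycles N \<Longrightarrow> C = {z} \<Longrightarrow> P) \<Longrightarrow> P"
  unfolding H(1) by blast

lemma tensor_relations_free: "x \<in> rel \<Longrightarrow> x \<in> carrier (free_space (carrier HN \<times> carrier SN))"
proof (induction rule: tensor_relations.induct)
  case (add_left v v' w)
  from add_left(1,2) obtain z z' where "z \<in> top_cycles N" "v = {z}" "z' \<in> top_cycles N" "v' = {z'}" by (metis HE)
  then have "v \<oplus>\<^bsub>HN\<^esub> v' \<in> carrier HN" by (simp add: H top_cycles_closed)
  then show ?case using add_left by (simp add: free_space_def keys_diff_subset)
next
  case (add_right v w w')
  then have "w \<oplus>\<^bsub>SN\<^esub> w' \<in> carrier SN" by (intro sgn_space_closed)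
  then show ?case using add_right by (simp add: free_space_def keys_diff_subset)
next
  case (smult_left v w a)
  from smult_left(1) obtain z where "z \<in> top_cycles N" "v = {z}" by (metis HE)
  then have "a \<odot>\<^bsub>HN\<^esub> v \<in> carrier HN" by (simp add: H top_cycles_closed)
  then show ?case using smult_left by (simp add: free_space_def keys_diff_subset)
next
  case (smult_right v w a)
  then have "a \<odot>\<^bsub>SN\<^esub> w \<in> carrier SN" by (intro sgn_space_closed)
  then show ?case using smult_right by (simp add: free_space_def keys_diff_subset)
next
  case (add x y)
  then show ?case by (simp add: free_space_def keys_add_subset)
next
  case (scale x a)
  then show ?case using keys_scale[of a x] by (auto simp: free_space_def)
qed (simp add: free_space_def)

lemma tree_map_relations: "x \<in> rel \<Longrightarrow> linext (tree_map N) x = 0"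
proof (induction rule: tensor_relations.induct)
  case (add_left v v' w)
  from add_left(1,2) obtain z z' where "v = {z}" "v' = {z'}" by (metis HE)
  then show ?case
    by (intro poly_mapping_eqI) (simp add: linext_diff linext_add H(2) lookup_minus lookup_tree_map[OF N] lookup_add algebra_simps)
next
  case (add_right v w w')
  from add_right(1) obtain z where "v = {z}" by (metis HE)
  then show ?case
    by (intro poly_mapping_eqI)
      (simp add: linext_diff linext_add lookup_add lookup_minus lookup_tree_map[OF N] sgn_space_def algebra_simps)
next
  case (smult_left v w a)
  from smult_left(1) obtain z where "v = {z}" by (metis HE)
  then show ?case
    by (intro poly_mapping_eqI) (simp add: linext_diff H(3) lookup_minus lookup_tree_map[OF N])
next
  case (smult_right v w a)
  from smult_right(1) obtain z where "v = {z}" by (metis HE)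
  then show ?case
    by (intro poly_mapping_eqI)
      (simp add: linext_diff lookup_minus lookup_tree_map[OF N] sgn_space_def)
qed (simp_all add: linext_add linext_scale)

private lemma rel_diff: "x \<in> rel \<Longrightarrow> y \<in> rel \<Longrightarrow> x - y \<in> rel"
  using tensor_relations.add[OF _ tensor_relations.scale[of y HN SN "-1"], of x] by simp

text \<open>Since \<open>SN\<close> is one-dimensional, every tensor is elementary.\<close>

lemma tensor_elementary:
  assumes \<omega>0: "\<omega>0 \<in> carrier SN" "\<And>\<omega>. \<omega> \<in> carrier SN \<Longrightarrow> \<exists>b. \<omega> = (\<lambda>xs. b * \<omega>0 xs)"
    and c: "c \<in> carrier (free_space (carrier HN \<times> carrier SN))"
  shows "\<exists>z\<in>top_cycles N. c - basis ({z}, \<omega>0) \<in> rel"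
proof -
  have zH: "{z} \<in> carrier HN" if "z \<in> top_cycles N" for z using that by (simp add: H(1))
  have one: "\<exists>z\<in>top_cycles N. Poly_Mapping.single (v, \<omega>) a - basis ({z}, \<omega>0) \<in> rel"
    if v: "v \<in> carrier HN" and \<omega>: "\<omega> \<in> carrier SN" for v \<omega> a
  proof -
    obtain z where z: "z \<in> top_cycles N" "v = {z}" using v by (rule HE)
    obtain b where b: "\<omega> = (\<lambda>xs. b * \<omega>0 xs)" using \<omega>0(2)[OF \<omega>] by blast
    have "basis (v, b \<odot>\<^bsub>SN\<^esub> \<omega>0) - Poly_Mapping.single (v, \<omega>0) b \<in> rel"
      by (rule tensor_relations.smult_right[OF v \<omega>0(1)])
    moreover have "b \<odot>\<^bsub>SN\<^esub> \<omega>0 = \<omega>" by (simp add: b sgn_space_def)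
    ultimately have "scale a (basis (v, \<omega>) - Poly_Mapping.single (v, \<omega>0) b) \<in> rel"
      by (metis tensor_relations.scale)
    then have 1: "Poly_Mapping.single (v, \<omega>) a - Poly_Mapping.single (v, \<omega>0) (a * b) \<in> rel"
      by (simp add: scale_diff_right)
    have "basis ((a * b) \<odot>\<^bsub>HN\<^esub> v, \<omega>0) - Poly_Mapping.single (v, \<omega>0) (a * b) \<in> rel"
      by (rule tensor_relations.smult_left[OF v \<omega>0(1)])
    then have "basis ({scale (a * b) z}, \<omega>0) - Poly_Mapping.single (v, \<omega>0) (a * b) \<in> rel"
      by (simp add: z(2) H(3))
    from rel_diff[OF 1 this] have "Poly_Mapping.single (v, \<omega>) a - basis ({scale (a * b) z}, \<omega>0) \<in> rel" by simp
    then show ?thesis using top_cycles_closed(3)[OF z(1)] by blast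
  qed
  have sum: "\<exists>z\<in>top_cycles N. (\<Sum>x\<in>A. Poly_Mapping.single x (f x)) - basis ({z}, \<omega>0) \<in> rel"
    if "finite A" "A \<subseteq> carrier HN \<times> carrier SN" for A f
    using that
  proof (induction A rule: finite_induct)
    case empty
    have "basis (0 \<odot>\<^bsub>HN\<^esub> {0}, \<omega>0) - Poly_Mapping.single ({0}, \<omega>0) 0 \<in> rel"
      by (rule tensor_relations.smult_left[OF zH[OF top_cycles_closed(1)] \<omega>0(1)])
    then have "basis ({0}, \<omega>0) \<in> rel" by (simp add: H(3))
    from rel_diff[OF tensor_relations.zero this] show ?case using top_cycles_closed(1) by auto
  next
    case (insert x A)
    obtain z where z: "z \<in> top_cycles N" "(\<Sum>x\<in>A. Poly_Mapping.single x (f x)) - basis ({z}, \<omega>0) \<in> rel"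
      using insert by auto
    obtain z' where z': "z' \<in> top_cycles N" "Poly_Mapping.single x (f x) - basis ({z'}, \<omega>0) \<in> rel"
      using one[of "fst x" "snd x" "f x"] insert by auto
    have "basis ({z'} \<oplus>\<^bsub>HN\<^esub> {z}, \<omega>0) - basis ({z'}, \<omega>0) - basis ({z}, \<omega>0) \<in> rel"
      by (rule tensor_relations.add_left[OF zH[OF z'(1)] zH[OF z(1)] \<omega>0(1)])
    then have 3: "basis ({z' + z}, \<omega>0) - basis ({z'}, \<omega>0) - basis ({z}, \<omega>0) \<in> rel" by (simp add: H(2))
    have "(\<Sum>x\<in>Set.insert x A. Poly_Mapping.single x (f x)) - basis ({z' + z}, \<omega>0) =
       (Poly_Mapping.single x (f x) - basis ({z'}, \<omega>0)) + ((\<Sum>x\<in>A. Poly_Mapping.single x (f x)) - basis ({z}, \<omega>0))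
        - (basis ({z' + z}, \<omega>0) - basis ({z'}, \<omega>0) - basis ({z}, \<omega>0))"
      using insert by (simp add: algebra_simps)
    also have "\<dots> \<in> rel" using rel_diff[OF tensor_relations.add[OF z'(2) z(2)] 3] .
    finally show ?case using top_cycles_closed(2)[OF z'(1) z(1)] by blast
  qed
  have "c = linext basis c" by simp
  also have "\<dots> = (\<Sum>x\<in>Poly_Mapping.keys c. Poly_Mapping.single x (Poly_Mapping.lookup c x))"
    unfolding linext_def by (rule sum.cong) simp_all
  finally have "c = (\<Sum>x\<in>Poly_Mapping.keys c. Poly_Mapping.single x (Poly_Mapping.lookup c x))" .
  then show ?thesis using sum[of "Poly_Mapping.keys c" "Poly_Mapping.lookup c"] c by (auto simp: free_space_def)
qed

text \<open>Modulo the relations \<open>c\<close> is an elementary tensor of a cycle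
  \<open>z\<close> with \<open>\<omega>0\<close>. As \<open>\<omega>0\<close> vanishes at no
  enumeration, all coordinates of \<open>z\<close> vanish, so that \<open>z = 0\<close>.\<close>

lemma tree_map_kernel:
  assumes c: "c \<in> carrier (free_space (carrier HN \<times> carrier SN))" and 0: "linext (tree_map N) c = 0"
  shows "c \<in> rel"
proof -
  obtain \<omega>0 where \<omega>0: "\<omega>0 \<in> carrier SN" "\<And>xs. xs \<in> enumerations N \<Longrightarrow> \<omega>0 xs \<noteq> 0"
    "\<And>\<omega>. \<omega> \<in> carrier SN \<Longrightarrow> \<exists>b. \<omega> = (\<lambda>xs. b * \<omega>0 xs)" by (rule sgn_generator[OF N, where 'k = 'k]) (rule that)
  obtain z where z: "z \<in> top_cycles N" "c - basis ({z}, \<omega>0) \<in> rel"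
    using tensor_elementary[OF \<omega>0(1,3) c] by blast
  have "tree_map N ({z}, \<omega>0) = 0"
    using tree_map_relations[OF z(2)] 0 by (simp add: linext_diff)
  then have "Poly_Mapping.lookup z (mchain t) * \<omega>0 (leaves t) = 0" if "t \<in> trees N" for t
    using lookup_tree_map[OF N, of z \<omega>0 t] that by simp
  then have "Poly_Mapping.lookup z (mchain t) = 0" if "t \<in> trees N" for t
    using \<omega>0(2)[of "leaves t"] that by (auto simp: trees_def)
  then have z0: "z = 0" using top_cycles_coordinates(4)[OF N z(1)] by blast
  have "0 \<in> (top_cycles N :: (_ \<Rightarrow>\<^sub>0 'k) set)" by (rule top_cycles_closed)
  then have H0: "{0} \<in> carrier HN" by (simp add: H(1))
  have "basis (0 \<odot>\<^bsub>HN\<^esub> {0}, \<omega>0) - Poly_Mapping.single ({0}, \<omega>0) 0 \<in> rel"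
    by (rule tensor_relations.smult_left[OF H0 \<omega>0(1)])
  then have "basis ({z}, \<omega>0) \<in> rel" by (simp add: H(3) z0)
  from tensor_relations.add[OF z(2) this] show ?thesis by simp
qed

lemma tree_map_image:
  "linext (tree_map N) ` carrier (free_space (carrier HN \<times> carrier SN)) = carrier (free_space (trees N))"
proof
  show "linext (tree_map N) ` carrier (free_space (carrier HN \<times> carrier SN)) \<subseteq> carrier (free_space (trees N))"
  proof clarify
    fix c :: "(_ set \<times> ('a list \<Rightarrow> 'k)) \<Rightarrow>\<^sub>0 'k"
    have "Poly_Mapping.keys (tree_map N x :: _ \<Rightarrow>\<^sub>0 'k) \<subseteq> trees N" for x
      unfolding tree_map_def by (cases x) (auto intro!: keys_sum_subset split: if_splits)
    then have "Poly_Mapping.keys (linext (tree_map N) c) \<subseteq> trees N" by (intro keys_linext_subset)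
    then show "linext (tree_map N) c \<in> carrier (free_space (trees N))" by (simp add: free_space_def)
  qed
  show "carrier (free_space (trees N)) \<subseteq> linext (tree_map N) ` carrier (free_space (carrier HN \<times> carrier SN))"
  proof
    fix y :: "'a planar_tree \<Rightarrow>\<^sub>0 'k" assume y: "y \<in> carrier (free_space (trees N))"
    obtain \<omega>0 where \<omega>0: "\<omega>0 \<in> carrier SN" "\<And>xs. xs \<in> enumerations N \<Longrightarrow> \<omega>0 xs \<noteq> 0"
      using sgn_generator[OF N] by metis
    \<comment> \<open>The coordinates of a top cycle can be prescribed; the division compensates for
      the second factor in \<open>tree_map\<close>.\<close>
    obtain z where z: "z \<in> top_cycles N"
      "\<forall>t\<in>trees N. Poly_Mapping.lookup z (mchain t) = Poly_Mapping.lookup y t / \<omega>0 (leaves t)"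
      using top_cycles_coordinates(3)[OF N, of "\<lambda>t. Poly_Mapping.lookup y t / \<omega>0 (leaves t)"] by blast
    have "linext (tree_map N) (basis ({z}, \<omega>0)) = y"
    proof (rule poly_mapping_eqI)
      fix t
      have "\<omega>0 (leaves t) \<noteq> 0" if "t \<in> trees N" using \<omega>0(2) that by (simp add: trees_def)
      moreover have "Poly_Mapping.lookup y t = 0" if "t \<notin> trees N"
        using y that by (auto simp: free_space_def in_keys_iff)
      ultimately show "Poly_Mapping.lookup (linext (tree_map N) (basis ({z}, \<omega>0))) t = Poly_Mapping.lookup y t"
        using z(2) by (simp add: lookup_tree_map[OF N])
    qed
    moreover have "basis ({z}, \<omega>0) \<in> carrier (free_space (carrier HN \<times> carrier SN))"
      using z(1) \<omega>0(1) by (simp add: free_space_def H(1))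
    ultimately show "y \<in> linext (tree_map N) ` carrier (free_space (carrier HN \<times> carrier SN))" by blast
  qed
qed

lemma tree_map_iso:
  "linear_iso (quotient_space (free_space (carrier HN \<times> carrier SN)) rel) (free_space (trees N))
     (\<lambda>C. linext (tree_map N) (SOME c. c \<in> C))"
  "x \<in> (\<lambda>u. u + y) ` rel \<Longrightarrow> linext (tree_map N) x = linext (tree_map N) y"
  "linext (tree_map N) (SOME c. c \<in> (\<lambda>u. u + y) ` rel) = linext (tree_map N) y"
  "carrier (quotient_space (free_space (carrier HN \<times> carrier SN)) rel)
     = (\<lambda>x. (\<lambda>u. u + x) ` rel) ` carrier (free_space (carrier HN \<times> carrier SN))"
proof -
  note I = linear_iso_quotient[where U = rel and L = "linext (tree_map N)" and S = "carrier HN \<times> carrier SN" and S' = "trees N",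
      OF tensor_relations.zero tensor_relations.add tensor_relations.scale linext_add linext_scale
        tree_map_relations tree_map_kernel tree_map_image]
  show "linear_iso (quotient_space (free_space (carrier HN \<times> carrier SN)) rel) (free_space (trees N))
     (\<lambda>C. linext (tree_map N) (SOME c. c \<in> C))" by (rule I(1))
  show "x \<in> (\<lambda>u. u + y) ` rel \<Longrightarrow> linext (tree_map N) x = linext (tree_map N) y" by (rule I(2))
  show "linext (tree_map N) (SOME c. c \<in> (\<lambda>u. u + y) ` rel) = linext (tree_map N) y" by (rule I(3))
  show "carrier (quotient_space (free_space (carrier HN \<times> carrier SN)) rel)
     = (\<lambda>x. (\<lambda>u. u + x) ` rel) ` carrier (free_space (carrier HN \<times> carrier SN))" by (rule I(4))
qed

end

section \<open>Naturality\<close>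

definition dmap :: "('a \<Rightarrow> 'a) \<Rightarrow> 'a dpart \<Rightarrow> 'a dpart" where
  "dmap f x = map_prod ((`) f) ((`) f) ` x"

lemma in_dmap: "(B, S) \<in> x \<Longrightarrow> (f ` B, f ` S) \<in> dmap f x"
  unfolding dmap_def by (rule image_eqI[of _ _ "(B, S)"]) simp_all

lemma supp_dmap: "supp (dmap f x) = f ` supp x"
  by (auto simp: supp_def dmap_def)

lemma dmap_simps: "dmap f {} = {}" "dmap f (x \<union> y) = dmap f x \<union> dmap f y" "dmap f (singles T) = singles (f ` T)"
  "dmap f (insert (B, S) x) = insert (f ` B, f ` S) (dmap f x)"
  by (auto simp: dmap_def singles_def image_image image_Un)

lemma dmap_grow:
  assumes "inj_on f N" "supp y \<subseteq> N"
  shows "dmap f (grow N S y) = grow (f ` N) (f ` S) (dmap f y)"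
  using inj_on_image_set_diff[OF assms(1), of N "supp y"] assms(2)
  by (simp add: grow_def dmap_simps supp_dmap Diff_subset)

lemma dpart_dmap:
  assumes x: "dpart x" and f: "inj_on f (supp x)"
  shows "dpart (dmap f x)"
proof (rule dpartI)
  fix B S assume "(B, S) \<in> dmap f x"
  then obtain C R where "(C, R) \<in> x" "B = f ` C" "S = f ` R" by (auto simp: dmap_def)
  then show "S \<noteq> {} \<and> S \<subseteq> B" using dpartD(1,2)[OF x, of C R] by (simp add: image_mono)
next
  fix B S C R a assume "(B, S) \<in> dmap f x" "(C, R) \<in> dmap f x" and a: "a \<in> B" "a \<in> C"
  then obtain B' S' C' R' where *: "(B', S') \<in> x" "B = f ` B'" "S = f ` S'" "(C', R') \<in> x" "C = f ` C'" "R = f ` R'"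
    by (auto simp: dmap_def)
  obtain b c where bc: "b \<in> B'" "c \<in> C'" "f b = f c" using a * by auto
  have "b \<in> supp x" "c \<in> supp x" using bc *(1,4) by (auto simp: in_supp)
  then have "b = c" using f bc(3) by (auto dest: inj_onD)
  then show "B = C \<and> S = R" using dpart_unique[OF x *(1,4)] bc * by blast
qed

text \<open>On encoded partitions relabelling is a plain image, free of \<open>restrict\<close> and
  \<open>inv_into\<close>; naturality of the chains is therefore checked there.\<close>

lemma relabel_decode:
  assumes f: "inj_on f N" and x: "x \<in> dparts0 N"
  shows "map_option (relabel N f) (decode x) = decode (dmap f x)"
proof (cases "x = {}")
  case True
  then show ?thesis by (simp add: decode_def dmap_simps)
next
  case False
  have d: "dpart x" "supp x = N" using x False by (auto simp: dparts0_def dparts_def)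
  have d': "dpart (dmap f x)" by (rule dpart_dmap) (use d f in auto)
  have ne: "dmap f x \<noteq> {}" using False by (simp add: dmap_def)
  have img: "fst ` dmap f x = (`) f ` fst ` x" by (auto simp: dmap_def image_image)
  have "f ` (restrict (\<lambda>B. THE S. (B, S) \<in> x) (fst ` x)) (inv_into N f ` B') = (THE S. (B', S) \<in> dmap f x)"
    if "B' \<in> (`) f ` fst ` x" for B'
  proof -
    from that obtain B S where B: "(B, S) \<in> x" "B' = f ` B" by force
    have "B \<subseteq> N" using dpartD(4)[OF d(1) B(1)] d(2) by simp
    then have inv: "inv_into N f ` B' = B" using inv_into_image_cancel[OF f] B(2) by blast
    have "B \<in> fst ` x" using B(1) by force
    then show ?thesis
      using the_dec[OF d(1) B(1)] the_dec[OF d' in_dmap[OF B(1)]] by (simp add: inv) (simp add: B(2))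
  qed
  then have "restrict (\<lambda>B. f ` (restrict (\<lambda>B. THE S. (B, S) \<in> x) (fst ` x)) (inv_into N f ` B)) ((`) f ` fst ` x)
      = restrict (\<lambda>B. THE S. (B, S) \<in> dmap f x) ((`) f ` fst ` x)"
    by (rule restrict_ext)
  then show ?thesis unfolding decode_eq[OF d(1) False] decode_eq[OF d' ne] img by (simp add: relabel_def)
qed

lemma set_planar_tree_leaves: "set_planar_tree t = set (leaves t)"
  by (induction t) auto

lemma leaves_map: "leaves (map_planar_tree f t) = map f (leaves t)"
  by (induction t) auto

lemma rest_map: "rest (map_planar_tree f t) = f ` rest t"
  by (simp add: rest_def leaves_map map_tl[symmetric])

lemma supp_qlift:
  assumes "y \<in> set (qlift t c)" "\<And>w. w \<in> set c \<Longrightarrow> supp w \<subseteq> set (leaves t)"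
  shows "supp y \<subseteq> set (leaves t)"
proof (cases t)
  case (Node u v)
  then obtain x where x: "y = grow (set (leaves t)) {hd (leaves t)} x" "x = {} \<or> x \<in> set c"
    using assms(1) by (auto simp: qlift_def simp del: leaves.simps)
  then have "supp x \<subseteq> set (leaves t)" using assms(2) by auto
  then show ?thesis using supp_grow x(1) by blast
qed (use assms(1) in \<open>simp add: qlift_def\<close>)

text \<open>The bound on supports lets \<open>dmap f\<close> pass through \<open>grow\<close>, which
  requires \<open>f\<close> to be injective on the set in which the support lies.\<close>

lemma supp_rchain: "y \<in> set (rchain t) \<Longrightarrow> supp y \<subseteq> set (leaves t)"
proof (induction t arbitrary: y)
  case (Node u v)
  have r: "rest u \<subseteq> set (leaves u)" unfolding rest_def by (metis leaves_ne list.set_sel(2) subsetI)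
  from Node.prems consider "y \<in> set (rchain u)" | "y = singles (rest u)"
    | w where "y = w \<union> singles (rest u)" "w \<in> set (qlift v (rchain v))"
    by (auto split: planar_tree.splits)
  then show ?case
  proof cases
    case 1
    then show ?thesis using Node.IH(1) by simp (rule le_supI1)
  next
    case 2
    then show ?thesis using r by simp (rule le_supI1)
  next
    case 3
    have "supp w \<subseteq> set (leaves v)" by (rule supp_qlift[OF 3(2) Node.IH(2)])
    then show ?thesis using r unfolding 3(1) supp_simps leaves.simps set_append by (simp add: le_supI1 le_supI2)
  qed
qed simp

lemma qlift_map:
  assumes "inj_on f (set (leaves t))"
  shows "qlift (map_planar_tree f t) (map (dmap f) (rchain t)) = map (dmap f) (qlift t (rchain t))"
proof (cases t)
  case (Node u v)
  let ?L = "set (leaves t)"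
  have "dmap f (grow ?L {hd (leaves t)} y) = grow (f ` ?L) {f (hd (leaves t))} (dmap f y)"
    if "y \<in> set ({} # rchain t)" for y
  proof -
    have "supp y \<subseteq> ?L" using that supp_rchain[of y t] by auto
    then show ?thesis using dmap_grow[OF assms] by simp
  qed
  moreover have "set (leaves (map_planar_tree f t)) = f ` ?L" "hd (leaves (map_planar_tree f t)) = f (hd (leaves t))"
    by (simp_all add: leaves_map hd_map)
  moreover have "qlift (map_planar_tree f t) c = map (grow (set (leaves (map_planar_tree f t))) {hd (leaves (map_planar_tree f t))}) ({} # c)"
    "qlift t c = map (grow ?L {hd (leaves t)}) ({} # c)" for c
    using Node by (simp_all add: qlift_def)
  ultimately show ?thesis by (simp add: dmap_simps o_def del: leaves.simps)
qed (simp add: qlift_def)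

lemma rchain_map: "inj_on f (set (leaves t)) \<Longrightarrow> rchain (map_planar_tree f t) = map (dmap f) (rchain t)"
proof (induction t)
  case (Node u v)
  have inj: "inj_on f (set (leaves u))" "inj_on f (set (leaves v))"
    using Node.prems by (auto intro: inj_on_subset)
  have "(case map_planar_tree f u of Tip _ \<Rightarrow> [] | Node _ _ \<Rightarrow> [singles (rest (map_planar_tree f u))])
      = map (dmap f) (case u of Tip _ \<Rightarrow> [] | Node _ _ \<Rightarrow> [singles (rest u)])"
    by (cases u) (simp_all add: dmap_simps rest_map del: leaves.simps, metis planar_tree.map(2) rest_map)
  then show ?case
    by (simp add: Node.IH inj qlift_map o_def dmap_simps rest_map)
qed simp

lemma mchain_map:
  assumes f: "inj_on f N" and N: "finite N" and t: "t \<in> trees N"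
  shows "mchain (map_planar_tree f t) = map (map_option (relabel N f)) (mchain t)"
proof -
  have "inj_on f (set (leaves t))" using f t by (simp add: trees_def enumerations_def)
  then have "qchain (map_planar_tree f t) = map (dmap f) (qchain t)"
    by (simp add: qchain_def rchain_map qlift_map)
  then show ?thesis
    using top_cycles_coordinates(6)[OF N t] relabel_decode[OF f] by (auto simp: mchain_def)
qed

text \<open>Injectivity keeps distinct chains apart, so that \<open>pushforward\<close> preserves
  the coefficients at the chains of trees.\<close>

lemma relabel_inj:
  assumes f: "inj_on f N" and N: "N \<noteq> {}"
  shows "inj_on (map_option (relabel N f)) (Pi_CTA_plus N)"
  unfolding decode_image[OF N, symmetric]
proof (rule inj_onI, clarify)
  fix x y assume x: "x \<in> dparts0 N" and y: "y \<in> dparts0 N"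
    and eq: "map_option (relabel N f) (decode x) = map_option (relabel N f) (decode y)"
  have dm: "dmap f x \<in> dparts0 (f ` N)" "x \<subseteq> Pow N \<times> Pow N" if "x \<in> dparts0 N" for x
  proof -
    have d: "dpart x" "supp x \<subseteq> N" "x = {} \<or> supp x = N" using that by (auto simp: dparts0_def dparts_def)
    then show "x \<subseteq> Pow N \<times> Pow N" by (intro dpart_subset_Pow)
    have "dpart (dmap f x)" by (rule dpart_dmap[OF d(1) inj_on_subset[OF f d(2)]])
    then show "dmap f x \<in> dparts0 (f ` N)"
      using d(3) by (auto simp: dparts0_def dparts_def supp_dmap dmap_simps)
  qed
  have "decode (dmap f x) = decode (dmap f y)" using eq relabel_decode[OF f] x y by simp
  then have "dmap f x = dmap f y" using inj_onD[OF decode_inj] dm(1) x y by blast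
  moreover have "inj_on (map_prod ((`) f) ((`) f)) (Pow N \<times> Pow N)"
    using map_prod_inj_on[OF inj_on_image_Pow[OF f] inj_on_image_Pow[OF f]] .
  ultimately have "x = y" unfolding dmap_def using inj_on_image_eq_iff dm(2) x y by metis
  then show "decode x = decode y" by simp
qed

lemma trees_image:
  assumes f: "inj_on f N"
  shows "trees (f ` N) = map_planar_tree f ` trees N"
proof (intro equalityI subsetI)
  fix t assume t: "t \<in> trees (f ` N)"
  let ?g = "inv_into N f"
  have l: "distinct (leaves t)" "set (leaves t) = f ` N" using t by (auto simp: trees_def enumerations_def)
  have "map_planar_tree f (map_planar_tree ?g t) = map_planar_tree id t"
    unfolding planar_tree.map_comp
    by (rule planar_tree.map_cong) (use l in \<open>auto simp: set_planar_tree_leaves f_inv_into_f\<close>)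
  then have "t = map_planar_tree f (map_planar_tree ?g t)" by (simp add: planar_tree.map_id)
  moreover have "map_planar_tree ?g t \<in> trees N"
    using l inj_on_inv_into[of "f ` N" f N] f
    by (auto simp: trees_def enumerations_def leaves_map distinct_map)
  ultimately show "t \<in> map_planar_tree f ` trees N" by blast
next
  fix t assume "t \<in> map_planar_tree f ` trees N"
  then show "t \<in> trees (f ` N)"
    using f by (auto simp: trees_def enumerations_def leaves_map distinct_map)
qed

lemma map_tree_inj:
  assumes f: "inj_on f N"
  shows "inj_on (map_planar_tree f) (trees N)"
proof (rule inj_on_inverseI)
  fix t assume t: "t \<in> trees N"
  have "map_planar_tree (inv_into N f) (map_planar_tree f t) = map_planar_tree id t"
    unfolding planar_tree.map_comp
    by (rule planar_tree.map_cong) (use t f in \<open>auto simp: set_planar_tree_leaves trees_def enumerations_def inv_into_f_f\<close>)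
  then show "map_planar_tree (inv_into N f) (map_planar_tree f t) = t" by (simp add: planar_tree.map_id)
qed

text \<open>No sign appears: the transported \<open>\<omega>\<close> takes at the leaves of the
  relabelled tree the value of \<open>\<omega>\<close> at the leaves of \<open>t\<close>, and the
  transported cycle has the old coefficient at the relabelled chain. Both sides become the same sum
  over \<open>trees N\<close>.\<close>

lemma tree_map_natural:
  fixes z :: "'a decorated_partition option list \<Rightarrow>\<^sub>0 'k::field"
  assumes N: "finite N" and f: "inj_on f N" and z: "z \<in> top_cycles N"
  shows "tree_map (f ` N) (map_prod (transport homology_species N f) (transport sgn_species N f) ({z}, \<omega>))
     = pushforward (map_planar_tree f) (tree_map N ({z}, \<omega>))"
proof -
  let ?M = "map_option (relabel N f)"
  have "Poly_Mapping.lookup (pushforward (map ?M) z) (mchain (map_planar_tree f t)) = Poly_Mapping.lookup z (mchain t)"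
    if t: "t \<in> trees N" for t
  proof -
    have ne: "N \<noteq> {}" using t trees_empty by auto
    have "inj_on (map ?M) (lists (Pi_CTA_plus N))"
      by (rule inj_on_mapI, rule inj_on_subset[OF relabel_inj[OF f ne]]) auto
    moreover have "mchain t \<in> lists (Pi_CTA_plus N)" using top_cycles_coordinates(5)[OF N t] by auto
    ultimately show ?thesis
      unfolding mchain_map[OF f N t] using keys_top_cycles[OF z] by (intro lookup_pushforward_inj)
  qed
  moreover have "transport sgn_species N f \<omega> (leaves (map_planar_tree f t)) = \<omega> (leaves t)" if t: "t \<in> trees N" for t
  proof -
    have l: "distinct (leaves t)" "set (leaves t) = N" using t by (auto simp: trees_def enumerations_def)
    then have "map (inv_into N f) (map f (leaves t)) = leaves t" using f by (auto intro: map_idI simp: inv_into_f_f)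
    moreover have "map f (leaves t) \<in> enumerations (f ` N)" using l f by (simp add: enumerations_def distinct_map)
    ultimately show ?thesis by (simp add: sgn_species_def leaves_map)
  qed
  ultimately have "tree_map (f ` N) (map_prod (transport homology_species N f) (transport sgn_species N f) ({z}, \<omega>))
      = (\<Sum>t\<in>trees N. Poly_Mapping.single (map_planar_tree f t) (Poly_Mapping.lookup z (mchain t) * \<omega> (leaves t)))"
    unfolding tree_map_def trees_image[OF f] by (simp add: sum.reindex[OF map_tree_inj[OF f]] homology_species_def)
  then show ?thesis
    by (simp add: tree_map_def pushforward_linext linext_sum)
qed

theorem Lambda_h_CTA_isomorphic_Mag:
  "species_isomorphic (Lambda_h_CTA :: ('a, 'k::field, _) species) (Mag :: ('a, 'k, _) species)"
proof -
  let ?\<phi> = "\<lambda>N C. linext (tree_map N :: _ \<Rightarrow> 'a planar_tree \<Rightarrow>\<^sub>0 'k) (SOME c. c \<in> C)"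
  have sp: "space (Lambda_h_CTA :: ('a, 'k, _) species) N = quotient_space
      (free_space (carrier (space (homology_species :: ('a, 'k, _) species) N) \<times> carrier (sgn_space N)))
      (tensor_relations (space homology_species N) (sgn_space N))" for N :: "'a set"
    by (simp add: Lambda_h_CTA_def hadamard_def tensor_space_def sgn_species_def)
  have mag: "space (Mag :: ('a, 'k, _) species) N = free_space (trees N)" for N :: "'a set"
    by (simp add: Mag_def trees_def)
  show ?thesis
    unfolding species_isomorphic_def
  proof (intro exI[of _ ?\<phi>] conjI allI impI ballI)
    fix N :: "'a set" assume N: "finite N"
    show "linear_iso (space (Lambda_h_CTA :: ('a, 'k, _) species) N) (space Mag N) (?\<phi> N)"
      unfolding sp mag by (rule tree_map_iso(1)[OF N])
  next
    fix N N' :: "'a set" and f C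
    assume N: "finite N" and f: "bij_betw f N N'" and C: "C \<in> carrier (space (Lambda_h_CTA :: ('a, 'k, _) species) N)"
    have inj: "inj_on f N" and N': "N' = f ` N" using f by (auto simp: bij_betw_def)
    let ?H = "space (homology_species :: ('a, 'k, _) species) N"
    let ?F = "free_space (carrier ?H \<times> carrier (sgn_space N)) :: ('k, _) module"
    let ?U = "tensor_relations ?H (sgn_space N)"
    let ?m = "map_prod (transport homology_species N f) (transport sgn_species N f)
        :: (_ \<Rightarrow>\<^sub>0 'k) set \<times> ('a list \<Rightarrow> 'k) \<Rightarrow> _"
    obtain x where x: "x \<in> carrier ?F" "C = (\<lambda>u. u + x) ` ?U"
      using C unfolding sp tree_map_iso(4)[OF N] by blast
    \<comment> \<open>Transport takes the elementwise image of the coset, from which the isomorphism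
      then picks an unspecified representative; so the value is computed for every
      \<open>c \<in> C\<close>.\<close>
    have val: "linext (tree_map N') (pushforward ?m c) = pushforward (map_planar_tree f) (linext (tree_map N) x)"
      if c: "c \<in> C" for c
    proof -
      obtain u where u: "u \<in> ?U" "c = u + x" using c x(2) by blast
      have keys: "Poly_Mapping.keys c \<subseteq> carrier ?H \<times> carrier (sgn_space N)"
        using tensor_relations_free[OF N u(1)] x(1) u(2) by (simp add: free_space_def keys_add_subset)
      have "linext (tree_map N') (pushforward ?m c) = linext (\<lambda>p. tree_map N' (?m p)) c"
        by (simp add: pushforward_linext linext_linext)
      also have "\<dots> = linext (\<lambda>p. pushforward (map_planar_tree f) (tree_map N p)) c"
      proof (rule linext_cong)
        fix p assume "p \<in> Poly_Mapping.keys c"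
        then have "fst p \<in> carrier ?H" using keys by auto
        then obtain z where "z \<in> top_cycles N" "fst p = {z}" unfolding homology_space(1)[OF N] by blast
        then show "tree_map N' (?m p) = pushforward (map_planar_tree f) (tree_map N p)"
          using tree_map_natural[OF N inj, of z "snd p"] unfolding N' by (cases p) simp
      qed
      also have "\<dots> = pushforward (map_planar_tree f) (linext (tree_map N) c)"
        by (simp add: pushforward_linext linext_linext)
      also have "linext (tree_map N) c = linext (tree_map N) x"
        by (rule tree_map_iso(2)[OF N]) (use c x(2) in simp)
      finally show ?thesis .
    qed
    have tr: "transport (Lambda_h_CTA :: ('a, 'k, _) species) N f C = pushforward ?m ` C"
      by (simp add: Lambda_h_CTA_def hadamard_def)
    have "C \<noteq> {}" unfolding x(2) using tensor_relations.zero by blast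
    then have "(SOME c. c \<in> pushforward ?m ` C) \<in> pushforward ?m ` C" by (simp add: some_in_eq)
    then obtain c where c: "c \<in> C" "(SOME c. c \<in> pushforward ?m ` C) = pushforward ?m c" by blast
    have "?\<phi> N' (transport (Lambda_h_CTA :: ('a, 'k, _) species) N f C) = pushforward (map_planar_tree f) (linext (tree_map N) x)"
      unfolding tr c(2) by (rule val[OF c(1)])
    also have "linext (tree_map N) x = ?\<phi> N C"
      unfolding x(2) by (rule tree_map_iso(3)[OF N, symmetric])
    finally show "?\<phi> N' (transport (Lambda_h_CTA :: ('a, 'k, _) species) N f C) = transport Mag N f (?\<phi> N C)"
      by (simp add: Mag_def)
  qed
qed

theorem theorem4p6:
  shows "(\<forall>N :: 'a set. finite N \<and> N \<noteq> {} \<longrightarrow>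
            cohen_macaulay TYPE('k::field_char_0) (Pi_CTA_plus N) (Pi_CTA_plus_order N))
       \<and> species_isomorphic (Lambda_h_CTA :: ('a, 'k, _) species) (Mag :: ('a, 'k, _) species)"
  using cohen_macaulay_Pi_CTA_plus Lambda_h_CTA_isomorphic_Mag by blast

end
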